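(* Let $0<\delta<1$, $0<b_0<b_1<1$ and $C\ge1$. Let $F\subset B_{\mathfrak r}(0,b_1)$ be a finite set such that $$\frac{\#(B_{\mathfrak r}(Z,b)\cap F)}{\#F}\le C(b/b_1)^\delta\quad\text{for all } Z\in\mathfrak r \text{ and all } b\ge b_0.$$ Let $0<\varepsilon<\delta/100$. Then there exists a measurable $B\subset B_1^U$ with $|B_1^U\setminus B|\le 0.01|B_1^U|$ such that for every $u_{\mathbf s}\in B$ there exists $F_{\mathbf s}\subset F$ with $\#(F\setminus F_{\mathbf s})\le 0.01\,\#F$ and such that for all $Z\in F_{\mathbf s}$ and all $b\ge b_0$, $$\#\{Z'\in F_{\mathbf s}:|\xi_{\mathbf s}(Z')-\xi_{\mathbf s}(Z)|\le b\}\le C_\varepsilon (b_0/b_1)^{-\varepsilon}(b/b_1)^\delta\,\#F,$$ where $C_\varepsilon$ depends only on $C$, $\varepsilon$ and $n$.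
   Context: Fix $n\ge3$. For $\mathbf s\in\mathbb R^{n-2}$, $u_{\mathbf s}$ denotes the unipotent matrix $n(\mathbf s,0)$ in $\mathrm{SO}^\circ(n,1)$, and $B_1^U=\{u_{\mathbf s}:\|\mathbf s\|\le1\}$ is identified with the closed Euclidean unit ball of $\mathbb R^{n-2}$, with Lebesgue measure $|\cdot|$ normalized so that $|B_1^U|=1$. $\mathfrak r$ is the orthogonal complement of $\mathrm{Lie}(\mathrm{SO}^\circ(n-1,1))$ in $\mathrm{Lie}(\mathrm{SO}^\circ(n,1))$, identified with $\mathbb R^n=\{(r_1,\mathbf c,r_2):r_1,r_2\in\mathbb R,\mathbf c\in\mathbb R^{n-2}\}$ (elements written $Z(r_1,\mathbf c,r_2)$) and equipped with the max norm; $B_{\mathfrak r}(Z,b)$ is the closed ball of radius $b$. One has $\mathrm{Ad}(u_{\mathbf s})Z(r_1,\mathbf c,r_2)=Z(r_1+\mathbf s\cdot\mathbf c+r_2\|\mathbf s\|^2/2,\ \mathbf c+r_2\mathbf s,\ r_2)$, and $\xi_{\mathbf s}:\mathfrak r\to\mathbb R$ is $\xi_{\mathbf s}(Z(r_1,\mathbf c,r_2))=r_1+\mathbf s\cdot\mathbf c+r_2\|\mathbf s\|^2/2$ (the component of $\mathrm{Ad}(u_{\mathbf s})Z$ in the $e^t$-expanding direction of $a_t=\mathrm{diag}(e^t,1,\dots,1,e^{-t})$). *)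

theory Defs
  imports "HOL-Analysis.Analysis"
begin

text \<open>The complement r of Lie(SO(n-1,1)) in Lie(SO(n,1)) is identified with
  R x R^(n-2) x R; an element Z(r1,c,r2) is the triple (r1, c, r2).
  The index type 'm has CARD('m) = n - 2 (n >= 3 means CARD('m) >= 1, automatic).\<close>

type_synonym 'm rvec = "real \<times> (real^'m) \<times> real"

definition rnorm :: "'m::finite rvec \<Rightarrow> real" where
  "rnorm Z = (case Z of (r1, c, r2) \<Rightarrow> max \<bar>r1\<bar> (max (Max (range (\<lambda>i. \<bar>c $ i\<bar>))) \<bar>r2\<bar>))"

definition rball :: "'m::finite rvec \<Rightarrow> real \<Rightarrow> 'm rvec set" where
  "rball Z b = {Z'. rnorm (Z' - Z) \<le> b}"

definition xi :: "real^'m::finite \<Rightarrow> 'm rvec \<Rightarrow> real" where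
  "xi s Z = (case Z of (r1, c, r2) \<Rightarrow> r1 + s \<bullet> c + r2 * (norm s)\<^sup>2 / 2)"

text \<open>B_1^U identified with the closed Euclidean unit ball of R^(n-2).\<close>
definition BU :: "(real^'m::finite) set" where
  "BU = cball 0 1"

end

theory Submission
  imports Defs
begin

text \<open>
  For fixed \<open>Z\<close> and \<open>Z'\<close> the map \<open>s \<mapsto> xi s (Z' - Z)\<close> is a quadratic polynomial with coefficients of size
  \<open>D = rnorm (Z' - Z)\<close>. When \<open>s\<close> has at least two coordinates, its sublevel set at height \<open>b\<close> has measure
  \<open>O(b / D)\<close>, and averaging the number of \<open>Z'\<close> over \<open>s\<close> is enough.

  In one variable a quadratic may be nearly tangent to zero, and near tangencies have to be counted. Fix
  \<open>(s, Z)\<close> with too many neighbours at some height and take the smallest \<open>t\<close> for which too many lie within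
  distance \<open>t\<close>; then the neighbours at distance about \<open>t\<close> are too many. Sort them by the slope of the
  difference at \<open>s\<close>: slope about \<open>t / 2^k\<close> means that the two parabolas come within \<open>O(t / 4^k)\<close> of
  touching, at a distance \<open>O(2^(-k))\<close> from \<open>s\<close>. Averaging over an interval of this length reduces
  the bound to one on the number of near tangencies in a cell.

  Suppose that many cells contain too many tangencies. List, for each parabola, those that touch it from
  above, ordered by the point of contact. Two quadratics cross at most twice, so the common entries of two
  lists appear in reversed order up to a cyclic shift. A sum of squares of signs over dyadic blocks of the
  lists then bounds the number of common entries (the argument of Marcus and Tardos, up to a logarithm),
  while Cauchy-Schwarz bounds it from below. The minimality of \<open>t\<close> bounds how many parabolas share one cell.
\<close>

section \<open>Reversed lists\<close>

text \<open>Apart from powers of \<open>Y\<close>, the count of tangencies has nothing to spare. Put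
  \<open>P = 2 ^ k\<close> and \<open>x = (t / (64 * 4 ^ k)) powr \<delta>\<close>, and suppose that
  a fixed share of the roughly \<open>N P\<close> cells hold about \<open>x N\<close> tangents each.
  Since \<delta> < 1, the Frostman bound at distance \<open>t\<close> is a constant times
  \<open>P^2 x N\<close>, which limits the pairs of parabolas with a common tangent; the cubic
  inequality of \<open>incidence_bound\<close> then has \<open>N^6 P^3 x^3\<close> on both sides.
  The exponents of \<open>Y\<close> therefore decide. A cell may hold \<open>Y ^ 42\<close> times
  the expected number; summing over slopes gives 43, Markov's inequality spends 5 more (48), joining
  the two signs of the leading coefficient gives 49, adding up the distances 50. The bound with 50
  returns as the bound on coincidences within a cell, where it loses because the threshold 42 enters
  squared: 2 * 42 - 3 * 8 = 60 against 50 + 1, with 8 the exponent saved in the number of rich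
  cells. As \<open>Y\<close> is \<open>n + 1000\<close> and \<open>n\<close> is about log2 (b1 /
  b0), the whole loss is polylogarithmic.\<close>

lemma fiber_sum_square_le:
  fixes e :: "'a \<Rightarrow> real"
  assumes "finite S"
  shows "(\<Sum>h\<in>{h\<in>S. \<phi> h = c}. e h)\<^sup>2 \<le> (\<Sum>h\<in>S. \<Sum>k\<in>S. of_bool (\<phi> h = \<phi> k) * (e h * e k))"
proof -
  define T where "T y = (\<Sum>h\<in>{h\<in>S. \<phi> h = y}. e h)" for y
  have "(\<Sum>h\<in>S. \<Sum>k\<in>S. of_bool (\<phi> h = \<phi> k) * (e h * e k))
      = (\<Sum>y\<in>\<phi> ` S. \<Sum>h\<in>{h\<in>S. \<phi> h = y}. \<Sum>k\<in>S. of_bool (\<phi> h = \<phi> k) * (e h * e k))"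
    using assms by (rule sum.image_gen)
  also have "\<dots> = (\<Sum>y\<in>\<phi> ` S. (T y)\<^sup>2)"
  proof (rule sum.cong[OF refl])
    fix y
    have "(\<Sum>k\<in>S. of_bool (\<phi> h = \<phi> k) * (e h * e k)) = e h * T y" if "\<phi> h = y" for h
    proof -
      have "(\<Sum>k\<in>S. of_bool (\<phi> h = \<phi> k) * (e h * e k)) = (\<Sum>k\<in>{k\<in>S. \<phi> k = y}. e h * e k)"
        using assms that by (auto intro!: sum.mono_neutral_cong_right)
      then show ?thesis by (simp add: T_def sum_distrib_left)
    qed
    then have "(\<Sum>h\<in>{h\<in>S. \<phi> h = y}. \<Sum>k\<in>S. of_bool (\<phi> h = \<phi> k) * (e h * e k))
        = (\<Sum>h\<in>{h\<in>S. \<phi> h = y}. e h * T y)" by simp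
    also have "\<dots> = (T y)\<^sup>2" by (simp add: T_def sum_distrib_right power2_eq_square)
    finally show "(\<Sum>h\<in>{h\<in>S. \<phi> h = y}. \<Sum>k\<in>S. of_bool (\<phi> h = \<phi> k) * (e h * e k)) = (T y)\<^sup>2" .
  qed
  finally have eq: "(\<Sum>h\<in>S. \<Sum>k\<in>S. of_bool (\<phi> h = \<phi> k) * (e h * e k)) = (\<Sum>y\<in>\<phi> ` S. (T y)\<^sup>2)" .
  show ?thesis
  proof (cases "c \<in> \<phi> ` S")
    case True
    have "(T c)\<^sup>2 \<le> (\<Sum>y\<in>\<phi> ` S. (T y)\<^sup>2)"
      using True assms by (intro member_le_sum) auto
    then show ?thesis using eq by (simp add: T_def)
  next
    case False
    then have "{h\<in>S. \<phi> h = c} = {}" by auto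
    then have "(\<Sum>h\<in>{h\<in>S. \<phi> h = c}. e h)\<^sup>2 = 0" by (simp only: sum.empty) simp
    also have "\<dots> \<le> (\<Sum>y\<in>\<phi> ` S. (T y)\<^sup>2)" by (simp add: sum_nonneg)
    finally show ?thesis using eq by simp
  qed
qed

text \<open>Condition \<open>rev\<close> is what survives of the statement that two curves meet at most twice: write
  \<open>j f h\<close> for the place where \<open>h\<close> touches \<open>f\<close>. If \<open>h\<close> and \<open>k\<close> both touch \<open>f\<close> and \<open>g\<close>, then they occur in
  opposite orders along \<open>f\<close> and \<open>g\<close> exactly when they move in the same direction in passing from
  \<open>f\<close> to \<open>g\<close>; so the two lists are reversed up to a cyclic shift, as in Marcus and Tardos.\<close>

locale reversed_lists =
  fixes A :: "'a set" and B :: "'b set" and E :: "'a \<Rightarrow> 'b \<Rightarrow> bool" and j :: "'a \<Rightarrow> 'b \<Rightarrow> nat"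
    and K :: nat and \<mu> \<nu> \<rho> :: real
  assumes fin: "finite A" "finite B"
    and E_sub: "E f h \<Longrightarrow> f \<in> A \<and> h \<in> B"
    and j_less: "E f h \<Longrightarrow> j f h < 2 ^ K"
    and mu: "E f h \<Longrightarrow> real (card {g\<in>A. E g h \<and> j g h = j f h}) \<le> \<mu>"
    and nu: "real (card {k\<in>B. E f k \<and> j f k = i}) \<le> \<nu>"
    and pairs: "real (card {(f, g). f \<in> A \<and> g \<in> A \<and> (\<exists>h\<in>B. E f h \<and> E g h)}) \<le> \<rho>"
    and rev: "\<lbrakk>E f h; E f k; E g h; E g k; j f h \<noteq> j f k; j g h \<noteq> j g k; j f h \<noteq> j g h; j f k \<noteq> j g k\<rbrakk>
      \<Longrightarrow> sgn (real (j f h) - real (j f k)) * sgn (real (j g h) - real (j g k))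
        = - (sgn (real (j g h) - real (j f h)) * sgn (real (j g k) - real (j f k)))"
begin

definition S where "S f g = {h\<in>B. E f h \<and> E g h \<and> j f h \<noteq> j g h}"
definition con where "con f g = {h\<in>B. E f h \<and> E g h \<and> j f h = j g h}"
definition X :: real where "X = (\<Sum>f\<in>A. \<Sum>g\<in>A. real (card (S f g)))"
definition I :: real where "I = (\<Sum>f\<in>A. real (card {h\<in>B. E f h}))"
text \<open>The two positions of \<open>h\<close> lie in one dyadic block of length
  \<open>2 ^ Suc l\<close>, that on \<open>f\<close> in its left half and that on \<open>g\<close>
  in its right half. Sorting by the level of separation is what makes the sets fibres of a map into
  pairs of blocks.\<close>

definition Splus where "Splus l f g = {h\<in>S f g. j f h < j g h \<and> j f h div 2 ^ l \<noteq> j g h div 2 ^ l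
    \<and> j f h div 2 ^ Suc l = j g h div 2 ^ Suc l}"
definition blk :: "nat \<Rightarrow> 'a \<Rightarrow> 'b \<Rightarrow> 'b \<Rightarrow> real" where
  "blk l f h k = of_bool (E f h \<and> E f k \<and> j f h div 2 ^ l = j f k div 2 ^ l)"
definition Q :: "nat \<Rightarrow> real" where "Q l = (\<Sum>f\<in>A. \<Sum>h\<in>B. \<Sum>k\<in>B. blk l f h k)"

lemma finite_S [simp]: "finite (S f g)" using fin by (simp add: S_def)

lemma nu_nonneg: "\<nu> \<ge> 0" using nu[of undefined 0] by linarith
lemma rho_nonneg: "\<rho> \<ge> 0" using pairs by linarith
lemma X_nonneg: "X \<ge> 0" by (simp add: X_def sum_nonneg)
lemma I_nonneg: "I \<ge> 0" by (simp add: I_def sum_nonneg)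

lemma blk_nonneg [simp]: "blk l f h k \<ge> 0" by (simp add: blk_def)

lemma Q_le: "Q l \<le> \<nu> * 2 ^ l * I"
proof -
  have row: "(\<Sum>k\<in>B. blk l f h k) \<le> of_bool (E f h) * (\<nu> * 2 ^ l)" if "f \<in> A" "h \<in> B" for f h
  proof (cases "E f h")
    case True
    let ?m = "j f h div 2 ^ l"
    have "{k\<in>B. E f k \<and> j f k div 2 ^ l = ?m}
        \<subseteq> (\<Union>i\<in>{?m * 2 ^ l ..< ?m * 2 ^ l + 2 ^ l}. {k\<in>B. E f k \<and> j f k = i})"
    proof
      fix k assume k: "k \<in> {k\<in>B. E f k \<and> j f k div 2 ^ l = ?m}"
      then have "j f k = ?m * 2 ^ l + j f k mod 2 ^ l" by (metis (mono_tags, lifting) div_mult_mod_eq mem_Collect_eq)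
      moreover have "j f k mod 2 ^ l < 2 ^ l" by simp
      ultimately have "j f k \<in> {?m * 2 ^ l ..< ?m * 2 ^ l + 2 ^ l}" by (metis add_less_cancel_left atLeastLessThan_iff le_add1)
      then show "k \<in> (\<Union>i\<in>{?m * 2 ^ l ..< ?m * 2 ^ l + 2 ^ l}. {k\<in>B. E f k \<and> j f k = i})"
        using k by blast
    qed
    then have "card {k\<in>B. E f k \<and> j f k div 2 ^ l = ?m}
        \<le> card (\<Union>i\<in>{?m * 2 ^ l ..< ?m * 2 ^ l + 2 ^ l}. {k\<in>B. E f k \<and> j f k = i})"
      using fin by (intro card_mono) auto
    also have "\<dots> \<le> (\<Sum>i\<in>{?m * 2 ^ l ..< ?m * 2 ^ l + 2 ^ l}. card {k\<in>B. E f k \<and> j f k = i})"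
      by (intro card_UN_le) simp
    finally have "real (card {k\<in>B. E f k \<and> j f k div 2 ^ l = ?m})
        \<le> (\<Sum>i\<in>{?m * 2 ^ l ..< ?m * 2 ^ l + 2 ^ l}. real (card {k\<in>B. E f k \<and> j f k = i}))"
      by (simp add: of_nat_sum[symmetric] del: of_nat_sum)
    also have "\<dots> \<le> (\<Sum>i\<in>{?m * 2 ^ l ..< ?m * 2 ^ l + 2 ^ l}. \<nu>)"
      by (intro sum_mono nu)
    also have "\<dots> = \<nu> * 2 ^ l" by simp
    finally have "real (card {k\<in>B. E f k \<and> j f k div 2 ^ l = ?m}) \<le> \<nu> * 2 ^ l" .
    moreover have "(\<Sum>k\<in>B. blk l f h k) = real (card {k\<in>B. E f k \<and> j f k div 2 ^ l = ?m})"
      using True fin by (simp add: blk_def sum_of_bool_eq Int_def eq_commute conj_commute)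
    ultimately show ?thesis using True by simp
  qed (simp add: blk_def)
  have "Q l \<le> (\<Sum>f\<in>A. \<Sum>h\<in>B. of_bool (E f h) * (\<nu> * 2 ^ l))"
    unfolding Q_def by (intro sum_mono row)
  also have "\<dots> = (\<Sum>f\<in>A. real (card {h\<in>B. E f h}) * (\<nu> * 2 ^ l))"
    using fin by (simp add: sum_distrib_right[symmetric] sum_of_bool_eq Int_def)
  also have "\<dots> = \<nu> * 2 ^ l * I"
    by (simp add: I_def sum_distrib_left sum_distrib_right mult_ac)
  finally show ?thesis .
qed

text \<open>If the parent blocks of \<open>h\<close> and \<open>k\<close> differed, both lists would
  show them in the same order although both move to the right, contrary to \<open>rev\<close>.
  Inside a common parent, \<open>f\<close> sees the left child and \<open>g\<close> the right
  one.\<close>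

lemma Splus_same_block:
  assumes "h \<in> Splus l f g" "k \<in> Splus l f g"
  shows "j f h div 2 ^ l = j f k div 2 ^ l \<and> j g h div 2 ^ l = j g k div 2 ^ l"
proof -
  have less: False if "h \<in> Splus l f g" "k \<in> Splus l f g" "j f h div 2 ^ Suc l < j f k div 2 ^ Suc l" for h k
  proof -
    have hk: "E f h" "E g h" "E f k" "E g k" "j f h < j g h" "j f k < j g k"
      "j f h div 2 ^ Suc l = j g h div 2 ^ Suc l" "j f k div 2 ^ Suc l = j g k div 2 ^ Suc l"
      using that by (auto simp: Splus_def S_def)
    have "j f h < j f k" using that(3) by (meson div_le_mono leD leI)
    moreover have "j g h < j g k" using that(3) hk(7,8) by (metis div_le_mono leD leI)
    ultimately show False using rev[of f h k g] hk by (simp add: sgn_if)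
  qed
  have par: "j f h div 2 ^ Suc l = j f k div 2 ^ Suc l"
    using less assms by (meson nat_neq_iff)
  have child: "j f h div 2 ^ l = 2 * (j f h div 2 ^ Suc l) \<and> j g h div 2 ^ l = 2 * (j f h div 2 ^ Suc l) + 1"
    if "h \<in> Splus l f g" for h
  proof -
    have hk: "j f h < j g h" "j f h div 2 ^ l \<noteq> j g h div 2 ^ l" "j f h div 2 ^ Suc l = j g h div 2 ^ Suc l"
      using that by (auto simp: Splus_def)
    have "j f h div 2 ^ l \<le> j g h div 2 ^ l" using hk(1) by (intro div_le_mono) simp
    then have lt: "j f h div 2 ^ l < j g h div 2 ^ l" using hk(2) by simp
    have d: "a div 2 ^ Suc l = a div 2 ^ l div 2" for a :: nat
      by (metis div_mult2_eq power_Suc2)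
    have two: "a = 2 * (a div 2) \<and> b = 2 * (a div 2) + 1" if "a < b" "a div 2 = b div 2" for a b :: nat
      using that by presburger
    show ?thesis using two[OF lt] hk(3) unfolding d by simp
  qed
  show ?thesis using child[OF assms(1)] child[OF assms(2)] par by simp
qed

text \<open>The product of the two factors lives on pairs \<open>h\<close>, \<open>k\<close> that
  share a block on both lists, and there \<open>rev\<close> turns it into minus the product of the
  directions in which \<open>h\<close> and \<open>k\<close> move. The exceptions are paid for
  separately: ties within one list by \<nu>, entries with equal positions on both lists by
  \<open>con\<close>.\<close>

lemma pair_estimate:
  fixes l :: nat
  assumes "f \<in> A" "g \<in> A"
  defines "\<tau> \<equiv> \<lambda>f h k. blk l f h k * sgn (real (j f h) - real (j f k))"
  shows "(\<Sum>h\<in>B. \<Sum>k\<in>B. \<tau> f h k * \<tau> g h k)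
    \<le> - (real (card (Splus l f g)))\<^sup>2 + 2 * \<nu> * real (card (S f g))
      + (\<Sum>h\<in>B. \<Sum>k\<in>B. blk l f h k * (of_bool (h \<in> con f g) + of_bool (k \<in> con f g)))"
proof -
  let ?e = "\<lambda>h. sgn (real (j g h) - real (j f h))"
  let ?\<phi> = "\<lambda>h. (j f h div 2 ^ l, j g h div 2 ^ l)"
  let ?s = "\<lambda>h. of_bool (h \<in> S f g) :: real"
  have pt: "\<tau> f h k * \<tau> g h k \<le> - (?s h * ?s k * (of_bool (?\<phi> h = ?\<phi> k) * (?e h * ?e k)))
      + ?s h * ?s k * (of_bool (j f h = j f k) + of_bool (j g h = j g k))
      + blk l f h k * (of_bool (h \<in> con f g) + of_bool (k \<in> con f g))" (is "?L \<le> ?R")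
    if hk: "h \<in> B" "k \<in> B" for h k
  proof (cases "h \<in> S f g \<and> k \<in> S f g")
    case True
    then have EE: "E f h" "E f k" "E g h" "E g k" "j f h \<noteq> j g h" "j f k \<noteq> j g k"
      and nc: "h \<notin> con f g" "k \<notin> con f g"
      by (auto simp: S_def con_def)
    show ?thesis
    proof (cases "?\<phi> h = ?\<phi> k")
      case False
      then have "?L = 0" by (auto simp: \<tau>_def blk_def)
      moreover have "(of_bool (?\<phi> h = ?\<phi> k) :: real) = 0" using False by simp
      ultimately show ?thesis using nc by (simp only:) simp
    next
      case same: True
      show ?thesis
      proof (cases "j f h = j f k \<or> j g h = j g k")
        case True
        then have "?L = 0" by (auto simp: \<tau>_def)
        moreover have "?e h * ?e k \<le> 1" by (simp add: sgn_if)
        moreover have "of_bool (j f h = j f k) + of_bool (j g h = j g k) \<ge> (1::real)" using True by auto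
        moreover have "?s h = 1" "?s k = 1" "of_bool (h \<in> con f g) = (0::real)" "of_bool (k \<in> con f g) = (0::real)"
          "of_bool (?\<phi> h = ?\<phi> k) = (1::real)"
          using same \<open>h \<in> S f g \<and> k \<in> S f g\<close> nc by simp_all
        ultimately show ?thesis by (simp only: mult_1_left add_0_left mult_zero_right add_0_right)
      next
        case False
        then show ?thesis using rev[of f h k g] EE same \<open>h \<in> S f g \<and> k \<in> S f g\<close> nc
          by (simp add: \<tau>_def blk_def)
      qed
    qed
  next
    case False
    show ?thesis
    proof (cases "E f h \<and> E f k \<and> E g h \<and> E g k \<and> j f h div 2 ^ l = j f k div 2 ^ l")
      case True
      then have "h \<in> con f g \<or> k \<in> con f g" using False hk by (auto simp: S_def con_def)
      moreover have "?L \<le> 1" by (simp add: \<tau>_def blk_def sgn_if)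
      moreover have "?s h * ?s k = 0" using False by simp
      moreover have "blk l f h k = 1" using True by (simp add: blk_def)
      ultimately show ?thesis
        by (simp only: mult_zero_left minus_zero add_0_left mult_1_left) auto
    next
      case False
      then have "?L = 0" by (auto simp: \<tau>_def blk_def)
      moreover have "?s h * ?s k = 0" using \<open>\<not> (h \<in> S f g \<and> k \<in> S f g)\<close> by simp
      moreover have "0 \<le> blk l f h k * (of_bool (h \<in> con f g) + of_bool (k \<in> con f g))" by simp
      ultimately show ?thesis by (simp only: mult_zero_left minus_zero add_0_left)
    qed
  qed
  have SB: "S f g \<subseteq> B" by (auto simp: S_def)
  have restr: "(\<Sum>h\<in>B. \<Sum>k\<in>B. ?s h * ?s k * F h k) = (\<Sum>h\<in>S f g. \<Sum>k\<in>S f g. F h k)" for F :: "'b \<Rightarrow> 'b \<Rightarrow> real"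
  proof -
    have "(\<Sum>k\<in>B. ?s h * ?s k * F h k) = ?s h * (\<Sum>k\<in>S f g. F h k)" for h
    proof -
      have "(\<Sum>k\<in>B. ?s h * ?s k * F h k) = (\<Sum>k\<in>S f g. ?s h * F h k)"
        using fin SB by (intro sum.mono_neutral_cong_right) auto
      then show ?thesis by (simp add: sum_distrib_left)
    qed
    then have "(\<Sum>h\<in>B. \<Sum>k\<in>B. ?s h * ?s k * F h k) = (\<Sum>h\<in>B. ?s h * (\<Sum>k\<in>S f g. F h k))" by simp
    also have "\<dots> = (\<Sum>h\<in>S f g. \<Sum>k\<in>S f g. F h k)"
      using fin SB by (intro sum.mono_neutral_cong_right) auto
    finally show ?thesis .
  qed
  \<comment> \<open>A nonempty \<open>Splus l f g\<close> is a full fibre of \<open>?\<phi>\<close>,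
    on which every sign \<open>?e\<close> is 1; its squared cardinality is thus one summand of a sum
    of squares.\<close>
  have sq: "(real (card (Splus l f g)))\<^sup>2
      \<le> (\<Sum>h\<in>S f g. \<Sum>k\<in>S f g. of_bool (?\<phi> h = ?\<phi> k) * (?e h * ?e k))"
  proof (cases "Splus l f g = {}")
    case True
    have "0 \<le> (\<Sum>h\<in>{h\<in>S f g. ?\<phi> h = (0,0)}. ?e h)\<^sup>2" by simp
    also have "\<dots> \<le> (\<Sum>h\<in>S f g. \<Sum>k\<in>S f g. of_bool (?\<phi> h = ?\<phi> k) * (?e h * ?e k))"
      by (rule fiber_sum_square_le) simp
    finally show ?thesis using True by simp
  next
    case False
    then obtain k where k: "k \<in> Splus l f g" by auto
    then have k': "k \<in> S f g" "j f k div 2 ^ l \<noteq> j g k div 2 ^ l" "j f k < j g k"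
      "j f k div 2 ^ Suc l = j g k div 2 ^ Suc l" by (auto simp: Splus_def)
    have fib: "Splus l f g = {h\<in>S f g. ?\<phi> h = ?\<phi> k}"
    proof (intro equalityI subsetI)
      fix h assume h: "h \<in> Splus l f g"
      then have "h \<in> S f g" by (simp add: Splus_def)
      then show "h \<in> {h\<in>S f g. ?\<phi> h = ?\<phi> k}" using Splus_same_block[OF h k] by simp
    next
      fix h assume h: "h \<in> {h\<in>S f g. ?\<phi> h = ?\<phi> k}"
      have "j f k div 2 ^ l < j g k div 2 ^ l"
        using k'(2,3) div_le_mono[of "j f k" "j g k" "2 ^ l"] by simp
      then have "j f h div 2 ^ l < j g h div 2 ^ l" using h by simp
      then have "j f h < j g h" using div_le_mono[of "j g h" "j f h" "2 ^ l"] by linarith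
      moreover have d: "a div 2 ^ Suc l = a div 2 ^ l div 2" for a :: nat
        by (metis div_mult2_eq power_Suc2)
      ultimately show "h \<in> Splus l f g" using h k' unfolding Splus_def d by auto
    qed
    have "real (card (Splus l f g)) = (\<Sum>h\<in>Splus l f g. ?e h)"
    proof -
      have "(\<Sum>h\<in>Splus l f g. ?e h) = (\<Sum>h\<in>Splus l f g. 1)"
        by (intro sum.cong refl) (auto simp: Splus_def)
      then show ?thesis by simp
    qed
    then have "(real (card (Splus l f g)))\<^sup>2 = (\<Sum>h\<in>{h\<in>S f g. ?\<phi> h = ?\<phi> k}. ?e h)\<^sup>2"
      unfolding fib by simp
    also have "\<dots> \<le> (\<Sum>h\<in>S f g. \<Sum>k\<in>S f g. of_bool (?\<phi> h = ?\<phi> k) * (?e h * ?e k))"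
      by (rule fiber_sum_square_le) simp
    finally show ?thesis .
  qed
  have nuS: "(\<Sum>k\<in>S f g. of_bool (j f h = j f k) + of_bool (j g h = j g k)) \<le> 2 * \<nu>" for h
  proof -
    have "(\<Sum>k\<in>S f g. of_bool (j f h = j f k) :: real) \<le> real (card {k\<in>B. E f k \<and> j f k = j f h})"
      using fin by (simp add: sum_of_bool_eq) (auto intro!: card_mono simp: S_def)
    moreover have "(\<Sum>k\<in>S f g. of_bool (j g h = j g k) :: real) \<le> real (card {k\<in>B. E g k \<and> j g k = j g h})"
      using fin by (simp add: sum_of_bool_eq) (auto intro!: card_mono simp: S_def)
    ultimately show ?thesis using nu[of f "j f h"] nu[of g "j g h"] by (simp add: sum.distrib)
  qed
  have "(\<Sum>h\<in>B. \<Sum>k\<in>B. \<tau> f h k * \<tau> g h k)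
    \<le> (\<Sum>h\<in>B. \<Sum>k\<in>B. - (?s h * ?s k * (of_bool (?\<phi> h = ?\<phi> k) * (?e h * ?e k)))
      + ?s h * ?s k * (of_bool (j f h = j f k) + of_bool (j g h = j g k))
      + blk l f h k * (of_bool (h \<in> con f g) + of_bool (k \<in> con f g)))"
    by (intro sum_mono pt)
  also have "\<dots> = - (\<Sum>h\<in>S f g. \<Sum>k\<in>S f g. of_bool (?\<phi> h = ?\<phi> k) * (?e h * ?e k))
      + (\<Sum>h\<in>S f g. \<Sum>k\<in>S f g. of_bool (j f h = j f k) + of_bool (j g h = j g k))
      + (\<Sum>h\<in>B. \<Sum>k\<in>B. blk l f h k * (of_bool (h \<in> con f g) + of_bool (k \<in> con f g)))"
    unfolding restr[symmetric] by (simp only: sum.distrib sum_negf)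
  also have "(\<Sum>h\<in>S f g. \<Sum>k\<in>S f g. of_bool (j f h = j f k) + of_bool (j g h = j g k)) \<le> (\<Sum>h\<in>S f g. 2 * \<nu>)"
    by (intro sum_mono nuS)
  finally show ?thesis using sq by (simp add: mult_ac)
qed

text \<open>Expanding \<open>0 \<le> (\<Sum>h,k. (\<Sum>f. \<tau> f h k)\<^sup>2)\<close>, condition \<open>rev\<close> turns the term of a pair
  \<open>(f, g)\<close> into minus a sum of squares, one of which is the square of the cardinality of \<open>Splus l f g\<close>.\<close>

lemma level_estimate: "(\<Sum>f\<in>A. \<Sum>g\<in>A. (real (card (Splus l f g)))\<^sup>2) \<le> 2 * \<mu> * Q l + 2 * \<nu> * X"
proof -
  define \<tau> where "\<tau> = (\<lambda>f h k. blk l f h k * sgn (real (j f h) - real (j f k)))"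
  have conh: "(\<Sum>g\<in>A. of_bool (h \<in> con f g)) \<le> \<mu>" if "E f h" for f h
  proof -
    have "(\<Sum>g\<in>A. of_bool (h \<in> con f g)) = real (card {g\<in>A. E g h \<and> j g h = j f h})"
      using fin that E_sub[OF that] by (simp add: sum_of_bool_eq Int_def con_def eq_commute conj_commute)
    then show ?thesis using mu[OF that] by simp
  qed
  have "0 \<le> (\<Sum>h\<in>B. \<Sum>k\<in>B. (\<Sum>f\<in>A. \<tau> f h k)\<^sup>2)"
    by (intro sum_nonneg) simp
  also have "\<dots> = (\<Sum>h\<in>B. \<Sum>k\<in>B. \<Sum>f\<in>A. \<Sum>g\<in>A. \<tau> f h k * \<tau> g h k)"
    by (simp add: power2_eq_square sum_product)
  also have "\<dots> = (\<Sum>h\<in>B. \<Sum>f\<in>A. \<Sum>k\<in>B. \<Sum>g\<in>A. \<tau> f h k * \<tau> g h k)"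
    by (intro sum.cong refl sum.swap)
  also have "\<dots> = (\<Sum>f\<in>A. \<Sum>h\<in>B. \<Sum>k\<in>B. \<Sum>g\<in>A. \<tau> f h k * \<tau> g h k)"
    by (rule sum.swap)
  also have "\<dots> = (\<Sum>f\<in>A. \<Sum>h\<in>B. \<Sum>g\<in>A. \<Sum>k\<in>B. \<tau> f h k * \<tau> g h k)"
    by (intro sum.cong refl sum.swap)
  also have "\<dots> = (\<Sum>f\<in>A. \<Sum>g\<in>A. \<Sum>h\<in>B. \<Sum>k\<in>B. \<tau> f h k * \<tau> g h k)"
    by (intro sum.cong refl sum.swap)
  also have "\<dots> \<le> (\<Sum>f\<in>A. \<Sum>g\<in>A. - (real (card (Splus l f g)))\<^sup>2 + 2 * \<nu> * real (card (S f g))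
      + (\<Sum>h\<in>B. \<Sum>k\<in>B. blk l f h k * (of_bool (h \<in> con f g) + of_bool (k \<in> con f g))))"
    unfolding \<tau>_def by (intro sum_mono pair_estimate)
  also have "\<dots> = - (\<Sum>f\<in>A. \<Sum>g\<in>A. (real (card (Splus l f g)))\<^sup>2) + 2 * \<nu> * X
      + (\<Sum>f\<in>A. \<Sum>g\<in>A. \<Sum>h\<in>B. \<Sum>k\<in>B. blk l f h k * (of_bool (h \<in> con f g) + of_bool (k \<in> con f g)))"
    by (simp add: sum.distrib sum_subtractf sum_negf X_def sum_distrib_left)
  also have "(\<Sum>f\<in>A. \<Sum>g\<in>A. \<Sum>h\<in>B. \<Sum>k\<in>B. blk l f h k * (of_bool (h \<in> con f g) + of_bool (k \<in> con f g)))
      = (\<Sum>f\<in>A. \<Sum>h\<in>B. \<Sum>g\<in>A. \<Sum>k\<in>B. blk l f h k * (of_bool (h \<in> con f g) + of_bool (k \<in> con f g)))"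
    by (intro sum.cong refl sum.swap)
  also have "\<dots> = (\<Sum>f\<in>A. \<Sum>h\<in>B. \<Sum>k\<in>B. \<Sum>g\<in>A. blk l f h k * (of_bool (h \<in> con f g) + of_bool (k \<in> con f g)))"
    by (intro sum.cong refl sum.swap)
  also have "\<dots> \<le> (\<Sum>f\<in>A. \<Sum>h\<in>B. \<Sum>k\<in>B. 2 * \<mu> * blk l f h k)"
  proof (intro sum_mono)
    fix f h k
    show "(\<Sum>g\<in>A. blk l f h k * (of_bool (h \<in> con f g) + of_bool (k \<in> con f g))) \<le> 2 * \<mu> * blk l f h k"
    proof (cases "E f h \<and> E f k")
      case True
      then have "(\<Sum>g\<in>A. of_bool (h \<in> con f g) + of_bool (k \<in> con f g)) \<le> 2 * \<mu>"
        using conh[of f h] conh[of f k] unfolding sum.distrib by fastforce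
      then have "blk l f h k * (\<Sum>g\<in>A. of_bool (h \<in> con f g) + of_bool (k \<in> con f g)) \<le> blk l f h k * (2 * \<mu>)"
        by (rule mult_left_mono) simp
      then show ?thesis by (simp add: sum_distrib_left mult_ac)
    qed (auto simp: blk_def)
  qed
  also have "\<dots> = 2 * \<mu> * Q l" by (simp add: Q_def sum_distrib_left)
  finally show ?thesis by linarith
qed

text \<open>Two different positions below \<open>2 ^ K\<close> share a block at level
  \<open>K\<close> but not at level 0, so they separate at some level in between. Either position
  may be the smaller one, whence the factor 2.\<close>

lemma X_le_levels: "X \<le> 2 * (\<Sum>l<K. \<Sum>f\<in>A. \<Sum>g\<in>A. real (card (Splus l f g)))"
proof -
  have cover: "S f g \<subseteq> (\<Union>l<K. Splus l f g \<union> Splus l g f)" for f g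
  proof
    fix h assume h: "h \<in> S f g"
    let ?P = "\<lambda>l. j f h div 2 ^ l = j g h div 2 ^ l"
    have EE: "E f h" "E g h" "j f h \<noteq> j g h" "h \<in> B" using h by (auto simp: S_def)
    have "?P K" using j_less[OF EE(1)] j_less[OF EE(2)] by simp
    moreover have "\<not> ?P 0" using EE by simp
    moreover have "\<not> ?P m" if "\<not> ?P 0" "\<And>l. l < K \<Longrightarrow> \<not> ?P l \<Longrightarrow> \<not> ?P (Suc l)" "m \<le> K" for m
      using that(3) by (induction m) (use that(1,2) in auto)
    ultimately obtain l where l: "l < K" "\<not> ?P l" "?P (Suc l)"
      by blast
    then show "h \<in> (\<Union>l<K. Splus l f g \<union> Splus l g f)"
      using EE by (auto simp: Splus_def S_def intro!: bexI[of _ l])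
  qed
  have "real (card (S f g)) \<le> (\<Sum>l<K. real (card (Splus l f g)) + real (card (Splus l g f)))" for f g
  proof -
    have fS: "finite (Splus l f g)" for l f g unfolding Splus_def by simp
    have "card (S f g) \<le> card (\<Union>l<K. Splus l f g \<union> Splus l g f)"
      using cover by (intro card_mono) (auto simp: fS)
    also have "\<dots> \<le> (\<Sum>l<K. card (Splus l f g \<union> Splus l g f))" by (intro card_UN_le) simp
    also have "\<dots> \<le> (\<Sum>l<K. card (Splus l f g) + card (Splus l g f))" by (intro sum_mono card_Un_le)
    finally have "real (card (S f g)) \<le> real (\<Sum>l<K. card (Splus l f g) + card (Splus l g f))"
      by (simp only: of_nat_le_iff)
    then show ?thesis by simp
  qed
  then have "X \<le> (\<Sum>f\<in>A. \<Sum>g\<in>A. \<Sum>l<K. real (card (Splus l f g)) + real (card (Splus l g f)))"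
    unfolding X_def by (intro sum_mono)
  also have "\<dots> = (\<Sum>f\<in>A. \<Sum>g\<in>A. \<Sum>l<K. real (card (Splus l f g))) + (\<Sum>f\<in>A. \<Sum>g\<in>A. \<Sum>l<K. real (card (Splus l g f)))"
    by (simp add: sum.distrib)
  also have "(\<Sum>f\<in>A. \<Sum>g\<in>A. \<Sum>l<K. real (card (Splus l g f))) = (\<Sum>f\<in>A. \<Sum>g\<in>A. \<Sum>l<K. real (card (Splus l f g)))"
    by (rule sum.swap)
  also have "(\<Sum>f\<in>A. \<Sum>g\<in>A. \<Sum>l<K. real (card (Splus l f g))) = (\<Sum>f\<in>A. \<Sum>l<K. \<Sum>g\<in>A. real (card (Splus l f g)))"
    by (intro sum.cong refl sum.swap)
  also have "\<dots> = (\<Sum>l<K. \<Sum>f\<in>A. \<Sum>g\<in>A. real (card (Splus l f g)))" by (rule sum.swap)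
  finally show ?thesis by simp
qed

text \<open>Cauchy-Schwarz over the triples of a level and a pair with a common entry; there are at
  most \<open>K * \<rho>\<close> of them, and other pairs contribute nothing. The block term grows
  like \<open>2 ^ l\<close> and sums geometrically, whereas the tie term is paid once per
  level.\<close>

lemma X_square_le:
  assumes "\<mu> \<ge> 0"
  shows "X\<^sup>2 \<le> 8 * K * \<rho> * (\<mu> * \<nu> * 2 ^ K * I + K * \<nu> * X)"
proof -
  define PP where "PP = {(f, g). f \<in> A \<and> g \<in> A \<and> (\<exists>h\<in>B. E f h \<and> E g h)}"
  have finPP: "finite PP" unfolding PP_def
    by (rule finite_subset[of _ "A \<times> A"]) (use fin in auto)
  define cc where "cc = (\<lambda>(l, f, g). real (card (Splus l f g)))"
  let ?L = "\<Sum>l<K. \<Sum>f\<in>A. \<Sum>g\<in>A. real (card (Splus l f g))"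
  have flat: "(\<Sum>f\<in>A. \<Sum>g\<in>A. F (real (card (Splus l f g)))) = (\<Sum>p\<in>PP. F (cc (l, p)))"
    if "F 0 = (0::real)" for F l
  proof -
    have "(\<Sum>f\<in>A. \<Sum>g\<in>A. F (real (card (Splus l f g)))) = (\<Sum>p\<in>A\<times>A. F (cc (l, p)))"
      by (simp add: sum.cartesian_product cc_def case_prod_beta)
    also have "\<dots> = (\<Sum>p\<in>PP. F (cc (l, p)))"
    proof (rule sum.mono_neutral_right)
      show "\<forall>p\<in>A \<times> A - PP. F (cc (l, p)) = 0"
      proof
        fix p assume "p \<in> A \<times> A - PP"
        then have "Splus l (fst p) (snd p) = {}" by (auto simp: PP_def Splus_def S_def)
        then show "F (cc (l, p)) = 0" using that by (simp add: cc_def case_prod_beta)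
      qed
    qed (use fin in \<open>auto simp: PP_def\<close>)
    finally show ?thesis .
  qed
  have L: "?L = (\<Sum>q\<in>{..<K}\<times>PP. cc q)"
    using flat[of "\<lambda>x. x"] by (simp add: sum.cartesian_product)
  have L2: "(\<Sum>l<K. \<Sum>f\<in>A. \<Sum>g\<in>A. (real (card (Splus l f g)))\<^sup>2) = (\<Sum>q\<in>{..<K}\<times>PP. (cc q)\<^sup>2)"
    using flat[of "\<lambda>x. x\<^sup>2"] by (simp add: sum.cartesian_product)
  have "?L\<^sup>2 \<le> (\<Sum>q\<in>{..<K}\<times>PP. 1\<^sup>2) * (\<Sum>q\<in>{..<K}\<times>PP. (cc q)\<^sup>2)"
    unfolding L using Cauchy_Schwarz_ineq_sum[of "\<lambda>_. 1" cc "{..<K}\<times>PP"] by simp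
  also have "\<dots> = real K * real (card PP) * (\<Sum>l<K. \<Sum>f\<in>A. \<Sum>g\<in>A. (real (card (Splus l f g)))\<^sup>2)"
    by (simp add: L2 card_cartesian_product)
  also have "\<dots> \<le> real K * \<rho> * (2 * \<mu> * \<nu> * 2 ^ K * I + 2 * K * \<nu> * X)"
  proof (intro mult_mono)
    show "real (card PP) \<le> \<rho>" using pairs by (simp add: PP_def)
    have "(\<Sum>l<K. \<Sum>f\<in>A. \<Sum>g\<in>A. (real (card (Splus l f g)))\<^sup>2) \<le> (\<Sum>l<K. 2 * \<mu> * (\<nu> * 2 ^ l * I) + 2 * \<nu> * X)"
    proof (intro sum_mono)
      fix l
      have "2 * \<mu> * Q l \<le> 2 * \<mu> * (\<nu> * 2 ^ l * I)" using Q_le[of l] assms by (intro mult_left_mono) auto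
      then show "(\<Sum>f\<in>A. \<Sum>g\<in>A. (real (card (Splus l f g)))\<^sup>2) \<le> 2 * \<mu> * (\<nu> * 2 ^ l * I) + 2 * \<nu> * X"
        using level_estimate[of l] by linarith
    qed
    also have "\<dots> = 2 * \<mu> * \<nu> * I * (\<Sum>l<K. 2 ^ l) + 2 * K * \<nu> * X"
      by (simp add: sum.distrib sum_distrib_left mult_ac)
    also have "\<dots> \<le> 2 * \<mu> * \<nu> * I * 2 ^ K + 2 * K * \<nu> * X"
    proof -
      have "(\<Sum>l<K. 2 ^ l) \<le> (2::real) ^ K" by (induction K) auto
      then show ?thesis using assms nu_nonneg I_nonneg by (intro add_mono mult_left_mono) auto
    qed
    finally show "(\<Sum>l<K. \<Sum>f\<in>A. \<Sum>g\<in>A. (real (card (Splus l f g)))\<^sup>2) \<le> 2 * \<mu> * \<nu> * 2 ^ K * I + 2 * K * \<nu> * X"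
      by (simp add: mult_ac)
  qed (auto simp: rho_nonneg intro!: sum_nonneg)
  finally have "(2 * ?L)\<^sup>2 \<le> 4 * (real K * \<rho> * (2 * \<mu> * \<nu> * 2 ^ K * I + 2 * K * \<nu> * X))"
    by (simp add: power_mult_distrib)
  moreover have "X\<^sup>2 \<le> (2 * ?L)\<^sup>2" using X_le_levels X_nonneg by (rule power_mono)
  ultimately show ?thesis by (simp add: algebra_simps)
qed

text \<open>By Cauchy-Schwarz over \<open>B\<close>, squared degrees count pairs \<open>f\<close>,
  \<open>g\<close> on a common \<open>h\<close>; those at equal positions number at most \<mu> per
  incidence, and the rest make up \<open>X\<close>.\<close>

lemma I_square_le: "I\<^sup>2 \<le> real (card B) * (\<mu> * I + X)"
proof -
  let ?d = "\<lambda>h. \<Sum>f\<in>A. of_bool (E f h) :: real"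
  have Isum: "I = (\<Sum>f\<in>A. \<Sum>h\<in>B. of_bool (E f h))"
    unfolding I_def using fin by (simp add: sum_of_bool_eq Int_def)
  also have "\<dots> = (\<Sum>h\<in>B. ?d h)" by (rule sum.swap)
  finally have I': "I = (\<Sum>h\<in>B. ?d h)" .
  have "I\<^sup>2 \<le> (\<Sum>h\<in>B. 1\<^sup>2) * (\<Sum>h\<in>B. (?d h)\<^sup>2)"
    unfolding I' using Cauchy_Schwarz_ineq_sum[of "\<lambda>_. 1" ?d B] by simp
  also have "(\<Sum>h\<in>B. (?d h)\<^sup>2) = (\<Sum>h\<in>B. \<Sum>f\<in>A. \<Sum>g\<in>A. of_bool (E f h \<and> E g h))"
    by (simp add: power2_eq_square sum_product of_bool_conj)
  also have "\<dots> \<le> (\<Sum>h\<in>B. \<Sum>f\<in>A. \<mu> * of_bool (E f h) + (\<Sum>g\<in>A. of_bool (h \<in> S f g)))"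
  proof (intro sum_mono)
    fix h f assume "h \<in> B" "f \<in> A"
    show "(\<Sum>g\<in>A. of_bool (E f h \<and> E g h)) \<le> \<mu> * of_bool (E f h) + (\<Sum>g\<in>A. of_bool (h \<in> S f g) :: real)"
    proof (cases "E f h")
      case True
      have "(\<Sum>g\<in>A. of_bool (E f h \<and> E g h) :: real)
          = (\<Sum>g\<in>A. of_bool (E g h \<and> j g h = j f h) + of_bool (h \<in> S f g))"
        using True \<open>h \<in> B\<close> by (intro sum.cong refl) (auto simp: S_def)
      also have "\<dots> = real (card {g\<in>A. E g h \<and> j g h = j f h}) + (\<Sum>g\<in>A. of_bool (h \<in> S f g))"
        using fin by (simp add: sum.distrib sum_of_bool_eq Int_def)
      finally show ?thesis using mu[OF True] True by simp
    qed (simp add: sum_nonneg)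
  qed
  also have "\<dots> = \<mu> * I + (\<Sum>h\<in>B. \<Sum>f\<in>A. \<Sum>g\<in>A. of_bool (h \<in> S f g))"
    unfolding I' by (simp add: sum.distrib sum_distrib_left)
  also have "(\<Sum>h\<in>B. \<Sum>f\<in>A. \<Sum>g\<in>A. of_bool (h \<in> S f g) :: real) = (\<Sum>f\<in>A. \<Sum>h\<in>B. \<Sum>g\<in>A. of_bool (h \<in> S f g))"
    by (rule sum.swap)
  also have "\<dots> = (\<Sum>f\<in>A. \<Sum>g\<in>A. \<Sum>h\<in>B. of_bool (h \<in> S f g))"
    by (intro sum.cong refl sum.swap)
  also have "\<dots> = X"
  proof -
    have "B \<inter> S f g = S f g" for f g by (auto simp: S_def)
    then show ?thesis using fin by (simp add: X_def sum_of_bool_eq)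
  qed
  finally show ?thesis by (simp add: mult_left_mono)
qed

text \<open>The alternatives record which term wins when the two Cauchy-Schwarz bounds are combined:
  equal positions in \<open>I_square_le\<close>, or else the block term or the tie term in
  \<open>X_square_le\<close>.\<close>

lemma incidence_bound:
  assumes "\<mu> \<ge> 0"
  shows "I \<le> 2 * card B * \<mu> \<or> I ^ 3 \<le> 64 * (card B)\<^sup>2 * K * \<rho> * \<mu> * \<nu> * 2 ^ K
    \<or> I\<^sup>2 \<le> 32 * card B * K\<^sup>2 * \<rho> * \<nu>"
proof (cases "I = 0")
  case True
  then show ?thesis using assms by simp
next
  case False
  then have Ipos: "I > 0" using I_nonneg by simp
  let ?n = "real (card B)"
  show ?thesis
  proof (cases "X \<le> \<mu> * I")
    case True
    then have "I * I \<le> ?n * (2 * \<mu> * I)"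
      using I_square_le mult_left_mono[of "\<mu> * I + X" "2 * \<mu> * I" ?n] by (simp add: power2_eq_square)
    then have "I * I \<le> (2 * ?n * \<mu>) * I" by (simp add: mult_ac)
    then show ?thesis using Ipos by (simp add: mult_le_cancel_right)
  next
    case False
    then have I2: "I\<^sup>2 \<le> 2 * ?n * X"
      using I_square_le mult_left_mono[of "\<mu> * I + X" "2 * X" ?n] by simp
    have Xpos: "X > 0" using False assms Ipos by (meson less_le_trans linorder_not_le mult_nonneg_nonneg order.strict_implies_order)
    show ?thesis
    proof (cases "K * \<nu> * X \<le> \<mu> * \<nu> * 2 ^ K * I")
      case True
      have "X\<^sup>2 \<le> 8 * K * \<rho> * (2 * (\<mu> * \<nu> * 2 ^ K * I))"
        by (intro order_trans[OF X_square_le[OF assms]] mult_left_mono) (use True rho_nonneg in \<open>auto simp: mult_ac\<close>)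
      then have "(2 * ?n)\<^sup>2 * X\<^sup>2 \<le> (2 * ?n)\<^sup>2 * (8 * K * \<rho> * (2 * (\<mu> * \<nu> * 2 ^ K * I)))"
        by (rule mult_left_mono) simp
      moreover have "(I\<^sup>2)\<^sup>2 \<le> (2 * ?n * X)\<^sup>2" using I2 by (rule power_mono) simp
      ultimately have "I ^ 3 * I \<le> (64 * ?n\<^sup>2 * K * \<rho> * \<mu> * \<nu> * 2 ^ K) * I"
        by (simp add: power2_eq_square power3_eq_cube mult_ac)
      then show ?thesis using Ipos by (simp add: mult_le_cancel_right)
    next
      case False
      have "X\<^sup>2 \<le> 8 * K * \<rho> * (2 * (K * \<nu> * X))"
        by (intro order_trans[OF X_square_le[OF assms]] mult_left_mono) (use False rho_nonneg in \<open>auto simp: mult_ac\<close>)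
      then have "X * X \<le> (16 * K\<^sup>2 * \<rho> * \<nu>) * X" by (simp add: power2_eq_square mult_ac)
      then have "X \<le> 16 * K\<^sup>2 * \<rho> * \<nu>" using Xpos by (simp add: mult_le_cancel_right)
      then have "2 * ?n * X \<le> 2 * ?n * (16 * K\<^sup>2 * \<rho> * \<nu>)" by (intro mult_left_mono) auto
      then show ?thesis using I2 by (simp add: mult_ac)
    qed
  qed
qed

end

section \<open>Tangencies of parabolas\<close>

lemma finite_section: "finite G \<Longrightarrow> finite {i. (i, f) \<in> G}"
  by (rule finite_subset[of _ "fst ` G"]) force+

lemma sum_card_sections:
  assumes "finite G" "finite A" "snd ` G \<subseteq> A"
  shows "(\<Sum>f\<in>A. card {i. (i, f) \<in> G}) = card G"
proof -
  have "card G = card (SIGMA f:A. {i. (i, f) \<in> G})"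
    by (rule bij_betw_same_card[of "\<lambda>(i, f). (f, i)"],
      rule bij_betw_byWitness[where f' = "\<lambda>(f, i). (i, f)"]) (use assms(3) in auto)
  also have "\<dots> = (\<Sum>f\<in>A. card {i. (i, f) \<in> G})"
    using assms(2) finite_section[OF assms(1)] by (simp add: card_SigmaI)
  finally show ?thesis by simp
qed

text \<open>The second divided difference of a quadratic is the constant \<beta>. The signs make it
  positive on the first three points and negative on the last three.\<close>

lemma quadratic_sign_changes:
  fixes \<alpha> \<beta> \<gamma> :: real
  defines "p \<equiv> \<lambda>z. \<alpha> + \<gamma> * z + \<beta> * z\<^sup>2"
  assumes "x < y" "y < z" "z < v" "p x > 0" "p y < 0" "p z > 0" "p v < 0"
  shows False
proof -
  have diff: "p u * (w - v) + p w * (v - u) - p v * (w - u) = \<beta> * ((w - u) * (v - u) * (w - v))" for u v w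
    by (simp add: p_def algebra_simps power2_eq_square)
  have "p x * (z - y) + p z * (y - x) - p y * (z - x) > 0"
    using assms by (smt (verit) mult_neg_pos mult_pos_pos)
  then have "\<beta> * ((z - x) * (y - x) * (z - y)) > 0" using diff[of x z y] by simp
  moreover have "(z - x) * (y - x) * (z - y) > 0" using assms by simp
  ultimately have "\<beta> > 0" by (rule zero_less_mult_pos2)
  have "p y * (v - z) + p v * (z - y) - p z * (v - y) < 0"
    using assms by (smt (verit) mult_neg_pos mult_pos_pos)
  then have "\<beta> * ((v - y) * (z - y) * (v - z)) < 0" using diff[of y v z] by simp
  then have "(- \<beta>) * ((v - y) * (z - y) * (v - z)) > 0" by simp
  moreover have "(v - y) * (z - y) * (v - z) > 0" using assms by simp
  ultimately have "- \<beta> > 0" by (rule zero_less_mult_pos2)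
  then show False using \<open>\<beta> > 0\<close> by simp
qed

text \<open>For distinct points the product is negative exactly when the two pairs interlace, that
  is, when the signs alternate along the line. In this form two such facts can be multiplied without
  a case distinction on the order of the points.\<close>

lemma quadratic_not_interlaced:
  fixes \<alpha> \<beta> \<gamma> :: real
  defines "p \<equiv> \<lambda>z. \<alpha> + \<gamma> * z + \<beta> * z\<^sup>2"
  assumes "p x1 > 0" "p x2 > 0" "p y1 < 0" "p y2 < 0"
  shows "(x1 - y1) * (x1 - y2) * (x2 - y1) * (x2 - y2) > 0"
proof -
  have main: "(x1 - y1) * (x1 - y2) * (x2 - y1) * (x2 - y2) > 0"
    if "x1 \<le> x2" "y1 \<le> y2" "p x1 > 0" "p x2 > 0" "p y1 < 0" "p y2 < 0" for x1 x2 y1 y2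
  proof -
    have ne: "x1 \<noteq> y1" "x1 \<noteq> y2" "x2 \<noteq> y1" "x2 \<noteq> y2" using that by auto
    have 1: "\<not> (x1 < y1 \<and> y1 < x2 \<and> x2 < y2)"
      using quadratic_sign_changes[of x1 y1 x2 y2 \<alpha> \<gamma> \<beta>] that unfolding p_def by blast
    have 2: "\<not> (y1 < x1 \<and> x1 < y2 \<and> y2 < x2)"
      using quadratic_sign_changes[of y1 x1 y2 x2 "-\<alpha>" "-\<gamma>" "-\<beta>"] that unfolding p_def by fastforce
    consider "x2 < y1" | "y2 < x1" | "x1 < y1" "y2 < x2" | "y1 < x1" "x2 < y2"
      using 1 2 ne that by linarith
    then show ?thesis
    proof cases
      case 1
      then have "(x1 - y1) * (x1 - y2) > 0" "(x2 - y1) * (x2 - y2) > 0"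
        using that by (auto intro!: mult_neg_neg)
      then have "((x1 - y1) * (x1 - y2)) * ((x2 - y1) * (x2 - y2)) > 0" by (rule mult_pos_pos)
      then show ?thesis by (simp add: mult.assoc)
    next
      case 2 then show ?thesis using that by (auto intro!: mult_pos_pos)
    next
      case 3
      then have "(x1 - y1) * (x1 - y2) > 0" using that by (intro mult_neg_neg) auto
      moreover have "(x2 - y1) * (x2 - y2) > 0" using 3 that by (intro mult_pos_pos) auto
      ultimately have "((x1 - y1) * (x1 - y2)) * ((x2 - y1) * (x2 - y2)) > 0" by (rule mult_pos_pos)
      then show ?thesis by (simp add: mult.assoc)
    next
      case 4
      then have "(x1 - y1) * (x1 - y2) < 0" "(x2 - y1) * (x2 - y2) < 0"
        using that by (auto intro!: mult_pos_neg)
      then have "((x1 - y1) * (x1 - y2)) * ((x2 - y1) * (x2 - y2)) > 0" by (rule mult_neg_neg)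
      then show ?thesis by (simp add: mult.assoc)
    qed
  qed
  consider "x1 \<le> x2" "y1 \<le> y2" | "x1 \<le> x2" "y2 \<le> y1" | "x2 \<le> x1" "y1 \<le> y2" | "x2 \<le> x1" "y2 \<le> y1"
    by linarith
  then show ?thesis
  proof cases
    case 1 then show ?thesis using main assms by blast
  next
    case 2 then show ?thesis using main[of x1 x2 y2 y1] assms by (simp add: mult_ac)
  next
    case 3 then show ?thesis using main[of x2 x1 y1 y2] assms by (simp add: mult_ac)
  next
    case 4 then show ?thesis using main[of x2 x1 y2 y1] assms by (simp add: mult_ac)
  qed
qed

locale quad_family =
  fixes F :: "'z set" and a c b :: "'z \<Rightarrow> real"
  assumes finite_F: "finite F"
begin

definition coef_dist :: "'z \<Rightarrow> 'z \<Rightarrow> real" where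
  "coef_dist f g = max \<bar>a f - a g\<bar> (max \<bar>c f - c g\<bar> \<bar>b f - b g\<bar>)"
definition val :: "'z \<Rightarrow> real \<Rightarrow> real" where "val f s = a f + c f * s + b f * s\<^sup>2 / 2"
definition slope :: "'z \<Rightarrow> real \<Rightarrow> real" where "slope f s = c f + b f * s"
definition vert :: "'z \<Rightarrow> 'z \<Rightarrow> real" where "vert f h = - (c h - c f) / (b h - b f)"
text \<open>Contact is one-sided: \<open>h - f\<close> is convex with leading coefficient comparable
  to \<open>t\<close>. The bounds 2 for the vertex and \<open>3 * (t / (64 * 4 ^ k))\<close> for the
  value there are those that \<open>tangentI\<close> obtains from a point of [-1, 1] at which the
  gap is at most \<open>t / (64 * 4 ^ k)\<close>.\<close>

definition tangent :: "real \<Rightarrow> nat \<Rightarrow> 'z \<Rightarrow> 'z \<Rightarrow> bool" where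
  "tangent t k f h \<longleftrightarrow> coef_dist f h \<le> t \<and> t / 4 \<le> b h - b f \<and> \<bar>vert f h\<bar> \<le> 2
     \<and> \<bar>val h (vert f h) - val f (vert f h)\<bar> \<le> 3 * (t / (64 * 4 ^ k))"
text \<open>Number, counted from -2, of the cell of width \<open>1 / 2 ^ k\<close> that contains the
  point of contact; \<open>nat\<close> is harmless because a tangency has its vertex in
  [-2, 2].\<close>

definition idx :: "nat \<Rightarrow> 'z \<Rightarrow> 'z \<Rightarrow> nat" where
  "idx k f h = nat \<lfloor>(vert f h + 2) * 2 ^ k\<rfloor>"

lemma val_diff_vert:
  assumes "b h \<noteq> b f"
  shows "val h s - val f s = (val h (vert f h) - val f (vert f h)) + (b h - b f) * (s - vert f h)\<^sup>2 / 2"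
proof -
  define x where "x = vert f h"
  have "(b h - b f) * x = - (c h - c f)" using assms by (simp add: x_def vert_def)
  then have cx: "c h = c f - (b h - b f) * x" by linarith
  have "(c f - d * x) * s + (b f + d) * s\<^sup>2 / 2 - (c f * s + b f * s\<^sup>2 / 2)
      = (c f - d * x) * x + (b f + d) * x\<^sup>2 / 2 - (c f * x + b f * x\<^sup>2 / 2) + d * (s - x)\<^sup>2 / 2" for d
    by (simp add: algebra_simps power2_eq_square add_divide_distrib diff_divide_distrib)
  from this[of "b h - b f"] show ?thesis unfolding val_def x_def[symmetric] cx by simp
qed

lemma slope_diff_vert:
  assumes "b h \<noteq> b f"
  shows "slope h s - slope f s = (b h - b f) * (s - vert f h)"
  using assms by (simp add: slope_def vert_def field_simps)

lemma coef_dist_commute: "coef_dist f g = coef_dist g f"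
  by (simp add: coef_dist_def abs_minus_commute)

lemma coef_dist_le_iff: "coef_dist f g \<le> r \<longleftrightarrow> \<bar>a f - a g\<bar> \<le> r \<and> \<bar>c f - c g\<bar> \<le> r \<and> \<bar>b f - b g\<bar> \<le> r"
  by (auto simp: coef_dist_def)

lemma coef_dist_triangle: "coef_dist f h \<le> coef_dist f g + coef_dist g h"
proof -
  have "\<bar>a f - a g\<bar> \<le> coef_dist f g \<and> \<bar>c f - c g\<bar> \<le> coef_dist f g \<and> \<bar>b f - b g\<bar> \<le> coef_dist f g"
    using coef_dist_le_iff by blast
  moreover have "\<bar>a g - a h\<bar> \<le> coef_dist g h \<and> \<bar>c g - c h\<bar> \<le> coef_dist g h \<and> \<bar>b g - b h\<bar> \<le> coef_dist g h"
    using coef_dist_le_iff by blast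
  moreover have "\<bar>p - r\<bar> \<le> D + D'" if "\<bar>p - q\<bar> \<le> D" "\<bar>q - r\<bar> \<le> D'" for p q r D D' :: real
    using that by linarith
  ultimately show ?thesis unfolding coef_dist_le_iff by blast
qed

text \<open>At these four points \<open>f - g\<close> and \<open>h - m\<close> have known signs. Neither quadratic alternates, which
  determines the signs of two products of differences of the points; their product is the claim.\<close>

lemma tangent_reversed:
  assumes t: "t > 0" and w: "w = 1 / 2 ^ k"
    and E: "tangent t k f h" "tangent t k f m" "tangent t k g h" "tangent t k g m"
    and sep: "\<bar>vert f h - vert f m\<bar> \<ge> w" "\<bar>vert g h - vert g m\<bar> \<ge> w"
      "\<bar>vert f h - vert g h\<bar> \<ge> w" "\<bar>vert f m - vert g m\<bar> \<ge> w"
  shows "(vert f h - vert f m) * (vert g h - vert g m) * ((vert g h - vert f h) * (vert g m - vert f m)) < 0"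
proof -
  define lam where "lam = t / (64 * 4 ^ k)"
  have lam: "lam > 0" using t by (simp add: lam_def)
  have tw: "t * w\<^sup>2 = 64 * lam"
    using t by (simp add: lam_def w power_divide power2_eq_square power_mult_distrib[symmetric])
  have near: "val h (vert f h) - val f (vert f h) \<le> 3 * lam" if "tangent t k f h" for f h
    using that by (auto simp: tangent_def lam_def)
  \<comment> \<open>At distance \<open>w\<close> from the vertex the square adds at least
    \<open>(t / 4) * w\<^sup>2 / 2 = 8 * lam\<close> to a value of at least
    \<open>- 3 * lam\<close>, which leaves 5 > 3. This margin is why contact is defined with
    3.\<close>
  have far: "val h s - val f s > 3 * lam" if T: "tangent t k f h" and d: "\<bar>s - vert f h\<bar> \<ge> w" for f h s
  proof -
    have bb: "b h - b f \<ge> t / 4" "val h (vert f h) - val f (vert f h) \<ge> - (3 * lam)"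
      using T by (auto simp: tangent_def lam_def)
    have "w\<^sup>2 \<le> (s - vert f h)\<^sup>2" using power_mono[OF d, of 2] w by simp
    then have "(t / 4) * w\<^sup>2 \<le> (b h - b f) * (s - vert f h)\<^sup>2" using bb t by (intro mult_mono) auto
    moreover have "b h \<noteq> b f" using bb t by auto
    ultimately show ?thesis using val_diff_vert[of h f s] bb tw lam by linarith
  qed
  let ?p = "\<lambda>z. (a f - a g) + (c f - c g) * z + ((b f - b g) / 2) * z\<^sup>2"
  let ?q = "\<lambda>z. (a h - a m) + (c h - c m) * z + ((b h - b m) / 2) * z\<^sup>2"
  have pq: "?p z = val f z - val g z" "?q z = val h z - val m z" for z
    by (simp_all add: val_def field_simps)
  \<comment> \<open>Write \<open>f - g\<close> as the difference of \<open>h - g\<close>, evaluated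
    far from its vertex, and \<open>h - f\<close>, evaluated at its vertex. The other seven signs
    arise in the same way.\<close>
  have p1: "?p (vert f h) > 0" unfolding pq
    using near[OF E(1)] far[OF E(3), of "vert f h"] sep by linarith
  have p2: "?p (vert f m) > 0" unfolding pq
    using near[OF E(2)] far[OF E(4), of "vert f m"] sep by linarith
  have p3: "?p (vert g h) < 0" unfolding pq
    using near[OF E(3)] far[OF E(1), of "vert g h"] sep by linarith
  have p4: "?p (vert g m) < 0" unfolding pq
    using near[OF E(4)] far[OF E(2), of "vert g m"] sep by linarith
  have q1: "?q (vert f m) > 0" unfolding pq
    using near[OF E(2)] far[OF E(1), of "vert f m"] sep by linarith
  have q2: "?q (vert g m) > 0" unfolding pq
    using near[OF E(4)] far[OF E(3), of "vert g m"] sep by linarith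
  have q3: "?q (vert f h) < 0" unfolding pq
    using near[OF E(1)] far[OF E(2), of "vert f h"] sep by linarith
  have q4: "?q (vert g h) < 0" unfolding pq
    using near[OF E(3)] far[OF E(4), of "vert g h"] sep by linarith
  let ?x1 = "vert f h" and ?x2 = "vert f m" and ?y1 = "vert g h" and ?y2 = "vert g m"
  have 1: "(?x1 - ?y1) * (?x1 - ?y2) * (?x2 - ?y1) * (?x2 - ?y2) > 0"
    by (rule quadratic_not_interlaced[OF p1 p2 p3 p4])
  have 2: "(?x2 - ?x1) * (?x2 - ?y1) * (?y2 - ?x1) * (?y2 - ?y1) > 0"
    by (rule quadratic_not_interlaced[OF q1 q2 q3 q4])
  have "0 < ((?x1 - ?y1) * (?x1 - ?y2) * (?x2 - ?y1) * (?x2 - ?y2)) * ((?x2 - ?x1) * (?x2 - ?y1) * (?y2 - ?x1) * (?y2 - ?y1))"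
    by (rule mult_pos_pos[OF 1 2])
  \<comment> \<open>\<open>?x1 - ?y2\<close> and \<open>?x2 - ?y1\<close> occur in both products, up
    to sign, and leave a square.\<close>
  also have "\<dots> = - (((?x1 - ?x2) * (?y1 - ?y2) * ((?y1 - ?x1) * (?y2 - ?x2))) * ((?x1 - ?y2) * (?x2 - ?y1))\<^sup>2)"
  proof -
    have "(p * q * u * v) * (m * u * (- q) * n) = - ((- m) * (- n) * ((- p) * (- v)) * (q * u)\<^sup>2)"
      for p q u v m n :: real by (simp add: power2_eq_square)
    from this[of "?x1 - ?y1" "?x1 - ?y2" "?x2 - ?y1" "?x2 - ?y2" "?x2 - ?x1" "?y2 - ?y1"]
    show ?thesis unfolding minus_diff_eq .
  qed
  finally have "((?x1 - ?x2) * (?y1 - ?y2) * ((?y1 - ?x1) * (?y2 - ?x2))) * ((?x1 - ?y2) * (?x2 - ?y1))\<^sup>2 < 0"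
    by simp
  then show ?thesis by (meson mult_nonneg_nonneg not_less zero_le_power2)
qed

lemma idx_bounds:
  assumes "\<bar>vert f h\<bar> \<le> 2"
  shows "real (idx k f h) \<le> (vert f h + 2) * 2 ^ k" "(vert f h + 2) * 2 ^ k < real (idx k f h) + 1"
    "idx k f h \<le> 4 * 2 ^ k"
proof -
  have nn: "0 \<le> (vert f h + 2) * 2 ^ k" using assms by (intro mult_nonneg_nonneg) auto
  then have eq: "real (idx k f h) = of_int \<lfloor>(vert f h + 2) * 2 ^ k\<rfloor>" unfolding idx_def by simp
  show 1: "real (idx k f h) \<le> (vert f h + 2) * 2 ^ k" unfolding eq by simp
  show "(vert f h + 2) * 2 ^ k < real (idx k f h) + 1" unfolding eq by linarith
  have "(vert f h + 2) * 2 ^ k \<le> 4 * 2 ^ k" using assms by (intro mult_right_mono) auto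
  then have "real (idx k f h) \<le> 4 * 2 ^ k" using 1 by linarith
  then have "real (idx k f h) \<le> real (4 * 2 ^ k)" by simp
  then show "idx k f h \<le> 4 * 2 ^ k" by (simp only: of_nat_le_iff)
qed

lemma idx_window:
  assumes "\<bar>vert f h\<bar> \<le> 2"
  shows "real (idx k f h) / 2 ^ k \<le> vert f h + 2" "vert f h + 2 \<le> real (idx k f h) / 2 ^ k + 1 / 2 ^ k"
  using idx_bounds(1,2)[OF assms, of k] by (simp_all add: field_simps)

text \<open>Points in neighbouring cells may be arbitrarily close; one cell in between forces a
  distance of a full width. This is the reason for treating even and odd cells separately.\<close>

lemma idx_gap:
  assumes "\<bar>vert f h\<bar> \<le> 2" "\<bar>vert g m\<bar> \<le> 2" "idx k f h + 2 \<le> idx k g m"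
  shows "vert g m - vert f h \<ge> 1 / 2 ^ k"
proof -
  have "(vert f h + 2) * 2 ^ k + 1 \<le> (vert g m + 2) * 2 ^ k"
    using idx_bounds[OF assms(1), of k] idx_bounds[OF assms(2), of k] assms(3) by linarith
  then show ?thesis by (simp add: field_simps)
qed

end

section \<open>Tangencies as reversed lists\<close>

context quad_family
begin

lemma tangent_leading:
  assumes "tangent t k f h"
  shows "t / 4 \<le> b h - b f \<and> b h - b f \<le> t"
proof -
  have "coef_dist f h \<le> t" "t / 4 \<le> b h - b f" using assms unfolding tangent_def by blast+
  moreover from this(1) have "\<bar>b f - b h\<bar> \<le> t" unfolding coef_dist_le_iff by blast
  ultimately show ?thesis by linarith
qed

text \<open>Supplies \<mu>. Near the cell both \<open>f\<close> and \<open>g\<close> agree with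
  \<open>h\<close> in value and slope up to small errors; once the leading coefficients are close as
  well, all coefficients are. The outcome \<open>t / 2\<close> is essential: it places
  \<open>g\<close> among the parabolas controlled by \<open>clean (t / 2)\<close>.\<close>

lemma tangent_near_dist:
  assumes t: "t > 0" and k: "k \<ge> 4"
    and T: "tangent t k f h" "tangent t k g h" and same: "idx k f h = idx k g h"
    and s: "\<bar>s - (real (idx k f h) / 2 ^ k - 2)\<bar> \<le> (3/2) / 2 ^ k" and s1: "\<bar>s\<bar> \<le> 1"
    and bb: "\<bar>b f - b g\<bar> \<le> t / 8"
  shows "coef_dist f g \<le> t / 2 \<and> \<bar>val g s - val f s\<bar> \<le> 512 * (t / (64 * 4 ^ k))"
proof -
  define w :: real where "w = 1 / 2 ^ k"
  define lam where "lam = t / (64 * 4 ^ k)"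
  have w0: "w > 0" by (simp add: w_def)
  have tw: "t * w\<^sup>2 = 64 * lam"
    using t by (simp add: lam_def w_def power_divide power2_eq_square power_mult_distrib[symmetric])
  have "(2::real) ^ 4 \<le> 2 ^ k" using k by (intro power_increasing) auto
  \<comment> \<open>The slopes will differ by at most \<open>5 * t * w\<close>, which is now at most
    5 t / 16; with the t / 8 from the leading coefficients this stays below t / 2.\<close>
  then have w16: "w \<le> 1 / 16" by (simp add: w_def field_simps)
  \<comment> \<open>\<open>s\<close> is within (3/2) w of the left end of the cell, hence within
    (5/2) w of the vertex. There the square contributes at most
    \<open>t * (5 w / 2)^2 / 2 = 200 * lam\<close>, to which the contact adds 3. Twice 203 is
    rounded up to 512 because \<open>512 * lam\<close> will be a power of 1/2.\<close>
  have one: "\<bar>val h s - val f s\<bar> \<le> 203 * lam \<and> \<bar>slope h s - slope f s\<bar> \<le> (5/2) * (t * w)"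
    if T: "tangent t k f h" and s: "\<bar>s - (real (idx k f h) / 2 ^ k - 2)\<bar> \<le> (3/2) / 2 ^ k" for f
  proof -
    have TT: "t / 4 \<le> b h - b f" "b h - b f \<le> t" "\<bar>vert f h\<bar> \<le> 2"
        "\<bar>val h (vert f h) - val f (vert f h)\<bar> \<le> 3 * lam"
      using T by (auto simp: tangent_def lam_def coef_dist_le_iff)
    have "\<bar>s - (real (idx k f h) / 2 ^ k - 2)\<bar> \<le> (3/2) * w" using s by (simp add: w_def)
    then have sx: "\<bar>s - vert f h\<bar> \<le> (5/2) * w"
      using idx_window[OF TT(3), of k, folded w_def] by linarith
    have ne: "b h \<noteq> b f" using TT t by auto
    have "(s - vert f h)\<^sup>2 \<le> ((5/2) * w)\<^sup>2" using power_mono[OF sx, of 2] by simp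
    then have "(b h - b f) * (s - vert f h)\<^sup>2 \<le> t * ((5/2) * w)\<^sup>2"
      using TT t by (intro mult_mono) auto
    also have "\<dots> = 400 * lam" using tw by (simp add: power_mult_distrib power2_eq_square)
    finally have "(b h - b f) * (s - vert f h)\<^sup>2 \<le> 400 * lam" .
    moreover have "(b h - b f) * (s - vert f h)\<^sup>2 \<ge> 0" using TT t by (intro mult_nonneg_nonneg) auto
    ultimately have 1: "\<bar>val h s - val f s\<bar> \<le> 203 * lam"
      using val_diff_vert[OF ne, of s] TT(4) by linarith
    have "\<bar>b h - b f\<bar> * \<bar>s - vert f h\<bar> \<le> t * ((5/2) * w)" using TT t sx by (intro mult_mono) auto
    then show ?thesis using 1 slope_diff_vert[OF ne, of s] by (simp add: abs_mult mult_ac)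
  qed
  have f: "\<bar>val h s - val f s\<bar> \<le> 203 * lam \<and> \<bar>slope h s - slope f s\<bar> \<le> (5/2) * (t * w)"
    using one[OF T(1) s] .
  have g: "\<bar>val h s - val g s\<bar> \<le> 203 * lam \<and> \<bar>slope h s - slope g s\<bar> \<le> (5/2) * (t * w)"
    using one[OF T(2)] s same by simp
  have v: "\<bar>val f s - val g s\<bar> \<le> 406 * lam" and sl: "\<bar>slope f s - slope g s\<bar> \<le> 5 * (t * w)"
    using f g by linarith+
  have lam0: "lam > 0" using t by (simp add: lam_def)
  have "t * w \<le> t / 16" using mult_left_mono[OF w16, of t] t by simp
  moreover have "64 * lam \<le> t / 256"
  proof -
    have "w\<^sup>2 \<le> (1/16)\<^sup>2" using w16 w0 by (intro power_mono) auto
    then have "t * w\<^sup>2 \<le> t * (1/16)\<^sup>2" using t by (intro mult_left_mono) auto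
    then show ?thesis using tw by (simp add: power2_eq_square)
  qed
  moreover have "\<bar>(b f - b g) * s\<bar> \<le> t / 8"
    unfolding abs_mult using mult_mono[OF bb s1] t by simp
  moreover have "\<bar>(b f - b g) * s\<^sup>2\<bar> \<le> t / 8"
  proof -
    have "s\<^sup>2 \<le> 1" using power_mono[OF s1, of 2] by simp
    then show ?thesis unfolding abs_mult using mult_mono[OF bb, of "\<bar>s\<^sup>2\<bar>" 1] t by simp
  qed
  moreover have "c f - c g = (slope f s - slope g s) - (b f - b g) * s"
    by (simp add: slope_def algebra_simps)
  moreover have cs: "\<bar>(slope f s - slope g s) * s\<bar> \<le> 5 * (t * w)"
    unfolding abs_mult using mult_mono[OF sl s1] t w0 by simp
  moreover have "a f - a g = (val f s - val g s) - (slope f s - slope g s) * s + (b f - b g) * s\<^sup>2 / 2"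
    by (simp add: slope_def val_def field_simps power2_eq_square)
  moreover have "\<bar>C\<bar> \<le> t / 2 \<and> \<bar>A\<bar> \<le> t / 2"
    if "tw \<le> t / 16" "64 * lam \<le> t / 256" "\<bar>q\<bar> \<le> t / 8" "\<bar>r\<bar> \<le> t / 8" "C = S - q" "\<bar>T\<bar> \<le> 5 * tw"
      "A = V - T + r / 2" "\<bar>V\<bar> \<le> 406 * lam" "\<bar>S\<bar> \<le> 5 * tw" for tw q r C S T A V
    using that t by linarith
  ultimately have "\<bar>c f - c g\<bar> \<le> t / 2 \<and> \<bar>a f - a g\<bar> \<le> t / 2"
    using v sl by blast
  then have "coef_dist f g \<le> t / 2" using bb t unfolding coef_dist_le_iff by auto
  then show ?thesis using v lam0 unfolding lam_def by linarith
qed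

text \<open>An instance of \<open>incidence_bound\<close> in which the list of \<open>f\<close>
  consists of its tangents in the cells of \<open>G\<close>. Two members of \<open>A\<close> that
  touch a common \<open>h\<close> have leading coefficients between \<open>t / 4\<close> and
  \<open>t\<close> below that of \<open>h\<close>, hence within \<open>3 * t / 4\<close> of each
  other, and the assumption on \<open>A\<close> sharpens this to \<open>t / 8\<close>.\<close>

lemma tangency_count:
  assumes t: "t > 0" and k: "k \<ge> 4"
    and A: "A \<subseteq> F" and cls: "\<And>f g. f \<in> A \<Longrightarrow> g \<in> A \<Longrightarrow> \<bar>b f - b g\<bar> \<le> 3 * t / 4 \<Longrightarrow> \<bar>b f - b g\<bar> \<le> t / 8"
    and G: "finite G" "\<And>i f. (i, f) \<in> G \<Longrightarrow> f \<in> A \<and> i mod 2 = p \<and> \<nu> \<le> card {h\<in>F. tangent t k f h \<and> idx k f h = i}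
        \<and> (\<exists>s. \<bar>s\<bar> \<le> 1 \<and> \<bar>s - (real i / 2 ^ k - 2)\<bar> \<le> (3/2) / 2 ^ k
            \<and> real (card {g\<in>F. coef_dist f g \<le> t / 2 \<and> \<bar>val g s - val f s\<bar> \<le> 512 * (t / (64 * 4 ^ k))}) \<le> \<mu>)"
    and mu0: "\<mu> \<ge> 0"
    and rho: "real (card {(f, g). f \<in> F \<and> g \<in> F \<and> coef_dist f g \<le> 2 * t}) \<le> \<rho>"
  defines "I \<equiv> real (card G) * real \<nu>" and "K \<equiv> k + 2" and "N \<equiv> card F"
  shows "I \<le> 2 * N * \<mu> \<or> I ^ 3 \<le> 64 * N\<^sup>2 * K * \<rho> * \<mu> * \<nu> * 2 ^ K \<or> I\<^sup>2 \<le> 32 * N * K\<^sup>2 * \<rho> * \<nu>"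
proof -
  \<comment> \<open>Cells hold at least \<nu> tangents, but reversed lists need an upper bound for
    the ties. Keeping exactly \<nu> in each cell serves both purposes and makes the number of
    incidences equal to \<open>card G * \<nu>\<close>.\<close>
  have "\<exists>H. H \<subseteq> {h\<in>F. tangent t k f h \<and> idx k f h = i} \<and> card H = \<nu>" if "(i, f) \<in> G" for i f
    using G(2)[OF that] by (meson obtain_subset_with_card_n)
  then have "\<forall>q. \<exists>H. q \<in> G \<longrightarrow> H \<subseteq> {h\<in>F. tangent t k (snd q) h \<and> idx k (snd q) h = fst q} \<and> card H = \<nu>"
    by (metis prod.collapse)
  then obtain Hs where Hs: "\<And>q. q \<in> G \<Longrightarrow> Hs q \<subseteq> {h\<in>F. tangent t k (snd q) h \<and> idx k (snd q) h = fst q} \<and> card (Hs q) = \<nu>"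
    by metis
  have finHs: "finite (Hs q)" if "q \<in> G" for q
    by (rule finite_subset[OF _ finite_F]) (use Hs[OF that] in blast)
  define E where "E f h \<longleftrightarrow> (idx k f h, f) \<in> G \<and> h \<in> Hs (idx k f h, f)" for f h
  \<comment> \<open>All cells in \<open>G\<close> have the same parity, so halving merges none of
    them, and different positions leave a whole cell between the points of contact.\<close>
  define j where "j f h = idx k f h div 2" for f h
  have E: "f \<in> A \<and> h \<in> F \<and> tangent t k f h \<and> idx k f h mod 2 = p \<and> (idx k f h, f) \<in> G" if "E f h" for f h
    using that Hs[of "(idx k f h, f)"] G(2)[of "idx k f h" f] unfolding E_def by auto
  have idx_j: "idx k f h = 2 * j f h + p" if "E f h" for f h
    using E[OF that] mult_div_mod_eq[of 2 "idx k f h"] unfolding j_def by simp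
  have j_eq: "j f h = j g m \<longleftrightarrow> idx k f h = idx k g m" if "E f h" "E g m" for f h g m
    using idx_j[OF that(1)] idx_j[OF that(2)] by linarith
  have vle: "\<bar>vert f h\<bar> \<le> 2" if "E f h" for f h using E[OF that] by (simp add: tangent_def)
  have gap: "vert g m - vert f h \<ge> 1 / 2 ^ k" if "E f h" "E g m" "j f h < j g m" for f h g m
  proof (rule idx_gap[OF vle[OF that(1)] vle[OF that(2)]])
    show "idx k f h + 2 \<le> idx k g m"
      using that(3) idx_j[OF that(1)] idx_j[OF that(2)] by linarith
  qed
  have gap': "\<bar>vert f h - vert g m\<bar> \<ge> 1 / 2 ^ k \<and> sgn (real (j f h) - real (j g m)) = sgn (vert f h - vert g m)"
    if "E f h" "E g m" and ne: "j f h \<noteq> j g m" for f h g m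
  proof -
    have pos: "(1::real) / 2 ^ k > 0" by simp
    consider "j f h < j g m" | "j g m < j f h" using ne by linarith
    then show ?thesis
    proof cases
      case 1
      have "vert f h - vert g m < 0" using gap[OF that(1,2) 1] pos by linarith
      then show ?thesis using gap[OF that(1,2) 1] 1 by simp
    next
      case 2
      have "vert f h - vert g m > 0" using gap[OF that(2,1) 2] pos by linarith
      then show ?thesis using gap[OF that(2,1) 2] 2 by simp
    qed
  qed
  interpret M: reversed_lists A F E j K \<mu> "real \<nu>" \<rho>
  proof
    show "finite A" "finite F" using A finite_F by (auto intro: finite_subset)
    show "f \<in> A \<and> h \<in> F" if "E f h" for f h using E[OF that] by simp
    show "j f h < 2 ^ K" if "E f h" for f h
    proof -
      have "idx k f h \<le> 4 * 2 ^ k" using idx_bounds(3)[OF vle[OF that]] .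
      then have "j f h \<le> 2 * 2 ^ k" unfolding j_def by linarith
      \<comment> \<open>A vertex at 2 gives \<open>idx = 4 * 2 ^ k\<close> and position
        \<open>2 ^ (k + 1)\<close>, so \<open>k + 1\<close> levels would just fail to
        suffice.\<close>
      also have "\<dots> < 2 ^ K" by (simp add: K_def)
      finally show ?thesis .
    qed
    show "real (card {g\<in>A. E g h \<and> j g h = j f h}) \<le> \<mu>" if Efh: "E f h" for f h
    proof -
      obtain s where s: "\<bar>s\<bar> \<le> 1" "\<bar>s - (real (idx k f h) / 2 ^ k - 2)\<bar> \<le> (3/2) / 2 ^ k"
         "real (card {g\<in>F. coef_dist f g \<le> t / 2 \<and> \<bar>val g s - val f s\<bar> \<le> 512 * (t / (64 * 4 ^ k))}) \<le> \<mu>"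
        using E[OF Efh] G(2) by blast
      have "{g\<in>A. E g h \<and> j g h = j f h}
          \<subseteq> {g\<in>F. coef_dist f g \<le> t / 2 \<and> \<bar>val g s - val f s\<bar> \<le> 512 * (t / (64 * 4 ^ k))}"
      proof
        fix g assume "g \<in> {g\<in>A. E g h \<and> j g h = j f h}"
        then have g: "E g h" "j g h = j f h" "g \<in> A" by auto
        have T: "tangent t k f h" "tangent t k g h" using E[OF Efh] E[OF g(1)] by auto
        have "b h - b f \<le> t" "b h - b g \<le> t" "t / 4 \<le> b h - b f" "t / 4 \<le> b h - b g"
          using tangent_leading[OF T(1)] tangent_leading[OF T(2)] by simp_all
        then have "\<bar>b f - b g\<bar> \<le> 3 * t / 4" by linarith
        then have bb: "\<bar>b f - b g\<bar> \<le> t / 8" using cls[of f g] E[OF Efh] g(3) by blast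
        have "idx k f h = idx k g h" using j_eq[OF Efh g(1)] g(2) by simp
        note near = tangent_near_dist[OF t k T this s(2,1) bb]
        have "g \<in> F" using A g(3) by (rule subsetD)
        then show "g \<in> {g\<in>F. coef_dist f g \<le> t / 2 \<and> \<bar>val g s - val f s\<bar> \<le> 512 * (t / (64 * 4 ^ k))}"
          by (intro CollectI conjI near[THEN conjunct1] near[THEN conjunct2])
      qed
      then have "card {g\<in>A. E g h \<and> j g h = j f h}
          \<le> card {g\<in>F. coef_dist f g \<le> t / 2 \<and> \<bar>val g s - val f s\<bar> \<le> 512 * (t / (64 * 4 ^ k))}"
        by (intro card_mono) (use finite_F in auto)
      then show ?thesis using s(3) by linarith
    qed
    show "real (card {m\<in>F. E f m \<and> j f m = i}) \<le> real \<nu>" for f i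
    proof (cases "\<exists>h. E f h \<and> j f h = i")
      case True
      then obtain h where h: "E f h" "j f h = i" by auto
      have "{m\<in>F. E f m \<and> j f m = i} \<subseteq> Hs (idx k f h, f)"
      proof
        fix m assume m: "m \<in> {m\<in>F. E f m \<and> j f m = i}"
        then have "idx k f m = idx k f h" using j_eq[OF h(1), of f m] h(2) by simp
        then show "m \<in> Hs (idx k f h, f)" using m unfolding E_def by simp
      qed
      moreover have "finite (Hs (idx k f h, f))"
        using finHs E[OF h(1)] by simp
      ultimately have "card {m\<in>F. E f m \<and> j f m = i} \<le> card (Hs (idx k f h, f))" by (rule card_mono[rotated])
      then show ?thesis using Hs E[OF h(1)] by simp
    next
      case False
      then have "{m\<in>F. E f m \<and> j f m = i} = {}" by auto
      then show ?thesis by (simp only: card.empty)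
    qed
    have "{(f, g). f \<in> A \<and> g \<in> A \<and> (\<exists>h\<in>F. E f h \<and> E g h)}
        \<subseteq> {(f, g). f \<in> F \<and> g \<in> F \<and> coef_dist f g \<le> 2 * t}"
    proof (clarsimp)
      fix f g h assume "f \<in> A" "g \<in> A" and EE: "E f h" "E g h"
      have "coef_dist f h \<le> t" "coef_dist g h \<le> t"
        using E[OF EE(1)] E[OF EE(2)] unfolding tangent_def by blast+
      then have "coef_dist f g \<le> 2 * t" using coef_dist_triangle[of f g h] coef_dist_commute[of g h] by linarith
      then show "f \<in> F \<and> g \<in> F \<and> coef_dist f g \<le> 2 * t" using A \<open>f \<in> A\<close> \<open>g \<in> A\<close> by blast
    qed
    then have "card {(f, g). f \<in> A \<and> g \<in> A \<and> (\<exists>h\<in>F. E f h \<and> E g h)}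
        \<le> card {(f, g). f \<in> F \<and> g \<in> F \<and> coef_dist f g \<le> 2 * t}"
      by (rule card_mono[rotated]) (rule finite_subset[of _ "F \<times> F"], use finite_F in auto)
    then show "real (card {(f, g). f \<in> A \<and> g \<in> A \<and> (\<exists>h\<in>F. E f h \<and> E g h)}) \<le> \<rho>"
      using rho by linarith
    show "sgn (real (j f h) - real (j f m)) * sgn (real (j g h) - real (j g m))
        = - (sgn (real (j g h) - real (j f h)) * sgn (real (j g m) - real (j f m)))"
      if EE: "E f h" "E f m" "E g h" "E g m" and ne: "j f h \<noteq> j f m" "j g h \<noteq> j g m" "j f h \<noteq> j g h" "j f m \<noteq> j g m"
      for f h m g
    proof -
      have s1: "\<bar>vert f h - vert f m\<bar> \<ge> 1 / 2 ^ k \<and> sgn (real (j f h) - real (j f m)) = sgn (vert f h - vert f m)"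
        by (rule gap'[OF EE(1,2) ne(1)])
      have s2: "\<bar>vert g h - vert g m\<bar> \<ge> 1 / 2 ^ k \<and> sgn (real (j g h) - real (j g m)) = sgn (vert g h - vert g m)"
        by (rule gap'[OF EE(3,4) ne(2)])
      have s3: "\<bar>vert g h - vert f h\<bar> \<ge> 1 / 2 ^ k \<and> sgn (real (j g h) - real (j f h)) = sgn (vert g h - vert f h)"
        by (rule gap'[OF EE(3,1) ne(3)[symmetric]])
      have s4: "\<bar>vert g m - vert f m\<bar> \<ge> 1 / 2 ^ k \<and> sgn (real (j g m) - real (j f m)) = sgn (vert g m - vert f m)"
        by (rule gap'[OF EE(4,2) ne(4)[symmetric]])
      have "(vert f h - vert f m) * (vert g h - vert g m) * ((vert g h - vert f h) * (vert g m - vert f m)) < 0"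
        by (rule tangent_reversed[OF t refl]) (use E EE s1 s2 s3 s4 in \<open>auto simp: abs_minus_commute\<close>)
      then have "sgn ((vert f h - vert f m) * (vert g h - vert g m) * ((vert g h - vert f h) * (vert g m - vert f m))) = -1"
        by simp
      then have "sgn (vert f h - vert f m) * sgn (vert g h - vert g m)
          * (sgn (vert g h - vert f h) * sgn (vert g m - vert f m)) = -1" by (simp only: sgn_mult)
      then have "sgn (vert f h - vert f m) * sgn (vert g h - vert g m)
          = - (sgn (vert g h - vert f h) * sgn (vert g m - vert f m))"
        by (auto simp: sgn_if split: if_splits)
      then show ?thesis using s1 s2 s3 s4 by simp
    qed
  qed
  have "M.I = I"
  proof -
    have fA: "finite A" by (rule M.fin)
    have "card {h\<in>F. E f h} = card {i. (i, f) \<in> G} * \<nu>" for f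
    proof -
      have "{h\<in>F. E f h} = (\<Union>i\<in>{i. (i, f) \<in> G}. Hs (i, f))"
      proof (intro equalityI subsetI)
        fix h assume "h \<in> {h\<in>F. E f h}"
        then show "h \<in> (\<Union>i\<in>{i. (i, f) \<in> G}. Hs (i, f))" unfolding E_def by blast
      next
        fix h assume "h \<in> (\<Union>i\<in>{i. (i, f) \<in> G}. Hs (i, f))"
        then obtain i where i: "(i, f) \<in> G" "h \<in> Hs (i, f)" by blast
        then have "h \<in> F" "idx k f h = i" using Hs[OF i(1)] by auto
        then show "h \<in> {h\<in>F. E f h}" using i unfolding E_def by simp
      qed
      also have "card \<dots> = (\<Sum>i\<in>{i. (i, f) \<in> G}. card (Hs (i, f)))"
      proof (rule card_UN_disjoint[OF finite_section[OF G(1)]])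
        show "\<forall>i\<in>{i. (i, f) \<in> G}. finite (Hs (i, f))"
          using finHs by simp
        show "\<forall>i\<in>{i. (i, f) \<in> G}. \<forall>i'\<in>{i. (i, f) \<in> G}. i \<noteq> i' \<longrightarrow> Hs (i, f) \<inter> Hs (i', f) = {}"
        proof (intro ballI impI)
          fix i i' assume i: "i \<in> {i. (i, f) \<in> G}" "i' \<in> {i. (i, f) \<in> G}" and ne: "i \<noteq> i'"
          have "idx k f h = i" if "h \<in> Hs (i, f)" for h using Hs[of "(i, f)"] i that by auto
          moreover have "idx k f h = i'" if "h \<in> Hs (i', f)" for h using Hs[of "(i', f)"] i that by auto
          ultimately show "Hs (i, f) \<inter> Hs (i', f) = {}" using ne by blast
        qed
      qed
      also have "\<dots> = card {i. (i, f) \<in> G} * \<nu>" using Hs by simp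
      finally show ?thesis .
    qed
    then have "M.I = (\<Sum>f\<in>A. real (card {i. (i, f) \<in> G})) * real \<nu>"
      unfolding M.I_def by (simp add: sum_distrib_right)
    also have "(\<Sum>f\<in>A. real (card {i. (i, f) \<in> G})) = real (card G)"
      using sum_card_sections[OF G(1) fA] G(2) by (force simp flip: of_nat_sum)
    finally show ?thesis by (simp add: I_def)
  qed
  then show ?thesis using M.incidence_bound[OF mu0] unfolding N_def by simp
qed

end

section \<open>Rich cells\<close>

text \<open>\<open>P\<close> stands for \<open>2 ^ k\<close>, \<open>x\<close> for the height to the
  power \<delta>, \<open>g\<close> for the number of rich cells of one class. After cancellation of
  \<open>C\<close>, \<open>N\<close>, \<open>x\<close> the alternatives compare, up to numerical
  factors, \<open>P * Y ^ 34\<close> with \<open>Y ^ 50\<close>, then \<open>Y ^ 60\<close> with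
  \<open>Y ^ 51\<close>, then \<open>Y ^ 26\<close> with \<open>Y\<^sup>2\<close>. \<open>P\<close>
  cancels as well in the last two; the first is the reason for requiring
  \<open>P \<ge> Y ^ 18\<close>.\<close>

lemma tangency_alternatives_fail:
  fixes g \<nu> N x P Y C K \<mu> \<rho> :: real
  assumes pos: "N > 0" "x > 0" "C \<ge> 1" "Y \<ge> 1000" "P \<ge> Y ^ 18" "0 \<le> K" "K \<le> Y" "0 \<le> \<mu>" "0 \<le> \<rho>"
    and g: "g \<ge> N * P / Y ^ 8" and nu: "\<nu> \<ge> C * Y ^ 42 * x * N"
    and mu: "\<mu> \<le> 512 * C * Y ^ 50 * x * N" and rho: "\<rho> \<le> 128 * C * P\<^sup>2 * x * N\<^sup>2"
  shows "\<not> g * \<nu> \<le> 2 * N * \<mu>"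
    and "\<not> (g * \<nu>) ^ 3 \<le> 64 * N\<^sup>2 * K * \<rho> * \<mu> * \<nu> * (4 * P)"
    and "\<not> (g * \<nu>)\<^sup>2 \<le> 32 * N * K\<^sup>2 * \<rho> * \<nu>"
proof -
  have Y0: "Y > 0" and P0: "P > 0" using pos by (auto intro: less_le_trans[of _ "Y ^ 18"])
  have C0: "C > 0" using pos by simp
  have nu0: "\<nu> > 0" using nu by (rule less_le_trans[rotated]) (use pos Y0 C0 in simp)
  have g0: "g > 0" using g by (rule less_le_trans[rotated]) (use pos Y0 P0 in simp)
  have gnu: "N * P / Y ^ 8 * (C * Y ^ 42 * x * N) \<le> g * \<nu>"
    using g nu pos Y0 P0 g0 by (intro mult_mono) auto
  show "\<not> g * \<nu> \<le> 2 * N * \<mu>"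
  proof
    assume le: "g * \<nu> \<le> 2 * N * \<mu>"
    have "C * x * N\<^sup>2 * Y ^ 52 = C * x * N\<^sup>2 * Y ^ 34 * Y ^ 18" by (simp add: mult.assoc flip: power_add)
    also have "\<dots> \<le> C * x * N\<^sup>2 * Y ^ 34 * P" using pos Y0 by (intro mult_left_mono) auto
    also have "\<dots> = N * P / Y ^ 8 * (C * Y ^ 42 * x * N)"
    proof -
      have Y42: "Y ^ 42 = Y ^ 34 * Y ^ 8" by (simp flip: power_add)
      have cancel: "C * x * N\<^sup>2 * z * P = N * P / y * (C * (z * y) * x * N)" if "y > 0" for y z
        using that by (simp add: power2_eq_square)
      show ?thesis unfolding Y42 by (rule cancel) (use Y0 in simp)
    qed
    also have "\<dots> \<le> 2 * N * \<mu>" using gnu le by linarith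
    also have "\<dots> \<le> 2 * N * (512 * C * Y ^ 50 * x * N)" using mu pos by (intro mult_left_mono) auto
    also have "\<dots> = C * x * N\<^sup>2 * (1024 * Y ^ 50)" by (simp add: power2_eq_square)
    finally have "Y ^ 52 \<le> 1024 * Y ^ 50" by (rule mult_left_le_imp_le) (use C0 pos in simp)
    moreover have "Y ^ 52 = Y\<^sup>2 * Y ^ 50" by (simp flip: power_add)
    ultimately have "Y\<^sup>2 * Y ^ 50 \<le> 1024 * Y ^ 50" by (simp only:)
    then have "Y\<^sup>2 \<le> 1024" by (rule mult_right_le_imp_le) (use Y0 in simp)
    moreover have "1000 * 1000 \<le> Y * Y" using pos by (intro mult_mono) auto
    ultimately show False by (simp add: power2_eq_square)
  qed
  show "\<not> (g * \<nu>) ^ 3 \<le> 64 * N\<^sup>2 * K * \<rho> * \<mu> * \<nu> * (4 * P)"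
  proof
    assume "(g * \<nu>) ^ 3 \<le> 64 * N\<^sup>2 * K * \<rho> * \<mu> * \<nu> * (4 * P)"
    then have "(g * (g * \<nu>)\<^sup>2) * \<nu> \<le> (64 * N\<^sup>2 * K * \<rho> * \<mu> * (4 * P)) * \<nu>"
      by (simp add: power3_eq_cube power2_eq_square mult_ac)
    then have le: "g * (g * \<nu>)\<^sup>2 \<le> 64 * N\<^sup>2 * K * \<rho> * \<mu> * (4 * P)" by (rule mult_right_le_imp_le) (rule nu0)
    have "(C\<^sup>2 * x\<^sup>2 * N ^ 5 * P ^ 3) * Y ^ 60 = (N * P / Y ^ 8) * (N * P / Y ^ 8 * (C * Y ^ 42 * x * N))\<^sup>2"
    proof -
      have "(N * P / Y ^ 8) * (N * P / Y ^ 8 * (C * Y ^ 42 * x * N))\<^sup>2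
          = (C\<^sup>2 * x\<^sup>2 * N ^ 5 * P ^ 3) * ((Y ^ 42)\<^sup>2 / (Y ^ 8) ^ 3)"
      proof -
        have "(N * P / y) * (N * P / y * (C * z * x * N))\<^sup>2 = (C\<^sup>2 * x\<^sup>2 * N ^ 5 * P ^ 3) * (z\<^sup>2 / y ^ 3)" for y z
          by (simp add: eval_nat_numeral mult_ac)
        then show ?thesis .
      qed
      also have "(Y ^ 42)\<^sup>2 = Y ^ 60 * (Y ^ 8) ^ 3" by (simp flip: power_mult power_add)
      also have "Y ^ 60 * (Y ^ 8) ^ 3 / (Y ^ 8) ^ 3 = Y ^ 60" by (rule nonzero_mult_div_cancel_right) (use Y0 in simp)
      finally show ?thesis by simp
    qed
    also have "\<dots> \<le> g * (g * \<nu>)\<^sup>2"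
      by (rule mult_mono[OF g power_mono[OF gnu]]) (use pos Y0 P0 C0 g0 in auto)
    also have "\<dots> \<le> 64 * N\<^sup>2 * K * \<rho> * \<mu> * (4 * P)" by (rule le)
    also have "\<dots> \<le> 64 * N\<^sup>2 * Y * (128 * C * P\<^sup>2 * x * N\<^sup>2) * (512 * C * Y ^ 50 * x * N) * (4 * P)"
      using pos mu rho P0 Y0 C0 by (intro mult_mono mult_nonneg_nonneg) auto
    also have "\<dots> = (C\<^sup>2 * x\<^sup>2 * N ^ 5 * P ^ 3) * (16777216 * (Y * Y ^ 50))"
    proof -
      have "64 * N\<^sup>2 * Y * (128 * C * P\<^sup>2 * x * N\<^sup>2) * (512 * C * y * x * N) * (4 * P)
          = (C\<^sup>2 * x\<^sup>2 * N ^ 5 * P ^ 3) * (16777216 * (Y * y))" for y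
        by (simp add: eval_nat_numeral mult_ac)
      then show ?thesis .
    qed
    finally have "Y ^ 60 \<le> 16777216 * (Y * Y ^ 50)" by (rule mult_left_le_imp_le) (use C0 pos P0 in simp)
    moreover have "Y ^ 60 = Y ^ 9 * (Y * Y ^ 50)" by (simp flip: power_Suc power_add)
    ultimately have "Y ^ 9 * (Y * Y ^ 50) \<le> 16777216 * (Y * Y ^ 50)" by (simp only:)
    then have "Y ^ 9 \<le> 16777216" by (rule mult_right_le_imp_le) (use Y0 in simp)
    moreover have "1000 ^ 9 \<le> Y ^ 9" using pos by (intro power_mono) auto
    ultimately show False by simp
  qed
  show "\<not> (g * \<nu>)\<^sup>2 \<le> 32 * N * K\<^sup>2 * \<rho> * \<nu>"
  proof
    assume "(g * \<nu>)\<^sup>2 \<le> 32 * N * K\<^sup>2 * \<rho> * \<nu>"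
    then have "(g * (g * \<nu>)) * \<nu> \<le> (32 * N * K\<^sup>2 * \<rho>) * \<nu>" by (simp add: power2_eq_square mult_ac)
    then have le: "g * (g * \<nu>) \<le> 32 * N * K\<^sup>2 * \<rho>" by (rule mult_right_le_imp_le) (rule nu0)
    have "(C * x * N ^ 3 * P\<^sup>2) * Y ^ 26 = (N * P / Y ^ 8) * (N * P / Y ^ 8 * (C * Y ^ 42 * x * N))"
    proof -
      have "(N * P / Y ^ 8) * (N * P / Y ^ 8 * (C * Y ^ 42 * x * N)) = (C * x * N ^ 3 * P\<^sup>2) * (Y ^ 42 / (Y ^ 8)\<^sup>2)"
      proof -
        have "(N * P / y) * (N * P / y * (C * z * x * N)) = (C * x * N ^ 3 * P\<^sup>2) * (z / y\<^sup>2)" for y z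
          by (simp add: eval_nat_numeral mult_ac)
        then show ?thesis .
      qed
      also have "Y ^ 42 = Y ^ 26 * (Y ^ 8)\<^sup>2" by (simp flip: power_mult power_add)
      also have "Y ^ 26 * (Y ^ 8)\<^sup>2 / (Y ^ 8)\<^sup>2 = Y ^ 26" by (rule nonzero_mult_div_cancel_right) (use Y0 in simp)
      finally show ?thesis by simp
    qed
    also have "\<dots> \<le> g * (g * \<nu>)" by (rule mult_mono[OF g gnu]) (use pos Y0 P0 C0 g0 in auto)
    also have "\<dots> \<le> 32 * N * K\<^sup>2 * \<rho>" by (rule le)
    also have "\<dots> \<le> 32 * N * Y\<^sup>2 * (128 * C * P\<^sup>2 * x * N\<^sup>2)"
      using pos rho P0 Y0 C0 by (intro mult_mono mult_nonneg_nonneg power_mono) auto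
    also have "\<dots> = (C * x * N ^ 3 * P\<^sup>2) * (4096 * Y\<^sup>2)"
      by (simp add: power2_eq_square power3_eq_cube mult_ac)
    finally have "Y ^ 26 \<le> 4096 * Y\<^sup>2" by (rule mult_left_le_imp_le) (use C0 pos P0 in simp)
    moreover have "Y ^ 26 = Y ^ 24 * Y\<^sup>2" by (simp flip: power_add)
    ultimately have "Y ^ 24 * Y\<^sup>2 \<le> 4096 * Y\<^sup>2" by (simp only:)
    then have "Y ^ 24 \<le> 4096" by (rule mult_right_le_imp_le) (use Y0 in simp)
    moreover have "1000 ^ 24 \<le> Y ^ 24" using pos by (intro power_mono) auto
    ultimately show False by simp
  qed
qed

text \<open>The form in which \<delta> < 1 is used: enlarging a scale by some factor enlarges the
  Frostman bound by at most that factor, so a gain linear in the scale always compensates.\<close>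

lemma powr_ratio_le:
  fixes x y d :: real
  assumes "0 < x" "x \<le> y" "0 \<le> d" "d \<le> 1"
  shows "y powr d \<le> (y / x) * x powr d"
proof -
  have "y powr d = (y / x) powr d * x powr d"
    using assms by (subst powr_mult[symmetric]) auto
  also have "(y / x) powr d \<le> (y / x) powr 1"
    using assms by (intro powr_mono) auto
  finally show ?thesis using assms by (simp add: mult_right_mono)
qed

text \<open>Lengths are divided by \<open>b1\<close>, and the scales of interest are
  \<open>1 / 2 ^ i\<close> with \<open>i < n\<close>. The Frostman bound starts at
  \<open>2 / 2 ^ n\<close> because \<open>n\<close> will be the least index with
  \<open>1 / 2 ^ n < b0 / b1\<close>, which puts \<open>b0 / b1\<close> at or below
  \<open>2 / 2 ^ n\<close>.\<close>

locale frostman_quads = quad_family F a c b for F :: "'z set" and a c b +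
  fixes C \<delta> :: real and n :: nat
  assumes F_ne: "F \<noteq> {}" and C1: "C \<ge> 1" and delta: "0 < \<delta>" "\<delta> < 1"
    and frost: "\<And>f \<rho>. f \<in> F \<Longrightarrow> \<rho> \<ge> 2 / 2 ^ n \<Longrightarrow> real (card {g\<in>F. coef_dist f g \<le> \<rho>}) \<le> C * \<rho> powr \<delta> * card F"
    and diam: "\<And>f g. f \<in> F \<Longrightarrow> g \<in> F \<Longrightarrow> coef_dist f g \<le> 2"
begin

text \<open>Thresholds are powers of \<open>Y\<close>; the summand 1000 makes one extra power of \<open>Y\<close> absorb any numerical
  constant.\<close>

definition Y :: real where "Y = real n + 1000"
definition N :: real where "N = real (card F)"
definition count :: "real \<Rightarrow> real \<Rightarrow> 'z \<Rightarrow> real \<Rightarrow> real" where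
  "count t r f s = real (card {g\<in>F. coef_dist f g \<le> t \<and> \<bar>val g s - val f s\<bar> \<le> r})"
text \<open>All heights are required at once, since the height at which cleanness is applied varies
  with the distance and with the slope.\<close>

definition clean :: "real \<Rightarrow> 'z \<Rightarrow> real \<Rightarrow> bool" where
  "clean t f s \<longleftrightarrow> (\<forall>i<n. count t (1 / 2 ^ i) f s \<le> C * Y ^ 50 * (1 / 2 ^ i) powr \<delta> * N)"
definition cell :: "real \<Rightarrow> nat \<Rightarrow> 'z \<Rightarrow> nat \<Rightarrow> 'z set" where
  "cell t k f i = {h\<in>F. tangent t k f h \<and> idx k f h = i}"
text \<open>A cell is rich only if it meets a parameter at which all smaller distances are under control. Hence
  the bounds at successive distances do not accumulate.\<close>

definition rich :: "real \<Rightarrow> nat \<Rightarrow> (nat \<times> 'z) set" where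
  "rich t k = {(i, f). f \<in> F \<and> real (card (cell t k f i)) > C * Y ^ 42 * (t / (64 * 4 ^ k)) powr \<delta> * N
     \<and> (\<exists>s. \<bar>s\<bar> \<le> 1 \<and> \<bar>s - (real i / 2 ^ k - 2)\<bar> \<le> (3/2) / 2 ^ k \<and> clean (t / 2) f s)}"

lemma Y_ge: "Y \<ge> 1000" "real n \<le> Y" by (simp_all add: Y_def)
lemma N_pos: "N > 0" using F_ne finite_F by (simp add: N_def card_gt_0_iff)

lemma card_cell_pos_imp:
  assumes "real (card (cell t k f i)) > 0"
  shows "i \<le> 4 * 2 ^ k"
proof -
  have "cell t k f i \<noteq> {}" using assms by force
  then obtain h where "tangent t k f h" "idx k f h = i" unfolding cell_def by blast
  then show ?thesis using idx_bounds(3)[of f h k] unfolding tangent_def by blast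
qed

lemma rich_subset: "rich t k \<subseteq> {..4 * 2 ^ k} \<times> F"
proof
  fix q assume q: "q \<in> rich t k"
  obtain i f where [simp]: "q = (i, f)" by fastforce
  have "0 \<le> C * Y ^ 42 * (t / (64 * 4 ^ k)) powr \<delta> * N" using C1 Y_ge N_pos by simp
  then have "real (card (cell t k f i)) > 0" using q unfolding rich_def by auto
  then show "q \<in> {..4 * 2 ^ k} \<times> F" using card_cell_pos_imp q unfolding rich_def by auto
qed

lemma finite_rich [simp]: "finite (rich t k)"
  by (rule finite_subset[OF rich_subset]) (use finite_F in simp)

lemma card_cell_le: "real (card (cell t k f i)) \<le> real (card {g\<in>F. coef_dist f g \<le> t})"
  using finite_F by (intro of_nat_mono card_mono) (auto simp: cell_def tangent_def)

text \<open>The factor 16 counts classes: two parities of the cell and eight residues of the leading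
  coefficient. If the bound failed, one class would have more than \<open>N * 2 ^ k / Y ^ 8\<close>
  rich cells, and none of the alternatives of \<open>tangency_count\<close> would be
  possible.\<close>

lemma rich_bound:
  assumes u: "u \<le> n + 1" and t: "t = 2 ^ u / 2 ^ n" and lam: "t / (64 * 4 ^ k) \<ge> 2 / 2 ^ n"
  shows "real (card (rich t k)) \<le> 16 * (N * 2 ^ k / Y ^ 8)"
proof (rule ccontr)
  assume contra: "\<not> ?thesis"
  define lam' where "lam' = t / (64 * 4 ^ k)"
  define x where "x = lam' powr \<delta>"
  define P :: real where "P = 2 ^ k"
  have t0: "t > 0" by (simp add: t)
  have lam0: "lam' > 0" using t0 by (simp add: lam'_def)
  have x0: "x > 0" using lam0 by (simp add: x_def)
  have P1: "P \<ge> 1" by (simp add: P_def)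
  have tP: "t = 64 * P\<^sup>2 * lam'" by (simp add: lam'_def P_def power2_eq_square power_mult_distrib[symmetric])
  have "1 \<le> 64 * P\<^sup>2" using one_le_power[OF P1, of 2] by linarith
  then have "lam' \<le> t" using mult_right_mono[of 1 "64 * P\<^sup>2" lam'] lam0 unfolding tP by simp
  then have t2: "t \<ge> 2 / 2 ^ n" using lam unfolding lam'_def by linarith
  have tx: "t powr \<delta> \<le> 64 * P\<^sup>2 * x"
    using powr_ratio_le[OF lam0 \<open>lam' \<le> t\<close>, of \<delta>] delta lam0 by (simp add: x_def tP)
  have t2x: "(2 * t) powr \<delta> \<le> 128 * P\<^sup>2 * x"
    using powr_ratio_le[OF lam0, of "2 * t" \<delta>] \<open>lam' \<le> t\<close> delta lam0 by (simp add: x_def tP)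
  have Y0: "Y > 0" using Y_ge by simp
  define thr where "thr = C * Y ^ 42 * x * N"
  have thr0: "thr \<ge> 0" using C1 Y0 x0 N_pos by (simp add: thr_def)
  define \<nu> where "\<nu> = Suc (nat \<lfloor>thr\<rfloor>)"
  have nu_gt: "real \<nu> > thr" using thr0 unfolding \<nu>_def by linarith
  have nu_le: "\<nu> \<le> m" if "real m > thr" for m :: nat
    using that thr0 unfolding \<nu>_def by linarith
  \<comment> \<open>For smaller \<open>P\<close> no cell is rich: a cell lies in the ball of radius
    \<open>t\<close>, which has at most \<open>64 * C * P\<^sup>2 * x * N\<close> elements, fewer
    than the threshold.\<close>
  have P18: "P \<ge> Y ^ 18"
  proof (rule ccontr)
    assume "\<not> P \<ge> Y ^ 18"
    then have "P\<^sup>2 \<le> (Y ^ 18)\<^sup>2" using P1 by (intro power_mono) auto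
    then have P2: "P\<^sup>2 \<le> Y ^ 36" by (simp flip: power_mult)
    have "rich t k = {}"
    proof (rule ccontr)
      assume "rich t k \<noteq> {}"
      then obtain i f where f: "f \<in> F" and gt: "real (card (cell t k f i)) > thr"
        unfolding rich_def thr_def x_def lam'_def by blast
      have "real (card (cell t k f i)) \<le> C * t powr \<delta> * N"
        using card_cell_le[of t k f i] frost[OF f t2] by (simp add: N_def)
      also have "\<dots> \<le> C * (64 * P\<^sup>2 * x) * N" using tx C1 N_pos by (intro mult_right_mono mult_left_mono) auto
      also have "\<dots> = C * x * N * (64 * P\<^sup>2)" by simp
      also have "\<dots> \<le> C * x * N * (Y ^ 42)"
      proof -
        have "64 * P\<^sup>2 \<le> Y ^ 6 * Y ^ 36"
        proof (intro mult_mono P2)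
          have "1000 ^ 6 \<le> Y ^ 6" using Y_ge by (intro power_mono) auto
          then show "64 \<le> Y ^ 6" by simp
        qed (use Y0 in auto)
        then show ?thesis using C1 x0 N_pos by (intro mult_left_mono) (auto simp flip: power_add)
      qed
      also have "\<dots> = thr" by (simp add: thr_def)
      finally show False using gt by simp
    qed
    then have "0 > 16 * (N * 2 ^ k / Y ^ 8)" using contra by simp
    moreover have "16 * (N * 2 ^ k / Y ^ 8) \<ge> 0" using N_pos Y0 by simp
    ultimately show False by linarith
  qed
  have k4: "k \<ge> 4"
  proof (rule ccontr)
    assume "\<not> k \<ge> 4"
    then have "P \<le> 2 ^ 4" unfolding P_def by (intro power_increasing) auto
    moreover have "1000 ^ 18 \<le> Y ^ 18" using Y_ge by (intro power_mono) auto
    ultimately show False using P18 by simp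
  qed
  have u_ge: "u \<ge> 7 + 2 * k"
  proof -
    have four: "(4::real) ^ k = 2 ^ (2 * k)" by (simp add: power_mult)
    have "2 ^ (7 + 2 * k) \<le> (2::real) ^ u"
      using lam unfolding t four by (simp add: field_simps power_add)
    then show ?thesis by (simp only: power_increasing_iff) 
  qed
  \<comment> \<open>The index of the height \<open>512 * (t / (64 * 4 ^ k))\<close> of
    \<open>tangent_near_dist\<close>. The assumed lower bound for \<open>t / (64 * 4 ^ k)\<close>
    gives \<open>e < n\<close>, so \<open>clean\<close> speaks about it.\<close>
  define e where "e = n + 2 * k - u - 3"
  have e_sum: "e + u + 3 = n + 2 * k" using k4 u by (simp add: e_def)
  have e_n: "e < n" using e_sum u_ge by linarith
  have e_eq: "512 * (t / (64 * 4 ^ k)) = 1 / 2 ^ e"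
  proof -
    have "(2::real) ^ e * 2 ^ u * 8 = 2 ^ n * 4 ^ k"
      using arg_cong[OF e_sum, of "\<lambda>m. (2::real) ^ m"] by (simp add: power_add power_mult)
    then show ?thesis unfolding t by (simp add: field_simps)
  qed
  define \<mu> where "\<mu> = C * Y ^ 50 * (1 / 2 ^ e) powr \<delta> * N"
  define \<rho> where "\<rho> = N * (C * (2 * t) powr \<delta> * N)"
  \<comment> \<open>The line is cut into pieces of length t / 8, labelled modulo 8. Points with
    equal labels at distance at most 3 t / 4, six pieces, must lie in the same piece.\<close>
  define cl where "cl f = nat (\<lfloor>8 * b f / t\<rfloor> mod 8)" for f
  define G where "G p q = {(i, f). (i, f) \<in> rich t k \<and> i mod 2 = p \<and> cl f = q}" for p q
  have cover: "rich t k \<subseteq> (\<Union>(p, q)\<in>{..<2} \<times> {..<8}. G p q)"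
  proof
    fix z assume "z \<in> rich t k"
    moreover obtain i f where "z = (i, f)" by fastforce
    moreover have "cl f < 8" unfolding cl_def by (simp add: nat_less_iff)
    moreover have "i mod 2 < 2" by simp
    ultimately show "z \<in> (\<Union>(p, q)\<in>{..<2} \<times> {..<8}. G p q)" unfolding G_def by fastforce
  qed
  have finG: "finite (G p q)" for p q
    by (rule finite_subset[of _ "rich t k"]) (auto simp: G_def)
  have "card (rich t k) \<le> card (\<Union>(p, q)\<in>{..<2} \<times> {..<8}. G p q)"
    using cover by (rule card_mono[rotated]) (use finG in auto)
  also have "\<dots> \<le> (\<Sum>z\<in>{..<2} \<times> {..<8}. card (case z of (p, q) \<Rightarrow> G p q))"
    by (rule card_UN_le) simp
  finally have sum_ge: "real (card (rich t k)) \<le> (\<Sum>z\<in>{..<2::nat} \<times> {..<8::nat}. real (card (case z of (p, q) \<Rightarrow> G p q)))"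
    by (metis of_nat_le_iff of_nat_sum)
  have "\<exists>z\<in>{..<2::nat} \<times> {..<8::nat}. real (card (case z of (p, q) \<Rightarrow> G p q)) > N * 2 ^ k / Y ^ 8"
  proof (rule ccontr)
    assume "\<not> ?thesis"
    then have "(\<Sum>z\<in>{..<2::nat} \<times> {..<8::nat}. real (card (case z of (p, q) \<Rightarrow> G p q)))
        \<le> (\<Sum>z\<in>{..<2::nat} \<times> {..<8::nat}. N * 2 ^ k / Y ^ 8)"
      by (intro sum_mono) (auto simp: not_less)
    then show False using sum_ge contra by simp
  qed
  then obtain p q where pq: "real (card (G p q)) > N * 2 ^ k / Y ^ 8" by auto
  have rho_ge: "real (card {(f, g). f \<in> F \<and> g \<in> F \<and> coef_dist f g \<le> 2 * t}) \<le> \<rho>"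
  proof -
    have "{(f, g). f \<in> F \<and> g \<in> F \<and> coef_dist f g \<le> 2 * t} = (SIGMA f:F. {g\<in>F. coef_dist f g \<le> 2 * t})" by auto
    then have "real (card {(f, g). f \<in> F \<and> g \<in> F \<and> coef_dist f g \<le> 2 * t})
        = (\<Sum>f\<in>F. real (card {g\<in>F. coef_dist f g \<le> 2 * t}))"
      using finite_F by (simp add: card_SigmaI)
    also have "\<dots> \<le> (\<Sum>f\<in>F. C * (2 * t) powr \<delta> * N)"
      unfolding N_def using t2 t0 by (intro sum_mono frost) auto
    finally show ?thesis by (simp add: \<rho>_def N_def)
  qed
  define A where "A = {f\<in>F. cl f = q}"
  have AF: "A \<subseteq> F" by (auto simp: A_def)
  have mu0: "\<mu> \<ge> 0" using C1 Y0 N_pos by (simp add: \<mu>_def)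
  have alt: "real (card (G p q)) * real \<nu> \<le> 2 * real (card F) * \<mu>
    \<or> (real (card (G p q)) * real \<nu>) ^ 3 \<le> 64 * (real (card F))\<^sup>2 * real (k + 2) * \<rho> * \<mu> * \<nu> * 2 ^ (k + 2)
    \<or> (real (card (G p q)) * real \<nu>)\<^sup>2 \<le> 32 * real (card F) * (real (k + 2))\<^sup>2 * \<rho> * \<nu>"
  proof -
    have cls: "\<bar>b f - b g\<bar> \<le> t / 8" if "f \<in> A" "g \<in> A" "\<bar>b f - b g\<bar> \<le> 3 * t / 4" for f g
    proof -
      have "\<lfloor>8 * b f / t\<rfloor> mod 8 = \<lfloor>8 * b g / t\<rfloor> mod 8"
        using that(1,2) unfolding A_def cl_def by (auto simp: nat_eq_iff)
      moreover have abs_eq: "\<bar>8 * b f / t - 8 * b g / t\<bar> = 8 * \<bar>b f - b g\<bar> / t"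
      proof -
        have eq: "8 * b f / t - 8 * b g / t = 8 * (b f - b g) / t"
          by (simp add: diff_divide_distrib right_diff_distrib)
        show ?thesis unfolding eq abs_divide abs_mult using t0 by simp
      qed
      have d: "\<bar>8 * b f / t - 8 * b g / t\<bar> \<le> 6"
        using that(3) t0 unfolding abs_eq by (simp add: field_simps)
      then have "\<bar>\<lfloor>8 * b f / t\<rfloor> - \<lfloor>8 * b g / t\<rfloor>\<bar> < 8" by linarith
      ultimately have "\<lfloor>8 * b f / t\<rfloor> = \<lfloor>8 * b g / t\<rfloor>"
      proof (rule_tac ccontr)
        assume "\<lfloor>8 * b f / t\<rfloor> mod 8 = \<lfloor>8 * b g / t\<rfloor> mod 8" "\<bar>\<lfloor>8 * b f / t\<rfloor> - \<lfloor>8 * b g / t\<rfloor>\<bar> < 8"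
          "\<lfloor>8 * b f / t\<rfloor> \<noteq> \<lfloor>8 * b g / t\<rfloor>"
        then show False
          using dvd_imp_le_int[of "\<lfloor>8 * b f / t\<rfloor> - \<lfloor>8 * b g / t\<rfloor>" 8]
          by (simp add: mod_eq_dvd_iff)
      qed
      then have "\<bar>8 * b f / t - 8 * b g / t\<bar> \<le> 1" by linarith
      then show ?thesis using t0 unfolding abs_eq by (simp add: field_simps)
    qed
    have Gp: "f \<in> A \<and> i mod 2 = p \<and> \<nu> \<le> card {h\<in>F. tangent t k f h \<and> idx k f h = i}
        \<and> (\<exists>s. \<bar>s\<bar> \<le> 1 \<and> \<bar>s - (real i / 2 ^ k - 2)\<bar> \<le> (3/2) / 2 ^ k
            \<and> real (card {g\<in>F. coef_dist f g \<le> t / 2 \<and> \<bar>val g s - val f s\<bar> \<le> 512 * (t / (64 * 4 ^ k))}) \<le> \<mu>)"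
      if "(i, f) \<in> G p q" for i f
    proof -
      have r: "(i, f) \<in> rich t k" "i mod 2 = p" "cl f = q" using that unfolding G_def by blast+
      have "f \<in> F \<and> real (card (cell t k f i)) > thr
          \<and> (\<exists>s. \<bar>s\<bar> \<le> 1 \<and> \<bar>s - (real i / 2 ^ k - 2)\<bar> \<le> (3/2) / 2 ^ k \<and> clean (t / 2) f s)"
        using r(1) unfolding rich_def thr_def x_def lam'_def mem_Collect_eq case_prod_conv .
      then have f: "f \<in> F" and gt: "real (card (cell t k f i)) > thr"
        and ex: "\<exists>s. \<bar>s\<bar> \<le> 1 \<and> \<bar>s - (real i / 2 ^ k - 2)\<bar> \<le> (3/2) / 2 ^ k \<and> clean (t / 2) f s"
        by blast+
      obtain s where s: "\<bar>s\<bar> \<le> 1" "\<bar>s - (real i / 2 ^ k - 2)\<bar> \<le> (3/2) / 2 ^ k" "clean (t / 2) f s"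
        using ex by blast
      have "count (t / 2) (1 / 2 ^ e) f s \<le> \<mu>" using s(3) e_n unfolding clean_def \<mu>_def by blast
      then have "real (card {g\<in>F. coef_dist f g \<le> t / 2 \<and> \<bar>val g s - val f s\<bar> \<le> 512 * (t / (64 * 4 ^ k))}) \<le> \<mu>"
        unfolding count_def e_eq .
      moreover have "\<nu> \<le> card {h\<in>F. tangent t k f h \<and> idx k f h = i}"
        using nu_le[OF gt] unfolding cell_def .
      ultimately show ?thesis using r f s unfolding A_def by blast
    qed
    show ?thesis
      using tangency_count[OF t0 k4 AF cls finG Gp mu0 rho_ge]
      unfolding of_nat_mult of_nat_power of_nat_numeral .
  qed
  have K: "real (k + 2) \<le> Y" using u_ge u by (simp add: Y_def)
  have muU: "\<mu> \<le> 512 * C * Y ^ 50 * x * N"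
  proof -
    have lam_e: "512 * lam' = 1 / 2 ^ e" using e_eq by (simp add: lam'_def)
    have "(512 * lam') powr \<delta> \<le> 512 * x"
      using powr_ratio_le[OF lam0, of "512 * lam'" \<delta>] delta lam0 by (simp add: x_def)
    then have "(1 / 2 ^ e) powr \<delta> \<le> 512 * x" unfolding lam_e .
    then have "C * Y ^ 50 * (1 / 2 ^ e) powr \<delta> * N \<le> C * Y ^ 50 * (512 * x) * N"
      using C1 Y0 N_pos by (intro mult_right_mono mult_left_mono) auto
    then show ?thesis by (simp add: \<mu>_def mult_ac)
  qed
  have rhoU: "\<rho> \<le> 128 * C * P\<^sup>2 * x * N\<^sup>2"
  proof -
    have "\<rho> \<le> N * (C * (128 * P\<^sup>2 * x) * N)"
      unfolding \<rho>_def using t2x C1 N_pos by (intro mult_left_mono mult_right_mono) auto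
    then show ?thesis by (simp add: power2_eq_square mult_ac)
  qed
  have rho0: "\<rho> \<ge> 0" using C1 N_pos by (simp add: \<rho>_def)
  note fails = tangency_alternatives_fail[OF N_pos x0 C1 Y_ge(1) P18 _ K mu0 rho0
      less_imp_le[OF pq, folded P_def] less_imp_le[OF nu_gt, unfolded thr_def] muU rhoU]
  have "(2::real) ^ (k + 2) = 4 * P" by (simp add: P_def)
  then show False using alt fails unfolding N_def[symmetric] by simp
qed

end

section \<open>Averaging over the parameter\<close>

lemma borel_measurable_card_Collect:
  assumes "finite F" "\<And>h. h \<in> F \<Longrightarrow> Measurable.pred M (P h)"
  shows "(\<lambda>s. real (card {h\<in>F. P h s})) \<in> borel_measurable M"
proof -
  have "(\<lambda>s. \<Sum>h\<in>F. of_bool (P h s) :: real) \<in> borel_measurable M"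
    using assms(2) by (intro borel_measurable_sum) measurable
  moreover have "(\<Sum>h\<in>F. of_bool (P h s) :: real) = real (card {h\<in>F. P h s})" for s
    using assms(1) by (simp add: sum_of_bool_eq Int_def)
  ultimately show ?thesis by simp
qed

lemma (in finite_measure) measure_card_gt_le:
  assumes H: "finite H" "\<And>h. h \<in> H \<Longrightarrow> S h \<in> sets M" and \<theta>: "\<theta> > 0"
  shows "measure M {s\<in>space M. real (card {h\<in>H. s \<in> S h}) > \<theta>} \<le> (\<Sum>h\<in>H. measure M (S h)) / \<theta>"
proof -
  let ?u = "\<lambda>s. \<Sum>h\<in>H. indicator (S h) s :: real"
  have ueq: "?u s = real (card {h\<in>H. s \<in> S h})" for s
    using H(1) by (simp add: indicator_def sum_of_bool_eq Int_def)
  have int: "integrable M ?u"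
    using H(2) by (intro Bochner_Integration.integrable_sum integrable_real_indicator) (auto simp: less_top[symmetric])
  have um: "?u \<in> borel_measurable M" using int by simp
  have "measure M {s\<in>space M. real (card {h\<in>H. s \<in> S h}) > \<theta>} \<le> measure M {s\<in>space M. ?u s \<ge> \<theta>}"
    by (rule finite_measure_mono) (use um in \<open>auto simp: ueq\<close>)
  also have "\<dots> \<le> (\<integral>s. ?u s \<partial>M) / \<theta>"
    by (rule integral_Markov_inequality_measure[OF int sets.empty_sets]) (auto simp: \<theta> sum_nonneg)
  also have "(\<integral>s. ?u s \<partial>M) = (\<Sum>h\<in>H. measure M (S h))"
    using H(2) by (subst Bochner_Integration.integral_sum)
      (auto intro!: sum.cong integrable_real_indicator simp: less_top[symmetric] Int_absorb1 sets.sets_into_space)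
  finally show ?thesis .
qed

context quad_family
begin

text \<open>The coefficients of \<open>h - f\<close> are determined by value, slope and leading
  coefficient \<open>B\<close> at \<open>s\<close>, so the distance is at most
  \<open>t / 64 + t / 8 + B\<close>; as it exceeds \<open>t / 2\<close>, this forces
  \<open>B \<ge> t / 4\<close>. With \<open>w = 1 / 2 ^ k\<close> the vertex then lies within
  \<open>(t w / 8) / (t / 4) = w / 2\<close> of \<open>s\<close>, and moving there changes the value
  by at most \<open>t w^2 / 32\<close>, twice the height \<open>t w^2 / 64\<close>: hence the 3 in
  \<open>tangent\<close>.\<close>

lemma tangentI:
  assumes t: "t > 0" and s: "\<bar>s\<bar> \<le> 1" and D: "t / 2 < coef_dist f h" "coef_dist f h \<le> t" and up: "b f \<le> b h"
    and q: "\<bar>val h s - val f s\<bar> \<le> t / (64 * 4 ^ k)" and d: "\<bar>slope h s - slope f s\<bar> \<le> t / (8 * 2 ^ k)"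
  shows "tangent t k f h \<and> \<bar>s - vert f h\<bar> \<le> (1/2) / 2 ^ k
    \<and> \<bar>s - (real (idx k f h) / 2 ^ k - 2)\<bar> \<le> (3/2) / 2 ^ k"
proof -
  define w :: real where "w = 1 / 2 ^ k"
  define B where "B = b h - b f"
  have w: "0 < w" "w \<le> 1" by (auto simp: w_def)
  have qw: "t / (64 * 4 ^ k) = t * w\<^sup>2 / 64"
    by (simp add: w_def power_divide power2_eq_square power_mult_distrib[symmetric])
  have dw: "t / (8 * 2 ^ k) = t * w / 8" by (simp add: w_def)
  have tw: "t * w \<le> t" using w t by simp
  have tw2: "t * w\<^sup>2 \<le> t" using w t by (simp add: power_le_one)
  have Bs: "\<bar>B * s\<bar> \<le> B" "\<bar>B * s\<^sup>2\<bar> \<le> B"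
  proof -
    have "B \<ge> 0" using up by (simp add: B_def)
    moreover have "s\<^sup>2 \<le> 1" using power_mono[OF s, of 2] by simp
    ultimately show "\<bar>B * s\<bar> \<le> B" "\<bar>B * s\<^sup>2\<bar> \<le> B"
      using s mult_left_mono[of "\<bar>s\<bar>" 1 B] mult_left_mono[of "s\<^sup>2" 1 B] by (auto simp: abs_mult)
  qed
  have ds: "\<bar>(slope h s - slope f s) * s\<bar> \<le> t * w / 8"
    unfolding abs_mult using mult_mono[OF d s] t w unfolding dw by simp
  have ceq: "c h - c f = (slope h s - slope f s) - B * s" by (simp add: slope_def B_def algebra_simps)
  have aeq: "a h - a f = (val h s - val f s) - (slope h s - slope f s) * s + B * s\<^sup>2 / 2"
    by (simp add: slope_def val_def B_def field_simps power2_eq_square)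
  have "\<bar>c h - c f\<bar> \<le> t * w / 8 + B" using ceq d Bs unfolding dw by linarith
  moreover have "\<bar>a h - a f\<bar> \<le> t * w\<^sup>2 / 64 + t * w / 8 + B" using aeq q ds Bs unfolding qw by linarith
  ultimately have "coef_dist f h \<le> t / 64 + t / 8 + B"
    unfolding coef_dist_le_iff using tw tw2 t up B_def by (intro conjI; linarith)
  then have B4: "B \<ge> t / 4" using D t by linarith
  then have ne: "b h \<noteq> b f" using t by (auto simp: B_def)
  have "B * \<bar>s - vert f h\<bar> \<le> t * w / 8"
    using slope_diff_vert[OF ne, of s] d up unfolding dw by (simp add: abs_mult B_def)
  moreover have "(t / 4) * \<bar>s - vert f h\<bar> \<le> B * \<bar>s - vert f h\<bar>" using B4 by (intro mult_right_mono) auto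
  ultimately have "t * \<bar>s - vert f h\<bar> \<le> t * (w / 2)" by linarith
  then have sv: "\<bar>s - vert f h\<bar> \<le> w / 2" using t by simp
  then have v2: "\<bar>vert f h\<bar> \<le> 2" using s w by linarith
  have "B * (s - vert f h)\<^sup>2 \<le> (t * w / 8) * (w / 2)"
  proof -
    have "B * (s - vert f h)\<^sup>2 = (B * \<bar>s - vert f h\<bar>) * \<bar>s - vert f h\<bar>" by (simp add: power2_eq_square)
    also have "\<dots> \<le> (t * w / 8) * (w / 2)"
      using \<open>B * \<bar>s - vert f h\<bar> \<le> t * w / 8\<close> sv t w by (intro mult_mono) auto
    finally show ?thesis .
  qed
  then have "B * (s - vert f h)\<^sup>2 \<le> 4 * (t * w\<^sup>2 / 64)" by (simp add: power2_eq_square)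
  moreover have "B * (s - vert f h)\<^sup>2 \<ge> 0" using B4 t by simp
  ultimately have "\<bar>val h (vert f h) - val f (vert f h)\<bar> \<le> 3 * (t * w\<^sup>2 / 64)"
    using val_diff_vert[OF ne, of s] q unfolding qw B_def[symmetric] by linarith
  then have T: "tangent t k f h" unfolding tangent_def qw using B4 v2 D by (simp add: B_def)
  have "\<bar>s - (real (idx k f h) / 2 ^ k - 2)\<bar> \<le> (3/2) * w"
    using idx_window[OF v2, of k, folded w_def] sv by linarith
  then have "\<bar>s - (real (idx k f h) / 2 ^ k - 2)\<bar> \<le> (3/2) / 2 ^ k" by (simp add: w_def)
  then show ?thesis using T sv by (simp add: w_def)
qed

end

text \<open>The parameter enters only through a coordinate \<sigma> whose distribution is dominated
  by Lebesgue measure on [-1, 1]. This allows the unit ball of \<open>real^'m\<close> with a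
  one-element index type to be used without transporting its measure to the line.\<close>

locale projected_quads = frostman_quads F a c b C \<delta> n + finite_measure M
  for F :: "'z set" and a c b C \<delta> n and M :: "'s measure" +
  fixes \<sigma> :: "'s \<Rightarrow> real"
  assumes sig_meas [measurable]: "\<sigma> \<in> borel_measurable M"
    and sig_bd: "s \<in> space M \<Longrightarrow> \<bar>\<sigma> s\<bar> \<le> 1"
    and slab: "u \<le> v \<Longrightarrow> measure M {s\<in>space M. u \<le> \<sigma> s \<and> \<sigma> s \<le> v} \<le> v - u"
begin

abbreviation gap :: "'z \<Rightarrow> 'z \<Rightarrow> 's \<Rightarrow> real" where
  "gap f h s \<equiv> \<bar>val h (\<sigma> s) - val f (\<sigma> s)\<bar>"
abbreviation incline :: "'z \<Rightarrow> 'z \<Rightarrow> 's \<Rightarrow> real" where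
  "incline f h s \<equiv> \<bar>slope h (\<sigma> s) - slope f (\<sigma> s)\<bar>"

lemma val_measurable [measurable]: "(\<lambda>s. val h (\<sigma> s)) \<in> borel_measurable M"
  unfolding val_def by measurable
lemma slope_measurable [measurable]: "(\<lambda>s. slope h (\<sigma> s)) \<in> borel_measurable M"
  unfolding slope_def by measurable
lemma count_measurable [measurable]: "(\<lambda>s. count t r f (\<sigma> s)) \<in> borel_measurable M"
  unfolding count_def using finite_F by (intro borel_measurable_card_Collect) measurable
lemma clean_measurable [measurable]: "Measurable.pred M (\<lambda>s. clean t f (\<sigma> s))"
  unfolding clean_def by measurable

lemma measure_le_diam:
  assumes "A \<subseteq> space M" "d \<ge> 0" "\<And>s s'. s \<in> A \<Longrightarrow> s' \<in> A \<Longrightarrow> \<sigma> s < \<sigma> s' \<Longrightarrow> \<sigma> s' - \<sigma> s \<le> d"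
  shows "measure M A \<le> d"
proof (cases "A = {}")
  case False
  define l where "l = Inf (\<sigma> ` A)"
  have bdd: "bdd_below (\<sigma> ` A)"
    using sig_bd assms(1) by (intro bdd_belowI[of _ "-1"]) force
  have "A \<subseteq> {s\<in>space M. l \<le> \<sigma> s \<and> \<sigma> s \<le> l + d}"
  proof
    fix s assume s: "s \<in> A"
    have "l \<le> \<sigma> s" unfolding l_def using s bdd by (intro cInf_lower) auto
    moreover have "\<sigma> s - d \<le> l"
      unfolding l_def
    proof (rule cInf_greatest)
      fix x assume "x \<in> \<sigma> ` A"
      then obtain s' where "s' \<in> A" "x = \<sigma> s'" by auto
      then show "\<sigma> s - d \<le> x" using assms(2) assms(3)[of s' s] s by (cases "\<sigma> s' < \<sigma> s") auto
    qed (use False in auto)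
    ultimately show "s \<in> {s\<in>space M. l \<le> \<sigma> s \<and> \<sigma> s \<le> l + d}" using s assms(1) by auto
  qed
  then have "measure M A \<le> measure M {s\<in>space M. l \<le> \<sigma> s \<and> \<sigma> s \<le> l + d}"
    by (rule finite_measure_mono) measurable
  also have "\<dots> \<le> l + d - l" by (rule slab) (use assms in simp)
  finally show ?thesis by simp
qed (use assms in simp)

text \<open>The secant slope of a quadratic is the mean of the slopes at the two ends. Two points of
  the set with slopes of the same sign are therefore at distance at most \<open>2 * r / D\<close>,
  whatever happens between them; the two signs give the factor 4.\<close>

lemma measure_transversal:
  assumes r: "r \<ge> 0" and D: "D > 0"
  shows "measure M {s\<in>space M. gap f h s \<le> r \<and> incline f h s > D} \<le> 4 * r / D"
proof -
  let ?q = "\<lambda>x. val h x - val f x" and ?d = "\<lambda>x. slope h x - slope f x"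
  have diff: "2 * (?q y - ?q x) = (y - x) * (?d x + ?d y)" for x y
    by (simp add: val_def slope_def field_simps power2_eq_square)
  let ?A = "{s\<in>space M. \<bar>?q (\<sigma> s)\<bar> \<le> r \<and> ?d (\<sigma> s) > D}"
  let ?B = "{s\<in>space M. \<bar>?q (\<sigma> s)\<bar> \<le> r \<and> ?d (\<sigma> s) < - D}"
  have A: "measure M ?A \<le> 2 * r / D"
  proof (rule measure_le_diam)
    fix s s' assume ss: "s \<in> ?A" "s' \<in> ?A" "\<sigma> s < \<sigma> s'"
    have "(\<sigma> s' - \<sigma> s) * (2 * D) \<le> (\<sigma> s' - \<sigma> s) * (?d (\<sigma> s) + ?d (\<sigma> s'))"
      by (rule mult_left_mono) (use ss in auto)
    also have "\<dots> = 2 * (?q (\<sigma> s') - ?q (\<sigma> s))" by (rule diff[symmetric])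
    also have "\<dots> \<le> 4 * r" using ss by auto
    finally show "\<sigma> s' - \<sigma> s \<le> 2 * r / D" using D by (simp add: field_simps)
  qed (use r D in auto)
  have B: "measure M ?B \<le> 2 * r / D"
  proof (rule measure_le_diam)
    fix s s' assume ss: "s \<in> ?B" "s' \<in> ?B" "\<sigma> s < \<sigma> s'"
    have "(\<sigma> s' - \<sigma> s) * (2 * D) \<le> (\<sigma> s' - \<sigma> s) * (- (?d (\<sigma> s) + ?d (\<sigma> s')))"
      by (rule mult_left_mono) (use ss in auto)
    also have "\<dots> = - (2 * (?q (\<sigma> s') - ?q (\<sigma> s)))" by (simp only: diff mult_minus_right)
    also have "\<dots> \<le> 4 * r" using ss by auto
    finally show "\<sigma> s' - \<sigma> s \<le> 2 * r / D" using D by (simp add: field_simps)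
  qed (use r D in auto)
  have "measure M {s\<in>space M. \<bar>?q (\<sigma> s)\<bar> \<le> r \<and> \<bar>?d (\<sigma> s)\<bar> > D} \<le> measure M (?A \<union> ?B)"
  proof (rule finite_measure_mono)
    show "?A \<union> ?B \<in> sets M" by (intro sets.Un) measurable
  qed auto
  also have "\<dots> \<le> measure M ?A + measure M ?B" by (intro measure_Un_le) measurable
  also have "\<dots> \<le> 4 * r / D" using A B by simp
  finally show ?thesis .
qed

end

section \<open>Neighbours at one distance, sorted by slope\<close>

context projected_quads
begin

text \<open>Only neighbours that can touch \<open>f\<close> from above, as \<open>tangent\<close>
  demands; \<open>shell_step\<close> obtains the others by a reflection.\<close>

definition upper :: "real \<Rightarrow> 'z \<Rightarrow> 'z set" where
  "upper t f = {h\<in>F. t / 2 < coef_dist f h \<and> coef_dist f h \<le> t \<and> b f \<le> b h}"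
text \<open>\<open>real i / 2 ^ k - 2\<close> is the left end of cell \<open>i\<close>. A parameter
  within half a width of a vertex in the cell is within 3/2 widths of that end.\<close>

definition near_rich :: "real \<Rightarrow> nat \<Rightarrow> 'z \<Rightarrow> 's set" where
  "near_rich t k f = {s\<in>space M. \<exists>i. (i, f) \<in> rich t k \<and> \<bar>\<sigma> s - (real i / 2 ^ k - 2)\<bar> \<le> (3/2) / 2 ^ k}"

lemma near_rich_sets [measurable]: "near_rich t k f \<in> sets M"
  unfolding near_rich_def by measurable

lemma finite_upper [simp]: "finite (upper t f)" using finite_F by (simp add: upper_def)

lemma card_upper_le:
  assumes "f \<in> F" "t \<ge> 2 / 2 ^ n"
  shows "real (card (upper t f)) \<le> C * t powr \<delta> * N"
proof -
  have "card (upper t f) \<le> card {g\<in>F. coef_dist f g \<le> t}"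
    using finite_F by (intro card_mono) (auto simp: upper_def)
  then show ?thesis using frost[OF assms] by (simp add: N_def)
qed

lemma measure_near_rich:
  "measure M (near_rich t k f) \<le> 3 / 2 ^ k * real (card {i. (i, f) \<in> rich t k})"
proof -
  let ?J = "{i. (i, f) \<in> rich t k}"
  let ?W = "\<lambda>i. {s\<in>space M. real i / 2 ^ k - 2 - (3/2) / 2 ^ k \<le> \<sigma> s \<and> \<sigma> s \<le> real i / 2 ^ k - 2 + (3/2) / 2 ^ k}"
  have fin: "finite ?J" by (rule finite_section) simp
  have "near_rich t k f \<subseteq> (\<Union>i\<in>?J. ?W i)" by (auto simp: near_rich_def abs_le_iff)
  then have "measure M (near_rich t k f) \<le> measure M (\<Union>i\<in>?J. ?W i)"
    by (rule finite_measure_mono) (use fin in measurable)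
  also have "\<dots> \<le> (\<Sum>i\<in>?J. measure M (?W i))"
    by (rule measure_UNION_le[OF fin]) measurable
  also have "\<dots> \<le> (\<Sum>i\<in>?J. 3 / 2 ^ k)"
  proof (rule sum_mono)
    fix i
    have "measure M (?W i) \<le> (real i / 2 ^ k - 2 + (3/2) / 2 ^ k) - (real i / 2 ^ k - 2 - (3/2) / 2 ^ k)"
      by (rule slab) simp
    then show "measure M (?W i) \<le> 3 / 2 ^ k" by simp
  qed
  finally show ?thesis by (simp add: mult_ac)
qed

text \<open>If \<open>Z h\<close> contains \<open>s\<close>, then \<open>h\<close> touches
  \<open>f\<close> in a cell near \<open>s\<close>. That cell cannot be rich: \<open>s\<close>
  itself would be the clean witness, and \<open>s\<close> would belong to \<open>near_rich\<close>.
  So at most \<open>5 * 2 ^ k\<close> cells with few members contribute, and each \<open>Z h\<close>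
  has measure \<open>O(r / (2 ^ k * lam'))\<close>. The number of cells cancels
  \<open>2 ^ k\<close>, and \<open>r \<le> lam'\<close> with \<delta> < 1 does the rest.\<close>

lemma level_transversal:
  assumes t: "t > 0" and f: "f \<in> F" and r: "r > 0" and lam: "t / (64 * 4 ^ k) \<ge> r"
    and last: "k < ks \<or> t / (64 * 4 ^ k) \<le> 2 * r"
    and good: "\<And>s. s \<in> good \<Longrightarrow> s \<in> space M \<and> clean (t / 2) f (\<sigma> s) \<and> s \<notin> near_rich t k f"
  defines "Z \<equiv> \<lambda>h. {s\<in>good. gap f h s \<le> r \<and> incline f h s \<le> t / (8 * 2 ^ k)
      \<and> (k < ks \<longrightarrow> incline f h s > t / (16 * 2 ^ k))}"
  shows "(\<Sum>h\<in>upper t f. measure M (Z h)) \<le> 20 * C * Y ^ 42 * r powr \<delta> * N"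
proof -
  define lam' where "lam' = t / (64 * 4 ^ k)"
  define thr where "thr = C * Y ^ 42 * lam' powr \<delta> * N"
  have lam0: "lam' > 0" using t by (simp add: lam'_def)
  have thr0: "thr \<ge> 0" using C1 Y_ge N_pos by (simp add: thr_def)
  have t_lam: "t = 64 * (2 ^ k)\<^sup>2 * lam'"
    by (simp add: lam'_def power2_eq_square power_mult_distrib[symmetric])
  have tan: "tangent t k f h \<and> \<bar>\<sigma> s - vert f h\<bar> \<le> (1/2) / 2 ^ k
      \<and> \<bar>\<sigma> s - (real (idx k f h) / 2 ^ k - 2)\<bar> \<le> (3/2) / 2 ^ k"
    if h: "h \<in> upper t f" and s: "s \<in> Z h" for h s
  proof (rule tangentI[OF t])
    show "\<bar>\<sigma> s\<bar> \<le> 1" using s good sig_bd by (auto simp: Z_def)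
    show "gap f h s \<le> t / (64 * 4 ^ k)" using s lam by (auto simp: Z_def)
  qed (use h s in \<open>auto simp: upper_def Z_def\<close>)
  let ?J = "{i. i \<le> 4 * 2 ^ k \<and> real (card (cell t k f i)) \<le> thr}"
  let ?H = "{h\<in>upper t f. Z h \<noteq> {}}"
  have fincell: "finite (cell t k f i)" for i using finite_F by (simp add: cell_def)
  have H_sub: "?H \<subseteq> (\<Union>i\<in>?J. cell t k f i)"
  proof
    fix h assume "h \<in> ?H"
    then obtain s where h: "h \<in> upper t f" and s: "s \<in> Z h" by auto
    note T = tan[OF h s]
    have in_cell: "h \<in> cell t k f (idx k f h)" using T h by (simp add: cell_def upper_def)
    have sg: "s \<in> space M" "clean (t / 2) f (\<sigma> s)" "s \<notin> near_rich t k f"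
      using s good by (auto simp: Z_def)
    then have "(idx k f h, f) \<notin> rich t k" using T unfolding near_rich_def by blast
    moreover have "\<exists>s. \<bar>s\<bar> \<le> 1 \<and> \<bar>s - (real (idx k f h) / 2 ^ k - 2)\<bar> \<le> (3/2) / 2 ^ k \<and> clean (t / 2) f s"
      using T sg sig_bd[OF sg(1)] by blast
    ultimately have "\<not> real (card (cell t k f (idx k f h))) > thr"
      using f unfolding rich_def thr_def lam'_def by blast
    moreover have "idx k f h \<le> 4 * 2 ^ k"
      using T idx_bounds(3)[of f h k] unfolding tangent_def by blast
    ultimately show "h \<in> (\<Union>i\<in>?J. cell t k f i)" using in_cell by auto
  qed
  have finJ: "finite ?J" by (rule finite_subset[of _ "{..4 * 2 ^ k}"]) auto
  have "card ?H \<le> card (\<Union>i\<in>?J. cell t k f i)"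
    using H_sub by (rule card_mono[rotated]) (use finJ fincell in auto)
  also have "\<dots> \<le> (\<Sum>i\<in>?J. card (cell t k f i))" by (rule card_UN_le[OF finJ])
  finally have "real (card ?H) \<le> (\<Sum>i\<in>?J. real (card (cell t k f i)))"
    unfolding of_nat_sum[symmetric] of_nat_le_iff .
  also have "\<dots> \<le> (\<Sum>i\<in>?J. thr)" by (rule sum_mono) simp
  also have "\<dots> = real (card ?J) * thr" by simp
  also have "\<dots> \<le> (5 * 2 ^ k) * thr"
  proof (rule mult_right_mono[OF _ thr0])
    have "card ?J \<le> card {..4 * 2 ^ k :: nat}" by (rule card_mono) auto
    then have "card ?J \<le> 4 * 2 ^ k + 1" by simp
    moreover have "(1::nat) \<le> 2 ^ k" by simp
    ultimately have "card ?J \<le> 5 * 2 ^ k" by linarith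
    then have "real (card ?J) \<le> real (5 * 2 ^ k)" by (simp only: of_nat_le_iff)
    then show "real (card ?J) \<le> 5 * 2 ^ k" by simp
  qed
  finally have cardH: "real (card ?H) \<le> (5 * 2 ^ k) * thr" .
  have mZ: "measure M (Z h) \<le> 4 * r / (2 ^ k * lam')" if h: "h \<in> upper t f" for h
  proof (cases "k < ks")
    case True
    have "measure M (Z h) \<le> measure M {s\<in>space M. gap f h s \<le> r
        \<and> incline f h s > t / (16 * 2 ^ k)}"
      by (rule finite_measure_mono) (use True good in \<open>auto simp: Z_def\<close>)
    also have "\<dots> \<le> 4 * r / (t / (16 * 2 ^ k))"
      by (rule measure_transversal) (use r t in auto)
    also have "\<dots> = r / (2 ^ k * lam')" unfolding t_lam using lam0 by (simp add: power2_eq_square field_simps)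
    also have "\<dots> \<le> 4 * r / (2 ^ k * lam')" using r lam0 by (simp add: divide_right_mono)
    finally show ?thesis .
  next
    case False
    \<comment> \<open>At the last level the slope has no lower bound. Being within half a cell of
      the vertex is enough there, because \<open>lam' \<le> 2 * r\<close>.\<close>
    have "measure M (Z h) \<le> 1 / 2 ^ k"
    proof (rule measure_le_diam)
      fix s s' assume "s \<in> Z h" "s' \<in> Z h"
      then show "\<sigma> s' - \<sigma> s \<le> 1 / 2 ^ k" using tan[OF h, of s] tan[OF h, of s'] by (simp add: abs_le_iff)
    qed (use good in \<open>auto simp: Z_def\<close>)
    also have "\<dots> \<le> 4 * r / (2 ^ k * lam')"
      using last False lam0 r unfolding lam'_def[symmetric] by (simp add: field_simps)
    finally show ?thesis .
  qed
  have "(\<Sum>h\<in>upper t f. measure M (Z h)) = (\<Sum>h\<in>?H. measure M (Z h))"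
    by (rule sum.mono_neutral_right) auto
  also have "\<dots> \<le> (\<Sum>h\<in>?H. 4 * r / (2 ^ k * lam'))" by (rule sum_mono) (use mZ in auto)
  also have "\<dots> = real (card ?H) * (4 * r / (2 ^ k * lam'))" by simp
  also have "\<dots> \<le> ((5 * 2 ^ k) * thr) * (4 * r / (2 ^ k * lam'))"
    by (rule mult_right_mono[OF cardH]) (use r lam0 in simp)
  also have "\<dots> = 20 * C * Y ^ 42 * (r / lam' * lam' powr \<delta>) * N"
    using lam0 by (simp add: thr_def)
  also have "\<dots> \<le> 20 * C * Y ^ 42 * r powr \<delta> * N"
  proof -
    have "lam' powr \<delta> \<le> (lam' / r) * r powr \<delta>"
      using powr_ratio_le[OF r, of lam' \<delta>] lam delta by (simp add: lam'_def)
    then have "r / lam' * lam' powr \<delta> \<le> r powr \<delta>" using r lam0 by (simp add: field_simps)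
    then show ?thesis using C1 Y_ge N_pos by (intro mult_right_mono mult_left_mono) auto
  qed
  finally show ?thesis .
qed

text \<open>Parameters near rich cells have total measure at most \<open>48 * N / Y ^ 8\<close> per
  level. Away from them the mean number of neighbours is at most
  \<open>21 * C * Y ^ 43 * r powr \<delta> * N\<close>, so Markov's inequality against the threshold
  with \<open>Y ^ 48\<close> leaves \<open>21 / Y ^ 5\<close> for each \<open>f\<close>.\<close>

lemma upper_step:
  assumes u: "1 \<le> u" "u \<le> n + 1" and t: "t = 2 ^ u / 2 ^ n" and i0: "i0 < n" and r: "r = 1 / 2 ^ i0"
  shows "(\<Sum>f\<in>F. measure M {s\<in>space M. clean (t / 2) f (\<sigma> s)
      \<and> real (card {h\<in>upper t f. gap f h s \<le> r}) > C * Y ^ 48 * r powr \<delta> * N}) \<le> N / Y ^ 4"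
proof -
  define \<theta> where "\<theta> = C * Y ^ 48 * r powr \<delta> * N"
  define bad where "bad f = {s\<in>space M. clean (t / 2) f (\<sigma> s)
      \<and> real (card {h\<in>upper t f. gap f h s \<le> r}) > \<theta>}" for f
  have t0: "t > 0" by (simp add: t)
  have r0: "r > 0" by (simp add: r)
  have Y0: "Y > 0" using Y_ge by simp
  have x0: "r powr \<delta> > 0" using r0 by simp
  have theta0: "\<theta> > 0" using C1 Y0 x0 N_pos by (simp add: \<theta>_def)
  have t2: "t \<ge> 2 / 2 ^ n"
    using power_increasing[OF u(1), of "2::real"] by (simp add: t divide_right_mono)
  show ?thesis
  \<comment> \<open>Below 64 r there is no level with \<open>t / (64 * 4 ^ k) \<ge> r\<close>, but
    the whole ball of radius \<open>t\<close> is already small enough.\<close>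
  proof (cases "t < 64 * r")
    case True
    have "bad f = {}" if f: "f \<in> F" for f
    proof -
      have "real (card {h\<in>upper t f. gap f h s \<le> r}) \<le> \<theta>" for s
      proof -
        have "card {h\<in>upper t f. gap f h s \<le> r} \<le> card (upper t f)"
          by (rule card_mono) auto
        then have "real (card {h\<in>upper t f. gap f h s \<le> r}) \<le> C * t powr \<delta> * N"
          using card_upper_le[OF f t2] by linarith
        also have "\<dots> \<le> C * (64 * r powr \<delta>) * N"
        proof -
          have "t powr \<delta> \<le> (64 * r) powr \<delta>" using True t0 delta by (intro powr_mono2) auto
          also have "\<dots> \<le> 64 * r powr \<delta>"
            using powr_ratio_le[OF r0, of "64 * r" \<delta>] delta r0 by simp
          finally show ?thesis using C1 N_pos by (intro mult_right_mono mult_left_mono) auto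
        qed
        also have "\<dots> = C * r powr \<delta> * N * 64" by simp
        also have "\<dots> \<le> C * r powr \<delta> * N * Y ^ 48"
        proof (intro mult_left_mono)
          have "1000 ^ 48 \<le> Y ^ 48" using Y_ge by (intro power_mono) auto
          then show "64 \<le> Y ^ 48" by simp
        qed (use C1 N_pos x0 in auto)
        also have "\<dots> = \<theta>" by (simp add: \<theta>_def)
        finally show ?thesis .
      qed
      then show ?thesis by (auto simp: bad_def not_less[symmetric])
    qed
    then have "(\<Sum>f\<in>F. measure M (bad f)) = 0" by simp
    moreover have "N / Y ^ 4 \<ge> 0" using N_pos Y0 by simp
    ultimately show ?thesis unfolding bad_def \<theta>_def by linarith
  next
    case False
    have exp_le: "n + 6 \<le> u + i0"
    proof -
      have "(2::real) ^ (n + 6) \<le> 2 ^ (u + i0)" using False by (simp add: t r field_simps power_add)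
      then show ?thesis by (simp only: power_increasing_iff)
    qed
    define e where "e = u + i0 - (n + 6)"
    \<comment> \<open>Since \<open>t / 64 = r * 2 ^ e\<close>, this is the last \<open>k\<close>
      with \<open>t / (64 * 4 ^ k) \<ge> r\<close>; rounding down leaves that height at most
      \<open>2 * r\<close>.\<close>
    define ks where "ks = e div 2"
    have esum: "u + i0 = n + 6 + e" using exp_le by (simp add: e_def)
    have ksY: "real (ks + 1) \<le> Y" using esum u i0 unfolding ks_def Y_def by linarith
    have lam_eq: "t / (64 * 4 ^ k) = r * (2 ^ e / 4 ^ k)" for k
    proof -
      have "(2::real) ^ u * 2 ^ i0 = 2 ^ n * 64 * 2 ^ e"
        using arg_cong[OF esum, of "\<lambda>m. (2::real) ^ m"] by (simp add: power_add)
      then show ?thesis unfolding t r by (simp add: field_simps)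
    qed
    have four: "(4::real) ^ k = 2 ^ (2 * k)" for k by (simp add: power_mult)
    have lam_ge: "t / (64 * 4 ^ k) \<ge> r" if "k \<le> ks" for k
    proof -
      have "(2::real) ^ (2 * k) \<le> 2 ^ e" using that by (intro power_increasing) (auto simp: ks_def)
      then have "1 \<le> (2::real) ^ e / 4 ^ k" by (simp add: four)
      then show ?thesis unfolding lam_eq using mult_left_mono[of 1 "2 ^ e / 4 ^ k" r] r0 by simp
    qed
    have lam_last: "t / (64 * 4 ^ ks) \<le> 2 * r"
    proof -
      have "(2::real) ^ e \<le> 2 ^ (2 * ks + 1)" by (intro power_increasing) (auto simp: ks_def)
      then have "(2::real) ^ e / 4 ^ ks \<le> 2" by (simp add: four field_simps)
      then show ?thesis unfolding lam_eq using mult_left_mono[of "2 ^ e / 4 ^ ks" 2 r] r0 by simp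
    qed
    have r_ge: "r \<ge> 2 / 2 ^ n"
    proof -
      have "(2::real) ^ (i0 + 1) \<le> 2 ^ n" using i0 by (intro power_increasing) auto
      then show ?thesis by (simp add: r field_simps)
    qed
    define good where "good f = {s\<in>space M. clean (t / 2) f (\<sigma> s) \<and> (\<forall>k\<le>ks. s \<notin> near_rich t k f)}" for f
    have good_sets [measurable]: "good f \<in> sets M" for f unfolding good_def by measurable
    define Yh where "Yh f h = {s\<in>good f. gap f h s \<le> r}" for f h
    have Yh_sets: "Yh f h \<in> sets M" for f h
    proof -
      have "Yh f h = good f \<inter> {s\<in>space M. gap f h s \<le> r}"
        using sets.sets_into_space[OF good_sets] unfolding Yh_def by blast
      then show ?thesis by simp
    qed
    have sumY: "(\<Sum>h\<in>upper t f. measure M (Yh f h)) \<le> 21 * C * Y ^ 43 * r powr \<delta> * N" if f: "f \<in> F" for f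
    proof -
      define Z where "Z k h = {s\<in>good f. gap f h s \<le> r \<and> incline f h s \<le> t / (8 * 2 ^ k)
        \<and> (k < ks \<longrightarrow> incline f h s > t / (16 * 2 ^ k))}" for k h
      define T0 where "T0 h = {s\<in>space M. gap f h s \<le> r \<and> incline f h s > t / 8}" for h
      have Z_sets: "Z k h \<in> sets M" for k h
      proof -
        have "Z k h = good f \<inter> {s\<in>space M. gap f h s \<le> r \<and> incline f h s \<le> t / (8 * 2 ^ k)
          \<and> (k < ks \<longrightarrow> incline f h s > t / (16 * 2 ^ k))}"
          using sets.sets_into_space[OF good_sets] unfolding Z_def by blast
        then show ?thesis by simp
      qed
      have T0_sets: "T0 h \<in> sets M" for h unfolding T0_def by measurable
      have cover: "Yh f h \<subseteq> T0 h \<union> (\<Union>k\<in>{..ks}. Z k h)" for h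
      proof
        fix s assume s: "s \<in> Yh f h"
        let ?d = "incline f h s"
        show "s \<in> T0 h \<union> (\<Union>k\<in>{..ks}. Z k h)"
        proof (cases "?d > t / 8")
          case True
          then show ?thesis using s by (auto simp: Yh_def T0_def good_def)
        next
          case False
          have ex: "\<exists>k\<le>m. P k \<and> (k < m \<longrightarrow> \<not> P (Suc k))" if "P 0" for P and m :: nat
            using that
          proof (induction m)
            case (Suc m)
            then obtain k where k: "k \<le> m" "P k" "k < m \<longrightarrow> \<not> P (Suc k)" by blast
            show ?case
            proof (cases "P (Suc m)")
              case False
              then have "k < Suc m \<longrightarrow> \<not> P (Suc k)" using k by (cases "k = m") auto
              then show ?thesis using k by (intro exI[of _ k]) auto
            qed auto
          qed auto
          obtain k where k: "k \<le> ks" "?d \<le> t / (8 * 2 ^ k)" "k < ks \<longrightarrow> \<not> ?d \<le> t / (8 * 2 ^ Suc k)"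
            using ex[of "\<lambda>k. ?d \<le> t / (8 * 2 ^ k)" ks] False by auto
          have "s \<in> Z k h" using s k unfolding Z_def Yh_def by auto
          then show ?thesis using k(1) by auto
        qed
      qed
      have T0: "(\<Sum>h\<in>upper t f. measure M (T0 h)) \<le> C * Y ^ 43 * r powr \<delta> * N"
      proof -
        have "(\<Sum>h\<in>upper t f. measure M (T0 h)) \<le> (\<Sum>h\<in>upper t f. 4 * r / (t / 8))"
          unfolding T0_def by (intro sum_mono measure_transversal) (use r0 t0 in auto)
        also have "\<dots> = real (card (upper t f)) * (32 * r / t)" by simp
        also have "\<dots> \<le> (C * t powr \<delta> * N) * (32 * r / t)"
          by (rule mult_right_mono[OF card_upper_le[OF f t2]]) (use r0 t0 in simp)
        also have "\<dots> \<le> (C * ((t / r) * r powr \<delta>) * N) * (32 * r / t)"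
        proof -
          have "r \<le> t" using False r0 by linarith
          then show ?thesis using powr_ratio_le[OF r0, of t \<delta>] delta C1 N_pos r0 t0
            by (intro mult_right_mono mult_left_mono) auto
        qed
        also have "\<dots> = C * r powr \<delta> * N * 32" using r0 t0 by simp
        also have "\<dots> \<le> C * r powr \<delta> * N * Y ^ 43"
        proof (intro mult_left_mono)
          have "1000 ^ 43 \<le> Y ^ 43" using Y_ge by (intro power_mono) auto
          then show "32 \<le> Y ^ 43" by simp
        qed (use C1 N_pos x0 in auto)
        finally show ?thesis by (simp add: mult_ac)
      qed
      have Zk: "(\<Sum>h\<in>upper t f. measure M (Z k h)) \<le> 20 * C * Y ^ 42 * r powr \<delta> * N" if "k \<le> ks" for k
        unfolding Z_def
      proof (rule level_transversal[OF t0 f r0 lam_ge[OF that]])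
        show "k < ks \<or> t / (64 * 4 ^ k) \<le> 2 * r" using lam_last that by (cases "k = ks") auto
        show "s \<in> space M \<and> clean (t / 2) f (\<sigma> s) \<and> s \<notin> near_rich t k f" if "s \<in> good f" for s
          using that \<open>k \<le> ks\<close> by (auto simp: good_def)
      qed
      have "(\<Sum>h\<in>upper t f. measure M (Yh f h)) \<le> (\<Sum>h\<in>upper t f. measure M (T0 h) + (\<Sum>k\<le>ks. measure M (Z k h)))"
      proof (rule sum_mono)
        fix h
        have "measure M (Yh f h) \<le> measure M (T0 h \<union> (\<Union>k\<in>{..ks}. Z k h))"
          using cover by (rule finite_measure_mono) (use T0_sets Z_sets in auto)
        also have "\<dots> \<le> measure M (T0 h) + measure M (\<Union>k\<in>{..ks}. Z k h)"
          using T0_sets Z_sets by (intro measure_Un_le) auto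
        also have "measure M (\<Union>k\<in>{..ks}. Z k h) \<le> (\<Sum>k\<le>ks. measure M (Z k h))"
          using Z_sets by (intro measure_UNION_le) auto
        finally show "measure M (Yh f h) \<le> measure M (T0 h) + (\<Sum>k\<le>ks. measure M (Z k h))" by simp
      qed
      also have "\<dots> = (\<Sum>h\<in>upper t f. measure M (T0 h)) + (\<Sum>k\<le>ks. \<Sum>h\<in>upper t f. measure M (Z k h))"
        by (simp add: sum.distrib sum.swap[of _ "upper t f"])
      also have "\<dots> \<le> C * Y ^ 43 * r powr \<delta> * N + (\<Sum>k\<le>ks. 20 * C * Y ^ 42 * r powr \<delta> * N)"
        by (intro add_mono T0 sum_mono Zk) auto
      also have "(\<Sum>k\<le>ks. 20 * C * Y ^ 42 * r powr \<delta> * N) = real (ks + 1) * (20 * C * Y ^ 42 * r powr \<delta> * N)" by simp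
      also have "\<dots> \<le> Y * (20 * C * Y ^ 42 * r powr \<delta> * N)"
        by (rule mult_right_mono[OF ksY]) (use C1 Y0 N_pos in simp)
      also have "\<dots> = 20 * C * (Y * Y ^ 42) * r powr \<delta> * N" by simp
      also have "Y * Y ^ 42 = Y ^ 43" by (simp flip: power_Suc)
      finally show ?thesis by (simp add: mult_ac)
    qed
    have mbad: "measure M (bad f) \<le> 21 / Y ^ 5 + (\<Sum>k\<le>ks. measure M (near_rich t k f))" if f: "f \<in> F" for f
    proof -
      let ?MK = "{s\<in>space M. real (card {h\<in>upper t f. s \<in> Yh f h}) > \<theta>}"
      have MK_sets: "?MK \<in> sets M"
      proof -
        have "(\<lambda>s. real (card {h\<in>upper t f. s \<in> Yh f h})) \<in> borel_measurable M"
          using Yh_sets[measurable] by (intro borel_measurable_card_Collect finite_upper) measurable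
        then show ?thesis by measurable
      qed
      have sub: "bad f \<subseteq> ?MK \<union> (\<Union>k\<in>{..ks}. near_rich t k f)"
      proof
        fix s assume s: "s \<in> bad f"
        show "s \<in> ?MK \<union> (\<Union>k\<in>{..ks}. near_rich t k f)"
        proof (cases "s \<in> good f")
          case True
          then have "{h\<in>upper t f. s \<in> Yh f h} = {h\<in>upper t f. gap f h s \<le> r}"
            by (auto simp: Yh_def)
          then show ?thesis using s by (auto simp: bad_def)
        next
          case False
          then show ?thesis using s by (auto simp: bad_def good_def)
        qed
      qed
      have "measure M (bad f) \<le> measure M (?MK \<union> (\<Union>k\<in>{..ks}. near_rich t k f))"
        using sub by (rule finite_measure_mono) (use MK_sets in auto)
      also have "\<dots> \<le> measure M ?MK + measure M (\<Union>k\<in>{..ks}. near_rich t k f)"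
        using MK_sets by (intro measure_Un_le) auto
      also have "measure M (\<Union>k\<in>{..ks}. near_rich t k f) \<le> (\<Sum>k\<le>ks. measure M (near_rich t k f))"
        by (intro measure_UNION_le) auto
      also have "measure M ?MK \<le> (\<Sum>h\<in>upper t f. measure M (Yh f h)) / \<theta>"
        by (rule measure_card_gt_le) (use Yh_sets theta0 in auto)
      also have "\<dots> \<le> (21 * C * Y ^ 43 * r powr \<delta> * N) / \<theta>"
        using sumY[OF f] theta0 by (simp add: divide_right_mono)
      also have "\<dots> = 21 / Y ^ 5"
      proof -
        have Y48: "Y ^ 48 = Y ^ 43 * Y ^ 5" by (simp flip: power_add)
        have cancel: "(21 * C * y * x * N) / (C * (y * z) * x * N) = 21 / z" if "y > 0" "x > 0" for x y z
          using that C1 N_pos by simp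
        show ?thesis unfolding \<theta>_def Y48 by (rule cancel[OF zero_less_power[OF Y0] x0])
      qed
      finally show ?thesis by simp
    qed
    have "(\<Sum>f\<in>F. measure M (bad f)) \<le> (\<Sum>f\<in>F. 21 / Y ^ 5 + (\<Sum>k\<le>ks. measure M (near_rich t k f)))"
      by (rule sum_mono) (rule mbad)
    also have "\<dots> = N * (21 / Y ^ 5) + (\<Sum>k\<le>ks. \<Sum>f\<in>F. measure M (near_rich t k f))"
      by (simp add: sum.distrib sum.swap[of _ F] N_def)
    also have "(\<Sum>k\<le>ks. \<Sum>f\<in>F. measure M (near_rich t k f)) \<le> (\<Sum>k\<le>ks. 48 * N / Y ^ 8)"
    proof (rule sum_mono)
      fix k assume "k \<in> {..ks}"
      then have lam: "t / (64 * 4 ^ k) \<ge> 2 / 2 ^ n" using lam_ge[of k] r_ge by simp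
      have "(\<Sum>f\<in>F. measure M (near_rich t k f)) \<le> (\<Sum>f\<in>F. 3 / 2 ^ k * real (card {i. (i, f) \<in> rich t k}))"
        by (intro sum_mono measure_near_rich)
      also have "\<dots> = 3 / 2 ^ k * (\<Sum>f\<in>F. real (card {i. (i, f) \<in> rich t k}))" by (simp add: sum_distrib_left)
      also have "(\<Sum>f\<in>F. real (card {i. (i, f) \<in> rich t k})) = real (card (rich t k))"
        using sum_card_sections[OF finite_rich finite_F, of t k] rich_subset[of t k] by (force simp flip: of_nat_sum)
      also have "3 / 2 ^ k * real (card (rich t k)) \<le> 3 / 2 ^ k * (16 * (N * 2 ^ k / Y ^ 8))"
        using rich_bound[OF u(2) t lam] by (intro mult_left_mono) auto
      also have "\<dots> = 48 * N / Y ^ 8" by simp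
      finally show "(\<Sum>f\<in>F. measure M (near_rich t k f)) \<le> 48 * N / Y ^ 8" .
    qed
    also have "(\<Sum>k\<le>ks. 48 * N / Y ^ 8) = real (ks + 1) * (48 * N / Y ^ 8)" by simp
    also have "\<dots> \<le> Y * (48 * N / Y ^ 8)" by (rule mult_right_mono[OF ksY]) (use N_pos Y0 in simp)
    also have "N * (21 / Y ^ 5) + Y * (48 * N / Y ^ 8) = N / Y ^ 4 * (21 / Y + 48 / Y ^ 3)"
      using Y0 by (simp add: field_simps eval_nat_numeral)
    also have "\<dots> \<le> N / Y ^ 4 * 1"
    proof (rule mult_left_mono)
      have "21 / Y \<le> 21 / 1000" using Y_ge by (intro divide_left_mono) auto
      moreover have "48 / Y ^ 3 \<le> 48 / 1000 ^ 3" using Y_ge by (intro divide_left_mono power_mono) auto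
      ultimately show "21 / Y + 48 / Y ^ 3 \<le> 1" by simp
    qed (use N_pos Y0 in simp)
    finally show ?thesis unfolding bad_def \<theta>_def by simp
  qed
qed

end

section \<open>Both signs of the leading coefficient and all distances\<close>

context projected_quads
begin

definition shell :: "real \<Rightarrow> 'z \<Rightarrow> 'z set" where
  "shell t f = {h\<in>F. t / 2 < coef_dist f h \<and> coef_dist f h \<le> t}"
definition new_bad :: "nat \<Rightarrow> nat \<Rightarrow> 'z \<Rightarrow> 's set" where
  "new_bad u i f = {s\<in>space M. clean (2 ^ u / 2 ^ n / 2) f (\<sigma> s)
     \<and> real (card {h\<in>shell (2 ^ u / 2 ^ n) f. gap f h s \<le> 1 / 2 ^ i}) > C * Y ^ 49 * (1 / 2 ^ i) powr \<delta> * N}"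

definition overfull :: "'z \<Rightarrow> 's set" where
  "overfull f = {s\<in>space M. \<exists>i<n. real (card {g\<in>F. gap f g s \<le> 1 / 2 ^ i})
      > C * Y ^ 50 * (1 / 2 ^ i) powr \<delta> * N}"

lemma finite_shell [simp]: "finite (shell t f)" using finite_F by (simp add: shell_def)

lemma new_bad_sets [measurable]: "new_bad u i f \<in> sets M"
proof -
  have [measurable]: "(\<lambda>s. real (card {h\<in>shell (2 ^ u / 2 ^ n) f. gap f h s \<le> 1 / 2 ^ i})) \<in> borel_measurable M"
    by (intro borel_measurable_card_Collect finite_shell) measurable
  show ?thesis unfolding new_bad_def by measurable
qed

text \<open>Negating all coefficients exchanges \<open>b f \<le> b h\<close> with its reverse and
  preserves distances, gaps and cleanness, so \<open>upper_step\<close> applies to either half of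
  the shell.\<close>

lemma shell_step:
  assumes u: "1 \<le> u" "u \<le> n + 1" and i: "i < n"
  shows "(\<Sum>f\<in>F. measure M (new_bad u i f)) \<le> 2 * N / Y ^ 4"
proof -
  define t :: real where "t = 2 ^ u / 2 ^ n"
  define r :: real where "r = 1 / 2 ^ i"
  interpret nq: quad_family F "\<lambda>z. - a z" "\<lambda>z. - c z" "\<lambda>z. - b z" by unfold_locales (rule finite_F)
  have nd: "nq.coef_dist = coef_dist"
    by (intro ext) (simp add: nq.coef_dist_def coef_dist_def abs_minus_commute)
  have nv: "nq.val = (\<lambda>h s. - val h s)"
    by (intro ext) (simp add: nq.val_def val_def)
  interpret neg: projected_quads F "\<lambda>z. - a z" "\<lambda>z. - c z" "\<lambda>z. - b z" C \<delta> n M \<sigma>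
    by unfold_locales (use F_ne C1 delta frost diam sig_bd slab in \<open>auto simp: nd\<close>)
  have nabs: "\<bar>nq.val g s - nq.val f s\<bar> = \<bar>val g s - val f s\<bar>" for f g s by (simp add: nv abs_minus_commute)
  have nc: "neg.count = count" by (intro ext) (simp only: neg.count_def count_def nd nabs)
  have ncl: "neg.clean = clean" by (intro ext) (simp add: neg.clean_def clean_def nc neg.Y_def Y_def neg.N_def N_def)
  define U where "U f = {s\<in>space M. clean (t / 2) f (\<sigma> s)
      \<and> real (card {h\<in>upper t f. gap f h s \<le> r}) > C * Y ^ 48 * r powr \<delta> * N}" for f
  define L where "L f = {s\<in>space M. clean (t / 2) f (\<sigma> s)
      \<and> real (card {h\<in>neg.upper t f. gap f h s \<le> r}) > C * Y ^ 48 * r powr \<delta> * N}" for f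
  have sU: "(\<Sum>f\<in>F. measure M (U f)) \<le> N / Y ^ 4"
    unfolding U_def by (rule upper_step[OF u t_def i r_def])
  have sL: "(\<Sum>f\<in>F. measure M (L f)) \<le> N / Y ^ 4"
    using neg.upper_step[OF u t_def i r_def] unfolding L_def nabs ncl neg.Y_def neg.N_def Y_def N_def .
  have U_sets: "U f \<in> sets M" for f
  proof -
    have [measurable]: "(\<lambda>s. real (card {h\<in>upper t f. gap f h s \<le> r})) \<in> borel_measurable M"
      by (intro borel_measurable_card_Collect finite_upper) measurable
    show ?thesis unfolding U_def by measurable
  qed
  have L_sets: "L f \<in> sets M" for f
  proof -
    have [measurable]: "(\<lambda>s. real (card {h\<in>neg.upper t f. gap f h s \<le> r})) \<in> borel_measurable M"
      by (intro borel_measurable_card_Collect neg.finite_upper) measurable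
    show ?thesis unfolding L_def by measurable
  qed
  have sub: "new_bad u i f \<subseteq> U f \<union> L f" for f
  proof
    fix s assume s: "s \<in> new_bad u i f"
    let ?P = "\<lambda>h. gap f h s \<le> r"
    have sp: "s \<in> space M" "clean (t / 2) f (\<sigma> s)"
      and big: "real (card {h\<in>shell t f. ?P h}) > C * Y ^ 49 * r powr \<delta> * N"
      using s by (auto simp: new_bad_def t_def r_def)
    have "{h\<in>shell t f. ?P h} = {h\<in>upper t f. ?P h} \<union> {h\<in>neg.upper t f. ?P h}"
      by (auto simp: shell_def upper_def neg.upper_def nd)
    then have le: "card {h\<in>shell t f. ?P h} \<le> card {h\<in>upper t f. ?P h} + card {h\<in>neg.upper t f. ?P h}"
      by (simp only: card_Un_le)
    have "2 * (C * Y ^ 48 * r powr \<delta> * N) \<le> Y * (C * Y ^ 48 * r powr \<delta> * N)"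
      using Y_ge C1 N_pos by (intro mult_right_mono) auto
    also have "\<dots> = C * (Y * Y ^ 48) * r powr \<delta> * N" by simp
    also have "Y * Y ^ 48 = Y ^ 49" by (simp flip: power_Suc)
    finally have "2 * (C * Y ^ 48 * r powr \<delta> * N) \<le> C * Y ^ 49 * r powr \<delta> * N" .
    then have "real (card {h\<in>upper t f. ?P h}) > C * Y ^ 48 * r powr \<delta> * N
        \<or> real (card {h\<in>neg.upper t f. ?P h}) > C * Y ^ 48 * r powr \<delta> * N"
      using le big by linarith
    then show "s \<in> U f \<union> L f" using sp by (auto simp: U_def L_def)
  qed
  have "(\<Sum>f\<in>F. measure M (new_bad u i f)) \<le> (\<Sum>f\<in>F. measure M (U f) + measure M (L f))"
  proof (rule sum_mono)
    fix f
    have "measure M (new_bad u i f) \<le> measure M (U f \<union> L f)"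
      using sub by (rule finite_measure_mono) (use U_sets L_sets in auto)
    also have "\<dots> \<le> measure M (U f) + measure M (L f)" using U_sets L_sets by (intro measure_Un_le) auto
    finally show "measure M (new_bad u i f) \<le> measure M (U f) + measure M (L f)" .
  qed
  then show ?thesis using sU sL by (simp add: sum.distrib)
qed

text \<open>The admissible count grows linearly with the index \<open>u\<close> of the distance, by
  one step \<open>C * Y ^ 49 * (1 / 2 ^ i) powr \<delta> * N\<close> each time. At the first
  violation the new shell alone exceeds a full step, while half the distance is still clean because
  \<open>n + 2\<close> steps stay below the bound with \<open>Y ^ 50\<close>. The union over at most
  \<open>Y\<^sup>2\<close> pairs of distance and height costs two of the four powers gained in
  \<open>shell_step\<close>.\<close>

lemma total_bad:
  "(\<Sum>f\<in>F. measure M (overfull f)) \<le> 2 * N / Y\<^sup>2"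
proof -
  have Y0: "Y > 0" using Y_ge by simp
  have cover: "overfull f \<subseteq> (\<Union>z\<in>{1..n+1}\<times>{..<n}. new_bad (fst z) (snd z) f)"
    if f: "f \<in> F" for f
  proof
    fix s assume s: "s \<in> overfull f"
    define thr where "thr u i = real (u + 1) * (C * Y ^ 49 * (1 / 2 ^ i) powr \<delta> * N)" for u i :: nat
    define ok where "ok u \<longleftrightarrow> (\<forall>i<n. count (2 ^ u / 2 ^ n) (1 / 2 ^ i) f (\<sigma> s) \<le> thr u i)" for u :: nat
    have X0: "C * Y ^ 49 * (1 / 2 ^ i) powr \<delta> * N \<ge> 0" for i :: nat using C1 Y0 N_pos by simp
    have thr_le: "thr u i \<le> C * Y ^ 50 * (1 / 2 ^ i) powr \<delta> * N" if "u \<le> n + 1" for u i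
    proof -
      have "thr u i \<le> Y * (C * Y ^ 49 * (1 / 2 ^ i) powr \<delta> * N)"
        unfolding thr_def using that X0 by (intro mult_right_mono) (auto simp: Y_def)
      also have "\<dots> = C * (Y * Y ^ 49) * (1 / 2 ^ i) powr \<delta> * N" by simp
      also have "Y * Y ^ 49 = Y ^ 50" by (simp flip: power_Suc)
      finally show ?thesis .
    qed
    have not_ok: "\<not> ok (n + 1)"
    proof
      assume ok: "ok (n + 1)"
      obtain i where i: "i < n" "real (card {g\<in>F. gap f g s \<le> 1 / 2 ^ i})
         > C * Y ^ 50 * (1 / 2 ^ i) powr \<delta> * N" using s unfolding overfull_def by blast
      have "{g\<in>F. coef_dist f g \<le> 2 ^ (n + 1) / 2 ^ n \<and> gap f g s \<le> 1 / 2 ^ i}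
          = {g\<in>F. gap f g s \<le> 1 / 2 ^ i}"
        using diam[OF f] by auto
      then show False using ok i thr_le[of "n + 1" i] unfolding ok_def count_def by force
    qed
    \<comment> \<open>The distance \<open>1 / 2 ^ n\<close> is below the range of the Frostman
      bound, but also below every height \<open>1 / 2 ^ i\<close>, so the ball of radius
      \<open>1 / 2 ^ i\<close> can be used instead.\<close>
    have ok0: "ok 0"
      unfolding ok_def
    proof (intro allI impI)
      fix i assume i: "i < n"
      have "(2::real) ^ (i + 1) \<le> 2 ^ n" using i by (intro power_increasing) auto
      then have r_ge: "(1::real) / 2 ^ i \<ge> 2 / 2 ^ n" by (simp add: field_simps)
      have "count (2 ^ 0 / 2 ^ n) (1 / 2 ^ i) f (\<sigma> s) \<le> real (card {g\<in>F. coef_dist f g \<le> 1 / 2 ^ i})"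
      proof -
        have "(1::real) / 2 ^ n \<le> 1 / 2 ^ i" using i by (simp add: frac_le)
        then show ?thesis unfolding count_def using finite_F by (intro of_nat_mono card_mono) auto
      qed
      also have "\<dots> \<le> C * (1 / 2 ^ i) powr \<delta> * N" using frost[OF f r_ge] by (simp add: N_def)
      also have "\<dots> \<le> C * (1 / 2 ^ i) powr \<delta> * N * Y ^ 49"
      proof -
        have "1 \<le> Y ^ 49" using Y_ge by (intro one_le_power) auto
        then show ?thesis using mult_left_mono[of 1 "Y ^ 49" "C * (1 / 2 ^ i) powr \<delta> * N"] C1 N_pos by simp
      qed
      also have "\<dots> = thr 0 i" by (simp add: thr_def)
      finally show "count (2 ^ 0 / 2 ^ n) (1 / 2 ^ i) f (\<sigma> s) \<le> thr 0 i" .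
    qed
    \<comment> \<open>the smallest distance at which the count becomes too large\<close>
    have "\<exists>u\<le>n. ok u \<and> \<not> ok (Suc u)"
    proof (rule ccontr)
      assume neg: "\<not> ?thesis"
      have "m \<le> n + 1 \<Longrightarrow> ok m" for m by (induction m) (use ok0 neg in auto)
      then show False using not_ok by blast
    qed
    then obtain u where u: "u \<le> n" "ok u" "\<not> ok (Suc u)" by blast
    obtain i where i: "i < n" "count (2 ^ Suc u / 2 ^ n) (1 / 2 ^ i) f (\<sigma> s) > thr (Suc u) i"
      using u(3) unfolding ok_def by force
    have half: "2 ^ Suc u / 2 ^ n / 2 = (2::real) ^ u / 2 ^ n" by simp
    have "{g\<in>F. coef_dist f g \<le> 2 ^ Suc u / 2 ^ n \<and> gap f g s \<le> 1 / 2 ^ i}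
        \<subseteq> {g\<in>F. coef_dist f g \<le> 2 ^ u / 2 ^ n \<and> gap f g s \<le> 1 / 2 ^ i}
          \<union> {h\<in>shell (2 ^ Suc u / 2 ^ n) f. gap f h s \<le> 1 / 2 ^ i}"
      unfolding shell_def half by (auto simp: not_less)
    then have "card {g\<in>F. coef_dist f g \<le> 2 ^ Suc u / 2 ^ n \<and> gap f g s \<le> 1 / 2 ^ i}
        \<le> card ({g\<in>F. coef_dist f g \<le> 2 ^ u / 2 ^ n \<and> gap f g s \<le> 1 / 2 ^ i}
          \<union> {h\<in>shell (2 ^ Suc u / 2 ^ n) f. gap f h s \<le> 1 / 2 ^ i})"
      by (rule card_mono[rotated]) (use finite_F in auto)
    also have "\<dots> \<le> card {g\<in>F. coef_dist f g \<le> 2 ^ u / 2 ^ n \<and> gap f g s \<le> 1 / 2 ^ i}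
          + card {h\<in>shell (2 ^ Suc u / 2 ^ n) f. gap f h s \<le> 1 / 2 ^ i}" by (rule card_Un_le)
    finally have "count (2 ^ Suc u / 2 ^ n) (1 / 2 ^ i) f (\<sigma> s) \<le> count (2 ^ u / 2 ^ n) (1 / 2 ^ i) f (\<sigma> s)
        + real (card {h\<in>shell (2 ^ Suc u / 2 ^ n) f. gap f h s \<le> 1 / 2 ^ i})"
      unfolding count_def by linarith
    moreover have "count (2 ^ u / 2 ^ n) (1 / 2 ^ i) f (\<sigma> s) \<le> thr u i" using u(2) i(1) by (simp add: ok_def)
    moreover have "thr (Suc u) i = thr u i + C * Y ^ 49 * (1 / 2 ^ i) powr \<delta> * N"
      by (simp add: thr_def algebra_simps)
    ultimately have "real (card {h\<in>shell (2 ^ Suc u / 2 ^ n) f. gap f h s \<le> 1 / 2 ^ i})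
        > C * Y ^ 49 * (1 / 2 ^ i) powr \<delta> * N" using i(2) by linarith
    moreover have "clean (2 ^ Suc u / 2 ^ n / 2) f (\<sigma> s)"
      unfolding half clean_def
    proof (intro allI impI)
      fix i assume "i < n"
      then have "count (2 ^ u / 2 ^ n) (1 / 2 ^ i) f (\<sigma> s) \<le> thr u i" using u(2) by (simp add: ok_def)
      also have "\<dots> \<le> C * Y ^ 50 * (1 / 2 ^ i) powr \<delta> * N" using u(1) by (intro thr_le) simp
      finally show "count (2 ^ u / 2 ^ n) (1 / 2 ^ i) f (\<sigma> s) \<le> C * Y ^ 50 * (1 / 2 ^ i) powr \<delta> * N" .
    qed
    ultimately have "s \<in> new_bad (Suc u) i f" using s unfolding new_bad_def overfull_def by blast
    then show "s \<in> (\<Union>z\<in>{1..n+1}\<times>{..<n}. new_bad (fst z) (snd z) f)"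
      using u(1) i(1) by (intro UN_I[of "(Suc u, i)"]) auto
  qed
  have "(\<Sum>f\<in>F. measure M (overfull f))
      \<le> (\<Sum>f\<in>F. \<Sum>z\<in>{1..n+1}\<times>{..<n}. measure M (new_bad (fst z) (snd z) f))"
  proof (rule sum_mono)
    fix f assume f: "f \<in> F"
    have "measure M (overfull f) \<le> measure M (\<Union>z\<in>{1..n+1}\<times>{..<n}. new_bad (fst z) (snd z) f)"
      using cover[OF f] by (rule finite_measure_mono) auto
    also have "\<dots> \<le> (\<Sum>z\<in>{1..n+1}\<times>{..<n}. measure M (new_bad (fst z) (snd z) f))"
      by (rule measure_UNION_le) auto
    finally show "measure M (overfull f) \<le> (\<Sum>z\<in>{1..n+1}\<times>{..<n}. measure M (new_bad (fst z) (snd z) f))" .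
  qed
  also have "\<dots> = (\<Sum>z\<in>{1..n+1}\<times>{..<n}. \<Sum>f\<in>F. measure M (new_bad (fst z) (snd z) f))" by (rule sum.swap)
  also have "\<dots> \<le> (\<Sum>z\<in>{1..n+1}\<times>{..<n}. 2 * N / Y ^ 4)"
    by (rule sum_mono) (use shell_step in auto)
  also have "\<dots> = real ((n + 1) * n) * (2 * N / Y ^ 4)" by (simp add: card_cartesian_product)
  also have "\<dots> \<le> Y\<^sup>2 * (2 * N / Y ^ 4)"
  proof (rule mult_right_mono)
    have "real ((n + 1) * n) \<le> Y * Y" unfolding of_nat_mult by (intro mult_mono) (auto simp: Y_def)
    then show "real ((n + 1) * n) \<le> Y\<^sup>2" by (simp add: power2_eq_square)
  qed (use N_pos Y0 in simp)
  also have "\<dots> = 2 * N / Y\<^sup>2" using Y0 by (simp add: field_simps eval_nat_numeral)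
  finally show ?thesis .
qed

end

section \<open>Sublevel sets in several variables\<close>

lemma rnorm_le_iff:
  "rnorm ((r1, c, r2) :: 'm::finite rvec) \<le> x \<longleftrightarrow> \<bar>r1\<bar> \<le> x \<and> (\<forall>i. \<bar>c $ i\<bar> \<le> x) \<and> \<bar>r2\<bar> \<le> x"
  by (auto simp: rnorm_def)

lemma rnorm_attained:
  obtains "\<bar>r1\<bar> = rnorm ((r1, c, r2) :: 'm::finite rvec)"
  | i where "\<bar>c $ i\<bar> = rnorm ((r1, c, r2) :: 'm::finite rvec)"
  | "\<bar>r2\<bar> = rnorm ((r1, c, r2) :: 'm::finite rvec)"
proof -
  have "Max (range (\<lambda>i. \<bar>c $ i\<bar>)) \<in> range (\<lambda>i. \<bar>c $ i\<bar>)" by (intro Max_in) auto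
  then obtain i where "Max (range (\<lambda>i. \<bar>c $ i\<bar>)) = \<bar>c $ i\<bar>" by blast
  then have "rnorm (r1, c, r2) = max \<bar>r1\<bar> (max \<bar>c $ i\<bar> \<bar>r2\<bar>)" by (simp add: rnorm_def)
  moreover have "max p (max q s) = p \<or> max p (max q s) = q \<or> max p (max q s) = s" for p q s :: real
    by linarith
  ultimately show ?thesis using that by metis
qed

text \<open>A sublevel set of a quadratic controls the squared distance to its centre, hence the
  comparison with a difference of squares. For exponent 1 such a bound fails near radius 0, which is
  precisely the tangency problem in one variable.\<close>

lemma power_diff_le:
  fixes x y :: real
  assumes "0 \<le> y" "y \<le> x" "2 \<le> d"
  shows "x ^ d - y ^ d \<le> real d * x ^ (d - 2) * (x\<^sup>2 - y\<^sup>2)"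
  using assms(3)
proof (induction d rule: dec_induct)
  case base
  have "y\<^sup>2 \<le> x\<^sup>2" using assms by (intro power_mono)
  then show ?case by simp
next
  case (step d)
  have "x ^ Suc d - y ^ Suc d = x * (x ^ d - y ^ d) + y ^ d * (x - y)" by (simp add: algebra_simps)
  also have "x * (x ^ d - y ^ d) \<le> x * (real d * x ^ (d - 2) * (x\<^sup>2 - y\<^sup>2))"
    using step.IH assms by (intro mult_left_mono) auto
  also have "y ^ d * (x - y) \<le> x ^ (d - 1) * (x\<^sup>2 - y\<^sup>2)"
  proof -
    obtain e where e: "d = Suc e" using step.hyps by (cases d) auto
    have "y ^ d * (x - y) = y ^ e * (y * (x - y))" by (simp add: e)
    also have "\<dots> \<le> x ^ e * ((x + y) * (x - y))"
      using assms by (intro mult_mono power_mono) auto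
    also have "(x + y) * (x - y) = x\<^sup>2 - y\<^sup>2" by (simp add: power2_eq_square algebra_simps)
    finally show ?thesis by (simp add: e)
  qed
  finally have "x ^ Suc d - y ^ Suc d \<le> x * (real d * x ^ (d - 2) * (x\<^sup>2 - y\<^sup>2)) + x ^ (d - 1) * (x\<^sup>2 - y\<^sup>2)" by simp
  moreover have "x * x ^ (d - 2) = x ^ (d - 1)" "Suc d - 2 = d - 1"
  proof -
    obtain e where "d = Suc (Suc e)" using le_Suc_ex[OF \<open>2 \<le> d\<close>] by auto
    then show "x * x ^ (d - 2) = x ^ (d - 1)" "Suc d - 2 = d - 1" by simp_all
  qed
  moreover have "x * (real d * z * q) = real d * (x * z) * q" for z q by simp
  ultimately have "x ^ Suc d - y ^ Suc d \<le> real d * x ^ (d - 1) * (x\<^sup>2 - y\<^sup>2) + x ^ (d - 1) * (x\<^sup>2 - y\<^sup>2)"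
    by (simp only:)
  then show ?case unfolding \<open>Suc d - 2 = d - 1\<close> by (simp add: algebra_simps)
qed

lemma measure_annulus_le:
  fixes a :: "'a::euclidean_space" and R \<eta> \<rho> :: real
  assumes d: "DIM('a) \<ge> 2" and R: "R \<ge> 0" and \<eta>: "\<eta> \<ge> 0"
  shows "measure lebesgue {s. \<rho> - \<eta> \<le> (norm (s - a))\<^sup>2 \<and> (norm (s - a))\<^sup>2 \<le> \<rho> + \<eta> \<and> norm (s - a) \<le> R}
    \<le> unit_ball_vol (DIM('a)) * (DIM('a) * R ^ (DIM('a) - 2) * (2 * \<eta>))"
proof -
  define v2 where "v2 = min (\<rho> + \<eta>) (R\<^sup>2)"
  define v1 where "v1 = max 0 (\<rho> - \<eta>)"
  let ?A = "{s. \<rho> - \<eta> \<le> (norm (s - a))\<^sup>2 \<and> (norm (s - a))\<^sup>2 \<le> \<rho> + \<eta> \<and> norm (s - a) \<le> R}"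
  have vol0: "unit_ball_vol (DIM('a)) \<ge> 0" by simp
  have rhs0: "unit_ball_vol (DIM('a)) * (DIM('a) * R ^ (DIM('a) - 2) * (2 * \<eta>)) \<ge> 0"
    using R \<eta> by simp
  show ?thesis
  proof (cases "v1 \<le> v2")
    case False
    have "?A = {}"
    proof (rule ccontr)
      assume "?A \<noteq> {}"
      then obtain s where s: "\<rho> - \<eta> \<le> (norm (s - a))\<^sup>2" "(norm (s - a))\<^sup>2 \<le> \<rho> + \<eta>" "norm (s - a) \<le> R" by blast
      have "(norm (s - a))\<^sup>2 \<le> R\<^sup>2" using s(3) by (intro power_mono) auto
      then have "v1 \<le> (norm (s - a))\<^sup>2" "(norm (s - a))\<^sup>2 \<le> v2" using s by (auto simp: v1_def v2_def)
      then show False using False by linarith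
    qed
    then show ?thesis using rhs0 by (simp only: measure_empty)
  next
    case True
    have v10: "v1 \<ge> 0" by (simp add: v1_def)
    define x where "x = sqrt v2"
    define y where "y = sqrt v1"
    have xy: "0 \<le> y" "y \<le> x" using True v10 by (simp_all add: x_def y_def)
    have sq: "x\<^sup>2 = v2" "y\<^sup>2 = v1" using True v10 by (simp_all add: x_def y_def)
    have xR: "x \<le> R" using R by (simp add: x_def v2_def real_le_lsqrt)
    have "?A \<subseteq> cball a x - ball a y"
    proof
      fix s assume s: "s \<in> ?A"
      have "(norm (s - a))\<^sup>2 \<le> R\<^sup>2" using s by (intro power_mono) auto
      then have "(norm (s - a))\<^sup>2 \<le> x\<^sup>2" "y\<^sup>2 \<le> (norm (s - a))\<^sup>2" using s unfolding sq by (auto simp: v1_def v2_def)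
      then have "norm (s - a) \<le> x" "y \<le> norm (s - a)"
        using xy by (auto intro: power2_le_imp_le)
      then show "s \<in> cball a x - ball a y" by (simp add: dist_norm norm_minus_commute)
    qed
    then have "measure lebesgue ?A \<le> measure lebesgue (cball a x - ball a y)"
      by (intro measure_mono_fmeasurable) (auto intro!: fmeasurable.Diff)
    also have "\<dots> = measure lebesgue (cball a x) - measure lebesgue (ball a y)"
      using xy by (intro measurable_measure_Diff) auto
    also have "\<dots> = unit_ball_vol (DIM('a)) * (x ^ DIM('a) - y ^ DIM('a))"
      using xy by (simp add: content_cball content_ball algebra_simps)
    also have "\<dots> \<le> unit_ball_vol (DIM('a)) * (DIM('a) * R ^ (DIM('a) - 2) * (2 * \<eta>))"
    proof (rule mult_left_mono[OF _ vol0])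
      have "x ^ DIM('a) - y ^ DIM('a) \<le> DIM('a) * x ^ (DIM('a) - 2) * (x\<^sup>2 - y\<^sup>2)"
        by (rule power_diff_le[OF xy d])
      also have "\<dots> \<le> DIM('a) * R ^ (DIM('a) - 2) * (2 * \<eta>)"
      proof -
        have "x\<^sup>2 - y\<^sup>2 \<le> 2 * \<eta>" unfolding sq by (auto simp: v1_def v2_def)
        moreover have "0 \<le> x\<^sup>2 - y\<^sup>2" unfolding sq using True by simp
        ultimately show ?thesis using xR xy by (intro mult_mono power_mono) auto
      qed
      finally show "x ^ DIM('a) - y ^ DIM('a) \<le> DIM('a) * R ^ (DIM('a) - 2) * (2 * \<eta>)" .
    qed
    finally show ?thesis .
  qed
qed

lemma xi_add_axis:
  fixes s :: "real^'m::finite"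
  shows "xi (s + h *\<^sub>R axis i 1) (r1, c, r2) - xi s (r1, c, r2) = h * (c $ i + r2 * (s $ i + h / 2))"
proof -
  have n: "(norm (s + h *\<^sub>R axis i 1))\<^sup>2 = (norm s)\<^sup>2 + 2 * h * s $ i + h\<^sup>2"
    unfolding power2_norm_eq_inner
    by (simp add: inner_add_left inner_add_right inner_axis inner_axis' power2_eq_square algebra_simps)
  show ?thesis unfolding xi_def prod.case n
    by (simp add: inner_add_left inner_axis inner_axis' algebra_simps power2_eq_square)
qed

lemma continuous_xi: "continuous_on A (\<lambda>s. xi s Z)"
proof -
  obtain r1 c r2 where Z: "Z = (r1, c, r2)" by (cases Z) auto
  show ?thesis unfolding Z xi_def prod.case by (intro continuous_intros) auto
qed

lemma xi_sublevel_sets: "{s\<in>BU. \<bar>xi s Z\<bar> \<le> r} \<in> lmeasurable"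
proof -
  have "closed {s\<in>BU. \<bar>xi s Z\<bar> \<le> r}"
  proof -
    have "{s\<in>BU. \<bar>xi s Z\<bar> \<le> r} = cball 0 1 \<inter> {s. \<bar>xi s Z\<bar> \<le> r}" by (auto simp: BU_def)
    then show ?thesis by (simp only:) (intro closed_Int closed_cball closed_Collect_le continuous_intros continuous_xi)
  qed
  moreover have "bounded {s\<in>BU. \<bar>xi s Z\<bar> \<le> r}"
    by (rule bounded_subset[of "cball 0 1"]) (auto simp: BU_def)
  ultimately show ?thesis by (intro lmeasurable_compact) (simp add: compact_eq_bounded_closed)
qed

text \<open>The cases follow the dominating coefficient. A large \<open>r2\<close> gives an annulus
  about \<open>- c / r2\<close>, whose centre is at most \<open>16 * d\<^sup>2\<close> away; a large
  \<open>c $ i\<close> gives a directional derivative bounded below; otherwise \<open>r1\<close>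
  keeps \<open>xi\<close> away from 0. The thresholds \<open>m / (16 * d)\<close> and
  \<open>m / (4 * d)\<close> ensure that the remaining terms cannot cancel the dominating
  one.\<close>

lemma xi_sublevel_measure:
  assumes d2: "CARD('m::finite) \<ge> 2"
  shows "\<exists>Cd>0. \<forall>(Z :: 'm rvec) r. 0 < r \<longrightarrow> 0 < rnorm Z \<longrightarrow>
    measure lebesgue {s\<in>BU. \<bar>xi s Z\<bar> \<le> r} \<le> Cd * (r / rnorm Z)"
proof -
  define d where "d = real CARD('m)"
  have d_ge: "d \<ge> 2" using d2 by (simp add: d_def)
  define V1 where "V1 = measure lebesgue (cball 0 1 :: (real^'m) set)"
  define V2 where "V2 = measure lebesgue (cball 0 2 :: (real^'m) set)"
  define R where "R = 1 + 16 * d\<^sup>2"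
  define Ca where "Ca = unit_ball_vol d * (d * R ^ (CARD('m) - 2) * (64 * d))"
  define Cb where "Cb = 128 * d * V2"
  define Cc where "Cc = 64 * d * V1"
  define Cd where "Cd = Ca + Cb + Cc + 1"
  have nn: "V1 \<ge> 0" "V2 \<ge> 0" "Ca \<ge> 0" "Cb \<ge> 0" "Cc \<ge> 0"
    using d_ge by (auto simp: V1_def V2_def Ca_def Cb_def Cc_def R_def)
  have BU_le: "measure lebesgue {s\<in>BU. \<bar>xi s (Z :: 'm rvec)\<bar> \<le> r} \<le> V1" for Z r
    unfolding V1_def by (rule measure_mono_fmeasurable[OF _ fmeasurableD[OF xi_sublevel_sets]]) (auto simp: BU_def)
  have main: "measure lebesgue {s\<in>BU. \<bar>xi s Z\<bar> \<le> r} \<le> Cd * (r / rnorm Z)"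
    if r: "0 < r" and m: "0 < rnorm Z" for Z :: "'m rvec" and r
  proof -
    obtain r1 c r2 where Z: "Z = (r1, c, r2)" by (cases Z) auto
    define m where "m = rnorm Z"
    let ?E = "{s\<in>BU. \<bar>xi s Z\<bar> \<le> r}"
    have m0: "m > 0" using \<open>0 < rnorm Z\<close> by (simp add: m_def)
    have rm: "r / m > 0" using r m0 by simp
    have le: "\<bar>r1\<bar> \<le> m" "\<And>i. \<bar>c $ i\<bar> \<le> m" "\<bar>r2\<bar> \<le> m"
      using rnorm_le_iff[of r1 c r2 m] by (auto simp: m_def Z)
    have out: "measure lebesgue ?E \<le> Cd * (r / m)" if "measure lebesgue ?E \<le> K * (r / m)" "K \<le> Ca + Cb + Cc" for K
    proof -
      have "K * (r / m) \<le> Cd * (r / m)" using that(2) rm nn by (intro mult_right_mono) (auto simp: Cd_def)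
      then show ?thesis using that(1) by linarith
    qed
    have coord: "\<bar>s $ i\<bar> \<le> 1" if "s \<in> BU" for s :: "real^'m" and i
      using component_le_norm_cart[of s i] that by (simp add: BU_def)
    consider (sq) "\<bar>r2\<bar> \<ge> m / (16 * d)" | (lin) i where "\<bar>r2\<bar> < m / (16 * d)" "\<bar>c $ i\<bar> \<ge> m / (4 * d)"
      | (const) "\<bar>r2\<bar> < m / (16 * d)" "\<And>i. \<bar>c $ i\<bar> < m / (4 * d)" by (meson not_less)
    then have "measure lebesgue ?E \<le> Cd * (r / m)"
    proof cases
      case sq
      then have r2: "r2 \<noteq> 0" using m0 d_ge by (auto simp: divide_le_0_iff)
      define a where "a = - (c /\<^sub>R r2)"
      define \<rho> where "\<rho> = (norm a)\<^sup>2 - 2 * r1 / r2"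
      define \<eta> where "\<eta> = 2 * r / \<bar>r2\<bar>"
      have xi_eq: "xi s Z = (r2 / 2) * ((norm (s - a))\<^sup>2 - \<rho>)" for s
      proof -
        have "(norm (s - a))\<^sup>2 = (norm s)\<^sup>2 - 2 * (s \<bullet> a) + (norm a)\<^sup>2"
          by (simp add: power2_norm_eq_inner inner_diff_left inner_diff_right inner_commute algebra_simps)
        moreover have "s \<bullet> a = - (s \<bullet> c) / r2" by (simp add: a_def divide_inverse mult_ac)
        ultimately show ?thesis using r2 by (simp add: Z xi_def \<rho>_def field_simps)
      qed
      have "norm c \<le> (\<Sum>i\<in>UNIV. \<bar>c $ i\<bar>)" by (rule norm_le_l1_cart)
      also have "\<dots> \<le> (\<Sum>i\<in>(UNIV::'m set). m)" using le by (intro sum_mono) auto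
      finally have "norm c \<le> d * m" by (simp add: d_def)
      have "norm a = norm c / \<bar>r2\<bar>" by (simp add: a_def divide_inverse mult_ac)
      also have "\<dots> \<le> (d * m) / (m / (16 * d))"
        using \<open>norm c \<le> d * m\<close> sq m0 d_ge by (intro frac_le) auto
      also have "\<dots> = 16 * d\<^sup>2" using m0 d_ge by (simp add: power2_eq_square)
      finally have na: "norm a \<le> 16 * d\<^sup>2" .
      have "?E \<subseteq> {s. \<rho> - \<eta> \<le> (norm (s - a))\<^sup>2 \<and> (norm (s - a))\<^sup>2 \<le> \<rho> + \<eta> \<and> norm (s - a) \<le> R}"
      proof
        fix s assume s: "s \<in> ?E"
        have "\<bar>(norm (s - a))\<^sup>2 - \<rho>\<bar> * \<bar>r2\<bar> \<le> 2 * r"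
          using s unfolding xi_eq by (simp add: abs_mult mult_ac)
        then have "\<bar>(norm (s - a))\<^sup>2 - \<rho>\<bar> \<le> \<eta>" using r2 by (simp add: \<eta>_def pos_le_divide_eq)
        moreover have "norm (s - a) \<le> R"
          using s na norm_triangle_ineq4[of s a] by (simp add: BU_def R_def)
        ultimately show "s \<in> {s. \<rho> - \<eta> \<le> (norm (s - a))\<^sup>2 \<and> (norm (s - a))\<^sup>2 \<le> \<rho> + \<eta> \<and> norm (s - a) \<le> R}"
          by (auto simp: abs_le_iff)
      qed
      then have "measure lebesgue ?E
          \<le> measure lebesgue {s. \<rho> - \<eta> \<le> (norm (s - a))\<^sup>2 \<and> (norm (s - a))\<^sup>2 \<le> \<rho> + \<eta> \<and> norm (s - a) \<le> R}"
      proof (rule measure_mono_fmeasurable)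
        have "closed {s. \<rho> - \<eta> \<le> (norm (s - a))\<^sup>2 \<and> (norm (s - a))\<^sup>2 \<le> \<rho> + \<eta> \<and> norm (s - a) \<le> R}"
          by (intro closed_Collect_conj closed_Collect_le continuous_intros)
        moreover have "bounded {s. \<rho> - \<eta> \<le> (norm (s - a))\<^sup>2 \<and> (norm (s - a))\<^sup>2 \<le> \<rho> + \<eta> \<and> norm (s - a) \<le> R}"
          by (rule bounded_subset[of "cball a R"]) (auto simp: dist_norm norm_minus_commute)
        ultimately show "{s. \<rho> - \<eta> \<le> (norm (s - a))\<^sup>2 \<and> (norm (s - a))\<^sup>2 \<le> \<rho> + \<eta> \<and> norm (s - a) \<le> R} \<in> lmeasurable"
          by (intro lmeasurable_compact) (simp add: compact_eq_bounded_closed)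
      qed (rule fmeasurableD[OF xi_sublevel_sets])
      also have "\<dots> \<le> unit_ball_vol (DIM(real^'m)) * (DIM(real^'m) * R ^ (DIM(real^'m) - 2) * (2 * \<eta>))"
        by (rule measure_annulus_le) (use d2 r in \<open>auto simp: R_def \<eta>_def\<close>)
      also have "\<dots> = unit_ball_vol d * (d * R ^ (CARD('m) - 2) * (2 * \<eta>))" by (simp add: d_def)
      also have "\<dots> \<le> unit_ball_vol d * (d * R ^ (CARD('m) - 2) * ((64 * d) * (r / m)))"
      proof -
        have "\<eta> \<le> 2 * r / (m / (16 * d))" unfolding \<eta>_def using sq r m0 d_ge by (intro frac_le) auto
        also have "2 * r / (m / (16 * d)) = (32 * d) * (r / m)" by simp
        finally have "2 * \<eta> \<le> (64 * d) * (r / m)" by linarith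
        then show ?thesis using d_ge by (intro mult_left_mono) (auto simp: R_def)
      qed
      also have "\<dots> = Ca * (r / m)" by (simp add: Ca_def)
      finally show ?thesis by (rule out) (use nn in simp)
    next
      case lin
      \<comment> \<open>A shift along axis \<open>i\<close> by at least \<tau> changes
        \<open>xi\<close> by at least \<open>\<tau> * (m / (8 * d)) = 8 * r\<close>, more than the
        \<open>2 * r\<close> allowed between two points of the set.\<close>
      define \<tau> where "\<tau> = 64 * d * (r / m)"
      have tau0: "\<tau> > 0" using rm d_ge unfolding \<tau>_def by (intro mult_pos_pos) auto
      show ?thesis
      proof (cases "\<tau> \<ge> 1")
        case True
        have "measure lebesgue ?E \<le> V1 * \<tau>" using BU_le[of Z r] mult_left_mono[OF True nn(1)] by simp
        also have "\<dots> = Cc * (r / m)" by (simp add: Cc_def \<tau>_def)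
        finally show ?thesis by (rule out) (use nn in simp)
      next
        case False
        \<comment> \<open>This many translates by multiples of \<tau> fit into the ball of radius 2.
          Being disjoint, they bound the measure by \<open>V2 / K\<close>, and \<open>K\<close> is
          at least half of \<open>1 / \<tau>\<close>.\<close>
        define K where "K = nat \<lfloor>1 / \<tau>\<rfloor>"
        have inv: "1 / \<tau> \<ge> 1" using False tau0 by simp
        have K: "real K \<le> 1 / \<tau>" "1 / \<tau> < real K + 1" "1 \<le> K" using inv unfolding K_def by linarith+
        define T where "T k = (\<lambda>x. (real k * \<tau>) *\<^sub>R axis i 1 + x) ` ?E" for k :: nat
        have T_meas: "T k \<in> lmeasurable" for k unfolding T_def by (rule measurable_translation[OF xi_sublevel_sets])
        have T_eq: "measure lebesgue (T k) = measure lebesgue ?E" for k unfolding T_def by (rule measure_translation)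
        \<comment> \<open>the \<open>i\<close>-th partial derivative is large, so the translates of the sublevel set are disjoint\<close>
        have disj: "T k \<inter> T l = {}" if kl: "k < l" for k l
        proof (rule ccontr)
          assume "T k \<inter> T l \<noteq> {}"
          then obtain x y where xy: "x \<in> ?E" "y \<in> ?E"
            "(real k * \<tau>) *\<^sub>R axis i 1 + x = (real l * \<tau>) *\<^sub>R axis i 1 + y" unfolding T_def by blast
          define h where "h = real l * \<tau> - real k * \<tau>"
          have x: "x = y + h *\<^sub>R axis i 1" using xy(3) by (simp add: h_def scaleR_diff_left algebra_simps)
          have h: "h \<ge> \<tau>" using kl tau0 mult_right_mono[of 1 "real l - real k" \<tau>] by (simp add: h_def algebra_simps)
          have xi: "x $ i = y $ i + h" by (simp add: x axis_def)
          have "\<bar>xi x Z - xi y Z\<bar> \<le> 2 * r" using xy by auto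
          then have "h * \<bar>c $ i + r2 * (y $ i + h / 2)\<bar> \<le> 2 * r"
            unfolding x Z xi_add_axis abs_mult using h tau0 by simp
          moreover have "\<bar>c $ i + r2 * (y $ i + h / 2)\<bar> \<ge> m / (8 * d)"
          proof -
            have "\<bar>y $ i + h / 2\<bar> \<le> 1" using coord[of x i] coord[of y i] xy xi by auto
            then have "\<bar>r2 * (y $ i + h / 2)\<bar> \<le> m / (16 * d)"
              unfolding abs_mult using mult_mono[of "\<bar>r2\<bar>" "m / (16 * d)" "\<bar>y $ i + h / 2\<bar>" 1] lin by simp
            moreover have "m / (4 * d) - m / (16 * d) \<ge> m / (8 * d)" using m0 d_ge by (simp add: field_simps)
            ultimately show ?thesis using lin(2) by linarith
          qed
          moreover have "\<tau> * (m / (8 * d)) \<le> h * \<bar>c $ i + r2 * (y $ i + h / 2)\<bar>"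
            using h tau0 calculation(2) m0 d_ge by (intro mult_mono) auto
          moreover have "\<tau> * (m / (8 * d)) = 8 * r" using m0 d_ge by (simp add: \<tau>_def)
          ultimately show False using r by linarith
        qed
        have "real K * measure lebesgue ?E = (\<Sum>k<K. measure lebesgue (T k))" by (simp add: T_eq)
        also have "\<dots> = measure lebesgue (\<Union>k\<in>{..<K}. T k)"
        proof (rule measure_finite_Union[symmetric])
          show "disjoint_family_on T {..<K}"
            unfolding disjoint_family_on_def using disj by (metis Int_commute linorder_neqE_nat)
          show "emeasure lebesgue (T k) \<noteq> \<infinity>" for k using fmeasurableD2[OF T_meas[of k]] unfolding infinity_ennreal_def .
        qed (use T_meas in \<open>auto simp: fmeasurableD\<close>)
        also have "\<dots> \<le> V2"
          unfolding V2_def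
        proof (rule measure_mono_fmeasurable)
          show "(\<Union>k\<in>{..<K}. T k) \<subseteq> cball 0 2"
          proof
            fix z assume "z \<in> (\<Union>k\<in>{..<K}. T k)"
            then obtain k x where k: "k < K" and x: "x \<in> ?E" and z: "z = (real k * \<tau>) *\<^sub>R axis i 1 + x"
              unfolding T_def by blast
            have "real k * \<tau> \<le> real K * \<tau>" using k tau0 by (intro mult_right_mono) auto
            also have "\<dots> \<le> 1" using K(1) tau0 by (simp add: pos_le_divide_eq)
            finally have "norm ((real k * \<tau>) *\<^sub>R axis i (1::real)) \<le> 1" using tau0 by (simp add: norm_axis_1)
            then show "z \<in> cball 0 2"
              using x norm_triangle_ineq[of "(real k * \<tau>) *\<^sub>R axis i 1" x] unfolding z by (simp add: BU_def)
          qed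
        qed (use T_meas in \<open>auto simp: fmeasurableD\<close>)
        finally have KE: "real K * measure lebesgue ?E \<le> V2" .
        have "1 \<le> 2 * \<tau> * real K"
        proof -
          have "1 / \<tau> \<le> 2 * real K" using K by linarith
          then show ?thesis using tau0 by (simp add: field_simps)
        qed
        then have "measure lebesgue ?E \<le> (2 * \<tau> * real K) * measure lebesgue ?E"
          using mult_right_mono[of 1 "2 * \<tau> * real K" "measure lebesgue ?E"] by simp
        also have "\<dots> = 2 * \<tau> * (real K * measure lebesgue ?E)" by simp
        also have "\<dots> \<le> 2 * \<tau> * V2" using KE tau0 by (intro mult_left_mono) auto
        also have "\<dots> = Cb * (r / m)" by (simp add: Cb_def \<tau>_def)
        finally show ?thesis by (rule out) (use nn in simp)
      qed
    next
      case const
      have r1m: "\<bar>r1\<bar> = m"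
      proof (rule rnorm_attained[of r1 c r2])
        fix i assume "\<bar>c $ i\<bar> = rnorm (r1, c, r2)"
        then have "m < m / (4 * d)" using const(2)[of i] by (simp add: m_def Z)
        moreover have "m / (4 * d) \<le> m" using m0 d_ge by (simp add: field_simps)
        ultimately show ?thesis by linarith
      next
        assume "\<bar>r2\<bar> = rnorm (r1, c, r2)"
        then have "m < m / (16 * d)" using const(1) by (simp add: m_def Z)
        moreover have "m / (16 * d) \<le> m" using m0 d_ge by (simp add: field_simps)
        ultimately show ?thesis by linarith
      qed (simp add: m_def Z)
      have big: "\<bar>xi s Z\<bar> \<ge> m / 2" if s: "s \<in> BU" for s
      proof -
        have "\<bar>s \<bullet> c\<bar> \<le> (\<Sum>i\<in>UNIV. \<bar>s $ i * c $ i\<bar>)" by (simp add: inner_vec_def sum_abs)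
        also have "\<dots> \<le> (\<Sum>i\<in>(UNIV::'m set). m / (4 * d))"
        proof (rule sum_mono)
          fix i
          show "\<bar>s $ i * c $ i\<bar> \<le> m / (4 * d)"
            unfolding abs_mult using mult_mono[OF coord[OF s, of i] less_imp_le[OF const(2)[of i]]] by simp
        qed
        also have "\<dots> = m / 4" using d_ge by (simp add: d_def)
        finally have 1: "\<bar>s \<bullet> c\<bar> \<le> m / 4" .
        have "(norm s)\<^sup>2 \<le> 1" using s by (simp add: BU_def power_le_one)
        moreover have "m / (16 * d) \<le> m / 4" using m0 d_ge by (simp add: field_simps)
        ultimately have "\<bar>r2 * (norm s)\<^sup>2\<bar> \<le> m / 4"
          unfolding abs_mult using mult_mono[of "\<bar>r2\<bar>" "m / 4" "\<bar>(norm s)\<^sup>2\<bar>" 1] const(1) m0 by simp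
        then show ?thesis using 1 r1m unfolding Z xi_def prod.case by linarith
      qed
      show ?thesis
      proof (cases "r < m / 2")
        case True
        then have "?E = {}" using big by force
        then have "measure lebesgue ?E = 0" by (simp only: measure_empty)
        moreover have "Cd * (r / m) \<ge> 0" using rm nn unfolding Cd_def by (intro mult_nonneg_nonneg) auto
        ultimately show ?thesis by simp
      next
        case False
        then have "1 \<le> 2 * (r / m)" using m0 by (simp add: field_simps)
        then have "V1 \<le> V1 * (2 * (r / m))" using mult_left_mono[of 1 "2 * (r / m)" V1] nn by simp
        also have "\<dots> \<le> V1 * (64 * d * (r / m))"
          using nn rm d_ge by (intro mult_left_mono mult_right_mono) auto
        also have "\<dots> = Cc * (r / m)" by (simp add: Cc_def)
        finally have "measure lebesgue ?E \<le> Cc * (r / m)" using BU_le[of Z r] by linarith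
        then show ?thesis by (rule out) (use nn in simp)
      qed
    qed
    then show ?thesis by (simp add: m_def)
  qed
  have "Cd > 0" using nn by (simp add: Cd_def)
  then show ?thesis using main by blast
qed

section \<open>Exceptional parameters\<close>

lemma sum_UN_le:
  fixes g :: "'a \<Rightarrow> real"
  assumes "finite I" "\<And>i. finite (S i)" "\<And>x. g x \<ge> 0"
  shows "sum g (\<Union>i\<in>I. S i) \<le> (\<Sum>i\<in>I. sum g (S i))"
  using assms(1)
proof induction
  case (insert i I)
  have "sum g (\<Union>k\<in>insert i I. S k) \<le> sum g (S i) + sum g (\<Union>k\<in>I. S k)"
    using assms insert.hyps sum.union_inter[of "S i" "\<Union>k\<in>I. S k" g] sum_nonneg[of "S i \<inter> (\<Union>k\<in>I. S k)" g]
    by simp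
  then show ?case using insert by simp
qed simp

locale frostman_points =
  fixes F :: "'m::finite rvec set" and b1 C \<delta> :: real and n :: nat
  assumes finite_F: "finite F" and F_ne: "F \<noteq> {}" and b1: "b1 > 0" and C1: "C \<ge> 1" and delta: "0 < \<delta>" "\<delta> < 1"
    and frost: "\<And>f \<rho>. f \<in> F \<Longrightarrow> \<rho> \<ge> 2 / 2 ^ n
      \<Longrightarrow> real (card {g\<in>F. rnorm (g - f) \<le> \<rho> * b1}) \<le> C * \<rho> powr \<delta> * card F"
    and diam: "\<And>f g. f \<in> F \<Longrightarrow> g \<in> F \<Longrightarrow> rnorm (g - f) \<le> 2 * b1"
begin

text \<open>\<open>A\<close> makes room for the constant of the sublevel estimate in several
  variables; on the line \<open>A = 1\<close> will do.\<close>

definition bad :: "real \<Rightarrow> 'm rvec \<Rightarrow> (real^'m) set" where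
  "bad A f = {s\<in>BU. \<exists>i<n. real (card {g\<in>F. \<bar>xi s g - xi s f\<bar> \<le> b1 / 2 ^ i})
     > A * C * (real n + 1000) ^ 50 * (1 / 2 ^ i) powr \<delta> * card F}"

lemma BU_lmeasurable: "BU \<in> lmeasurable"
  unfolding BU_def by simp

lemma BU_sets: "BU \<inter> space lebesgue \<in> sets lebesgue"
  using fmeasurableD[OF BU_lmeasurable] by simp

lemma finite_measure_BU: "finite_measure (lebesgue_on BU)"
  by (rule finite_measure_lebesgue_on[OF BU_lmeasurable])

lemma measure_BU_pos: "measure lebesgue (BU :: (real^'m) set) > 0"
  unfolding BU_def by simp

lemma xi_measurable [measurable]: "(\<lambda>s. xi s Z) \<in> borel_measurable (lebesgue_on BU)"
  by (rule continuous_imp_measurable_on_sets_lebesgue[OF continuous_xi fmeasurableD[OF BU_lmeasurable]])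

lemma bad_sets: "bad A f \<in> sets (lebesgue_on BU)"
proof -
  define h where "h i s = real (card {g\<in>F. \<bar>xi s g - xi s f\<bar> \<le> b1 / 2 ^ i})" for i s
  define \<theta> where "\<theta> i = A * C * (real n + 1000) ^ 50 * (1 / 2 ^ i) powr \<delta> * card F" for i :: nat
  have h: "h i \<in> borel_measurable (lebesgue_on BU)" for i
    unfolding h_def by (intro borel_measurable_card_Collect finite_F) measurable
  have "bad A f = (\<Union>i\<in>{..<n}. {s\<in>space (lebesgue_on BU). \<theta> i < h i s})"
    by (auto simp: bad_def h_def \<theta>_def)
  moreover have "{s\<in>space (lebesgue_on BU). \<theta> i < h i s} \<in> sets (lebesgue_on BU)" for i
    by (rule borel_measurable_less[OF borel_measurable_const h])
  ultimately show ?thesis by (metis (no_types, lifting) finite_lessThan sets.finite_UN)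
qed

lemma measure_on_BU: "A \<subseteq> BU \<Longrightarrow> measure (lebesgue_on BU) A = measure lebesgue A"
  by (rule measure_restrict_space[OF BU_sets])

text \<open>The single coordinate of \<open>s\<close> serves as \<sigma>, and
  \<open>xi s Z / b1\<close> becomes \<open>val Z (\<sigma> s)\<close>. Lebesgue measure is not
  normalized here: \<open>BU\<close> has measure at least 2, which converts the bound
  \<open>2 * N / 1000\<^sup>2\<close> into a fraction of it.\<close>

lemma bad_total_line:
  assumes one: "CARD('m) = 1"
  shows "(\<Sum>f\<in>F. measure lebesgue (bad 1 f)) \<le> 1 / 10000 * measure lebesgue (BU :: (real^'m) set) * card F"
proof -
  obtain j :: 'm where U: "UNIV = {j}" using one by (rule card_1_singletonE)
  have all: "(\<forall>i. P i) \<longleftrightarrow> P j" for P :: "'m \<Rightarrow> bool" using U by (metis UNIV_I singletonD)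
  have box: "(BU :: (real^'m) set) = {s. -1 \<le> s $ j \<and> s $ j \<le> 1}"
    unfolding BU_def by (auto simp: norm_vec_def L2_set_def U abs_le_iff)
  have slab: "measure (lebesgue_on BU) {s\<in>space (lebesgue_on BU). u \<le> s $ j \<and> s $ j \<le> v} \<le> v - u" if "u \<le> v" for u v
  proof -
    let ?B = "cbox (\<chi> i. u) (\<chi> i. v) :: (real^'m) set"
    have "measure (lebesgue_on BU) {s\<in>space (lebesgue_on BU). u \<le> s $ j \<and> s $ j \<le> v}
        = measure lebesgue {s\<in>BU. u \<le> s $ j \<and> s $ j \<le> v}"
      by (subst measure_on_BU) auto
    also have "\<dots> \<le> measure lebesgue ?B"
    proof (rule measure_mono_fmeasurable)
      show "{s\<in>BU. u \<le> s $ j \<and> s $ j \<le> v} \<subseteq> ?B"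
      proof
        fix s :: "real^'m" assume s: "s \<in> {s\<in>BU. u \<le> s $ j \<and> s $ j \<le> v}"
        then show "s \<in> ?B" by (simp add: mem_box_cart all)
      qed
      have "closed {s\<in>BU. u \<le> s $ j \<and> s $ j \<le> v}"
        unfolding box mem_Collect_eq by (intro closed_Collect_conj closed_Collect_le continuous_intros)
      then show "{s\<in>BU. u \<le> s $ j \<and> s $ j \<le> v} \<in> sets lebesgue" by (simp add: lborelD borel_closed)
    qed simp
    also have "\<dots> = v - u" using that by (simp add: content_cbox_if_cart U interval_eq_empty_cart not_less)
    finally show ?thesis .
  qed
  have BU2: "measure lebesgue (BU :: (real^'m) set) \<ge> 2"
  proof -
    have "measure lebesgue (cbox (\<chi> i. -1) (\<chi> i. 1) :: (real^'m) set) \<le> measure lebesgue (BU :: (real^'m) set)"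
      by (rule measure_mono_fmeasurable[OF _ _ BU_lmeasurable]) (auto simp: box mem_box_cart)
    then show ?thesis by (simp add: content_cbox_if_cart U interval_eq_empty_cart not_less)
  qed
  define \<sigma> :: "real^'m \<Rightarrow> real" where "\<sigma> s = s $ j" for s
  define a :: "'m rvec \<Rightarrow> real" where "a Z = fst Z / b1" for Z
  define c :: "'m rvec \<Rightarrow> real" where "c Z = fst (snd Z) $ j / b1" for Z
  define b :: "'m rvec \<Rightarrow> real" where "b Z = snd (snd Z) / b1" for Z
  interpret fm: finite_measure "lebesgue_on BU :: (real^'m) measure" by (rule finite_measure_BU)
  interpret q: quad_family F a c b by unfold_locales (rule finite_F)
  have cd: "q.coef_dist f g \<le> \<rho> \<longleftrightarrow> rnorm (g - f) \<le> \<rho> * b1" for f g \<rho>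
  proof -
    obtain r1 d r2 where f: "f = (r1, d, r2)" by (cases f) auto
    obtain r1' d' r2' where g: "g = (r1', d', r2')" by (cases g) auto
    have div: "\<bar>x / b1 - y / b1\<bar> \<le> \<rho> \<longleftrightarrow> \<bar>y - x\<bar> \<le> \<rho> * b1" for x y
    proof -
      have "\<bar>x / b1 - y / b1\<bar> = \<bar>y - x\<bar> / b1"
        using b1 by (simp add: diff_divide_distrib[symmetric] abs_minus_commute)
      then show ?thesis using b1 by (simp add: pos_divide_le_eq)
    qed
    show ?thesis unfolding q.coef_dist_le_iff f g a_def b_def c_def
      by (simp add: rnorm_le_iff all div)
  qed
  interpret p: projected_quads F a c b C \<delta> n "lebesgue_on BU" \<sigma>
  proof
    show "\<sigma> \<in> borel_measurable (lebesgue_on BU)"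
      unfolding \<sigma>_def by (rule continuous_imp_measurable_on_sets_lebesgue[OF _ fmeasurableD[OF BU_lmeasurable]])
        (intro continuous_intros)
    show "\<bar>\<sigma> s\<bar> \<le> 1" if "s \<in> space (lebesgue_on BU)" for s
      using that by (simp add: box \<sigma>_def abs_le_iff)
    show "measure (lebesgue_on BU) {s\<in>space (lebesgue_on BU). u \<le> \<sigma> s \<and> \<sigma> s \<le> v} \<le> v - u" if "u \<le> v" for u v
      unfolding \<sigma>_def by (rule slab[OF that])
    show "real (card {g\<in>F. q.coef_dist f g \<le> \<rho>}) \<le> C * \<rho> powr \<delta> * real (card F)"
      if "f \<in> F" "2 / 2 ^ n \<le> \<rho>" for f \<rho> using frost[OF that] by (simp add: cd)
    show "q.coef_dist f g \<le> 2" if "f \<in> F" "g \<in> F" for f g using diam[OF that] by (simp add: cd)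
  qed (use F_ne C1 delta in auto)
  have vx: "xi s Z = b1 * q.val Z (\<sigma> s)" for s Z
  proof -
    obtain r1 d r2 where Z: "Z = (r1, d, r2)" by (cases Z) auto
    have "s \<bullet> d = s $ j * d $ j" by (simp add: inner_vec_def U)
    moreover have "(norm s)\<^sup>2 = (s $ j)\<^sup>2" by (simp add: norm_vec_def L2_set_def U)
    ultimately show ?thesis using b1 by (simp add: Z xi_def q.val_def a_def b_def c_def \<sigma>_def field_simps)
  qed
  have iff: "\<bar>xi s g - xi s f\<bar> \<le> b1 / 2 ^ i \<longleftrightarrow> \<bar>q.val g (\<sigma> s) - q.val f (\<sigma> s)\<bar> \<le> 1 / 2 ^ i" for s f g i
  proof -
    have "\<bar>xi s g - xi s f\<bar> = b1 * \<bar>q.val g (\<sigma> s) - q.val f (\<sigma> s)\<bar>"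
      unfolding vx using b1 by (simp add: abs_mult flip: right_diff_distrib)
    moreover have "b1 / 2 ^ i = b1 * (1 / 2 ^ i)" by simp
    ultimately show ?thesis using b1 by (simp only: mult_le_cancel_left_pos)
  qed
  have bad_eq: "bad 1 f = p.overfull f" for f
    unfolding bad_def iff p.overfull_def p.Y_def p.N_def by simp
  have bad_meas: "measure (lebesgue_on BU) (bad 1 f) = measure lebesgue (bad 1 f)" for f
    by (rule measure_on_BU) (auto simp: bad_def)
  have "(\<Sum>f\<in>F. measure lebesgue (bad 1 f)) \<le> 2 * p.N / p.Y\<^sup>2"
    using p.total_bad unfolding bad_eq[symmetric] bad_meas .
  also have "\<dots> \<le> 2 * p.N / 1000\<^sup>2"
    using p.Y_ge p.N_pos by (intro divide_left_mono power_mono) auto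
  also have "\<dots> \<le> 1 / 10000 * measure lebesgue (BU :: (real^'m) set) * card F"
  proof -
    have "2 * p.N \<le> measure lebesgue (BU :: (real^'m) set) * p.N"
      using BU2 p.N_pos by (intro mult_right_mono) auto
    moreover have "p.N \<ge> 0" using p.N_pos by simp
    ultimately show ?thesis by (simp add: p.N_def)
  qed
  finally show ?thesis .
qed

text \<open>A shell at distance \<open>t u > r\<close> has at most
  \<open>C * t u powr \<delta> * N\<close> elements, each with a sublevel set of measure
  \<open>O(r / t u)\<close>; since \<delta> < 1 the product is \<open>O(r powr \<delta>) * N\<close>
  at every scale. Scales up to \<open>r\<close> use the trivial bound \<open>V\<close>. The
  \<open>n + 2\<close> groups are the ball of radius \<open>r\<close> and \<open>n + 1\<close>
  shells.\<close>

lemma sublevel_sum: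
  assumes Cd: "Cd > 0" "\<And>(Z :: 'm rvec) r. 0 < r \<Longrightarrow> 0 < rnorm Z \<Longrightarrow>
      measure lebesgue {s\<in>BU. \<bar>xi s Z\<bar> \<le> r} \<le> Cd * (r / rnorm Z)"
    and f: "f \<in> F" and i: "i < n"
  defines "V \<equiv> measure lebesgue (BU :: (real^'m) set)"
  shows "(\<Sum>h\<in>F. measure lebesgue {s\<in>BU. \<bar>xi s h - xi s f\<bar> \<le> b1 / 2 ^ i})
    \<le> (real n + 2) * (C * (V + 2 * Cd) * (1 / 2 ^ i) powr \<delta> * card F)"
proof -
  define r :: real where "r = 1 / 2 ^ i"
  define N where "N = real (card F)"
  define t :: "nat \<Rightarrow> real" where "t u = 2 ^ u / 2 ^ n" for u
  let ?m = "\<lambda>h. measure lebesgue {s\<in>BU. \<bar>xi s h - xi s f\<bar> \<le> b1 / 2 ^ i}"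
  have r0: "r > 0" by (simp add: r_def)
  have V0: "V \<ge> 0" by (simp add: V_def)
  have r_ge: "r \<ge> 2 / 2 ^ n"
  proof -
    have "(2::real) ^ (i + 1) \<le> 2 ^ n" using i by (intro power_increasing) auto
    then show ?thesis by (simp add: r_def field_simps)
  qed
  have diff: "xi s h - xi s f = xi s (h - f)" for s h
    by (cases h; cases f) (simp add: xi_def inner_diff_right algebra_simps diff_divide_distrib)
  have mV: "?m h \<le> V" for h
    unfolding V_def diff by (rule measure_mono_fmeasurable[OF _ fmeasurableD[OF xi_sublevel_sets] BU_lmeasurable]) auto
  define S where "S u = {h\<in>F. t u * b1 / 2 < rnorm (h - f) \<and> rnorm (h - f) \<le> t u * b1}" for u
  define S0 where "S0 = {h\<in>F. rnorm (h - f) \<le> r * b1}"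
  have fin: "finite (S u)" "finite S0" for u using finite_F by (auto simp: S_def S0_def)
  have X0: "C * r powr \<delta> * N \<ge> 0" using C1 by (simp add: N_def)
  have cover: "F \<subseteq> S0 \<union> (\<Union>u\<in>{1..n+1}. S u)"
  proof
    fix h assume h: "h \<in> F"
    show "h \<in> S0 \<union> (\<Union>u\<in>{1..n+1}. S u)"
    proof (cases "\<exists>u\<le>n. rnorm (h - f) > t u * b1 \<and> rnorm (h - f) \<le> t (Suc u) * b1")
      case True
      then obtain u where u: "u \<le> n" "rnorm (h - f) > t u * b1" "rnorm (h - f) \<le> t (Suc u) * b1" by blast
      then have "h \<in> S (Suc u)" using h by (simp add: S_def t_def)
      then show ?thesis using u(1) by auto
    next
      case False
      have top: "rnorm (h - f) \<le> t (n + 1) * b1" using diam[OF f h] by (simp add: t_def)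
      have "k \<le> n + 1 \<Longrightarrow> rnorm (h - f) \<le> t (n + 1 - k) * b1" for k
      proof (induction k)
        case (Suc k)
        then have "Suc (n - k) = n + 1 - k" by simp
        then show ?case using Suc False by (metis Suc_leD Suc_eq_plus1 diff_Suc_Suc diff_le_self not_le_imp_less)
      qed (use top in simp)
      from this[of "n + 1"] have "rnorm (h - f) \<le> t 0 * b1" by simp
      moreover have "1 / 2 ^ n \<le> (2 :: real) / 2 ^ n" by (simp add: divide_right_mono)
      then have "t 0 \<le> r" using r_ge by (simp add: t_def)
      ultimately have "rnorm (h - f) \<le> r * b1" using b1 mult_right_mono[of "t 0" r b1] by linarith
      then show ?thesis using h by (simp add: S0_def)
    qed
  qed
  have s0: "(\<Sum>h\<in>S0. ?m h) \<le> C * (V + 2 * Cd) * r powr \<delta> * N"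
  proof -
    have "(\<Sum>h\<in>S0. ?m h) \<le> (\<Sum>h\<in>S0. V)" by (intro sum_mono mV)
    also have "\<dots> = real (card S0) * V" by simp
    also have "\<dots> \<le> (C * r powr \<delta> * N) * (V + 2 * Cd)"
      using frost[OF f r_ge] V0 Cd X0 by (intro mult_mono) (auto simp: S0_def N_def)
    finally show ?thesis by (simp add: mult_ac)
  qed
  have su: "(\<Sum>h\<in>S u. ?m h) \<le> C * (V + 2 * Cd) * r powr \<delta> * N" if u: "1 \<le> u" for u
  proof -
    have t0: "t u > 0" by (simp add: t_def)
    have t2: "t u \<ge> 2 / 2 ^ n"
      using power_increasing[OF u, of "2::real"] by (simp add: t_def divide_right_mono)
    have cS: "real (card (S u)) \<le> C * t u powr \<delta> * N"
    proof -
      have "card (S u) \<le> card {g\<in>F. rnorm (g - f) \<le> t u * b1}"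
        using finite_F by (intro card_mono) (auto simp: S_def)
      then show ?thesis using frost[OF f t2] by (simp add: N_def)
    qed
    show ?thesis
    proof (cases "t u \<le> r")
      case True
      have "(\<Sum>h\<in>S u. ?m h) \<le> (\<Sum>h\<in>S u. V)" by (intro sum_mono mV)
      also have "\<dots> = real (card (S u)) * V" by simp
      also have "\<dots> \<le> (C * r powr \<delta> * N) * (V + 2 * Cd)"
      proof (intro mult_mono)
        have "t u powr \<delta> \<le> r powr \<delta>" using True t0 delta by (intro powr_mono2) auto
        then have "C * t u powr \<delta> * N \<le> C * r powr \<delta> * N"
          using C1 by (intro mult_right_mono mult_left_mono) (auto simp: N_def)
        then show "real (card (S u)) \<le> C * r powr \<delta> * N" using cS by linarith
      qed (use V0 Cd X0 in auto)
      finally show ?thesis by (simp add: mult_ac)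
    next
      case False
      have "?m h \<le> 2 * Cd * (r / t u)" if h: "h \<in> S u" for h
      proof -
        have R: "rnorm (h - f) > t u * b1 / 2" using h by (simp add: S_def)
        have tb: "t u * b1 / 2 > 0" using t0 b1 by simp
        have "?m h \<le> Cd * ((b1 / 2 ^ i) / rnorm (h - f))"
          unfolding diff by (rule Cd(2)) (use R tb b1 in auto)
        also have "\<dots> \<le> Cd * ((b1 / 2 ^ i) / (t u * b1 / 2))"
          using R tb b1 Cd by (intro mult_left_mono frac_le) auto
        also have "\<dots> = 2 * Cd * (r / t u)" using b1 by (simp add: r_def)
        finally show ?thesis .
      qed
      then have "(\<Sum>h\<in>S u. ?m h) \<le> (\<Sum>h\<in>S u. 2 * Cd * (r / t u))" by (rule sum_mono)
      also have "\<dots> = real (card (S u)) * (2 * Cd * (r / t u))" by simp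
      also have "\<dots> \<le> (C * t u powr \<delta> * N) * (2 * Cd * (r / t u))"
        using cS Cd r0 t0 by (intro mult_right_mono) auto
      also have "\<dots> \<le> (C * ((t u / r) * r powr \<delta>) * N) * (2 * Cd * (r / t u))"
        using powr_ratio_le[OF r0, of "t u" \<delta>] False delta C1 Cd r0 t0
        by (intro mult_right_mono mult_left_mono) (auto simp: N_def)
      also have "\<dots> = (C * r powr \<delta> * N) * (2 * Cd)" using r0 t0 by simp
      also have "\<dots> \<le> (C * r powr \<delta> * N) * (V + 2 * Cd)"
        using X0 V0 by (intro mult_left_mono) auto
      finally show ?thesis by (simp add: mult_ac)
    qed
  qed
  have "(\<Sum>h\<in>F. ?m h) \<le> (\<Sum>h\<in>S0 \<union> (\<Union>u\<in>{1..n+1}. S u). ?m h)"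
    by (rule sum_mono2) (use fin cover in auto)
  also have "\<dots> \<le> (\<Sum>h\<in>S0. ?m h) + (\<Sum>h\<in>(\<Union>u\<in>{1..n+1}. S u). ?m h)"
    using fin by (subst sum.union_inter[symmetric]) (auto intro: sum_nonneg)
  also have "(\<Sum>h\<in>(\<Union>u\<in>{1..n+1}. S u). ?m h) \<le> (\<Sum>u\<in>{1..n+1}. \<Sum>h\<in>S u. ?m h)"
    using fin by (intro sum_UN_le) auto
  also have "\<dots> \<le> (\<Sum>u\<in>{1..n+1}. C * (V + 2 * Cd) * r powr \<delta> * N)"
    by (intro sum_mono su) auto
  finally show ?thesis using s0 by (simp add: r_def N_def algebra_simps)
qed

text \<open>Without near tangencies the first moment is enough: Markov's inequality at each height,
  with \<open>A\<close> chosen as the constant of \<open>sublevel_sum\<close> relative to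
  \<open>V\<close>.\<close>

lemma bad_total_higher:
  assumes Cd: "Cd > 0" "\<And>(Z :: 'm rvec) r. 0 < r \<Longrightarrow> 0 < rnorm Z \<Longrightarrow>
      measure lebesgue {s\<in>BU. \<bar>xi s Z\<bar> \<le> r} \<le> Cd * (r / rnorm Z)"
  defines "V \<equiv> measure lebesgue (BU :: (real^'m) set)"
  shows "(\<Sum>f\<in>F. measure lebesgue (bad ((V + 2 * Cd) / V) f)) \<le> 1 / 10000 * V * card F"
proof -
  define A where "A = (V + 2 * Cd) / V"
  define Y where "Y = real n + 1000"
  define N where "N = real (card F)"
  have V0: "V > 0" unfolding V_def by (rule measure_BU_pos)
  have A0: "A > 0" using V0 Cd by (simp add: A_def)
  have N0: "N > 0" using F_ne finite_F by (simp add: N_def card_gt_0_iff)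
  have Y0: "Y \<ge> 1000" by (simp add: Y_def)
  interpret fm: finite_measure "lebesgue_on BU :: (real^'m) measure" by (rule finite_measure_BU)
  have one: "measure lebesgue (bad A f) \<le> V / Y ^ 48" if f: "f \<in> F" for f
  proof -
    define \<theta> where "\<theta> i = A * C * Y ^ 50 * (1 / 2 ^ i) powr \<delta> * N" for i :: nat
    have th0: "\<theta> i > 0" for i using A0 C1 Y0 N0 by (simp add: \<theta>_def)
    define T where "T i h = {s\<in>BU. \<bar>xi s h - xi s f\<bar> \<le> b1 / 2 ^ i}" for i :: nat and h
    have T_sets: "T i h \<in> sets (lebesgue_on BU)" for i h
    proof -
      have "{s\<in>space (lebesgue_on BU). \<bar>xi s h - xi s f\<bar> \<le> b1 / 2 ^ i} \<in> sets (lebesgue_on BU)" by measurable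
      then show ?thesis by (simp add: T_def)
    qed
    define W where "W i = {s\<in>space (lebesgue_on BU). real (card {h\<in>F. s \<in> T i h}) > \<theta> i}" for i
    have W_sets: "W i \<in> sets (lebesgue_on BU)" for i
    proof -
      have "(\<lambda>s. real (card {h\<in>F. s \<in> T i h})) \<in> borel_measurable (lebesgue_on BU)"
        using T_sets[measurable] by (intro borel_measurable_card_Collect finite_F) measurable
      then show ?thesis unfolding W_def by measurable
    qed
    have "bad A f \<subseteq> (\<Union>i\<in>{..<n}. W i)"
    proof
      fix s assume s: "s \<in> bad A f"
      then obtain i where i: "i < n" "real (card {g\<in>F. \<bar>xi s g - xi s f\<bar> \<le> b1 / 2 ^ i}) > \<theta> i" and sB: "s \<in> BU"
        unfolding bad_def \<theta>_def Y_def N_def by blast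
      have "{h\<in>F. s \<in> T i h} = {g\<in>F. \<bar>xi s g - xi s f\<bar> \<le> b1 / 2 ^ i}" using sB by (auto simp: T_def)
      then have "s \<in> W i" using i sB by (simp add: W_def)
      then show "s \<in> (\<Union>i\<in>{..<n}. W i)" using i by blast
    qed
    then have "measure (lebesgue_on BU) (bad A f) \<le> measure (lebesgue_on BU) (\<Union>i\<in>{..<n}. W i)"
      by (rule fm.finite_measure_mono) (use W_sets in auto)
    also have "\<dots> \<le> (\<Sum>i\<in>{..<n}. measure (lebesgue_on BU) (W i))"
      using W_sets by (intro measure_UNION_le) auto
    also have "\<dots> \<le> (\<Sum>i\<in>{..<n}. (real n + 2) * V / Y ^ 50)"
    proof (rule sum_mono)
      fix i assume i: "i \<in> {..<n}"
      have "measure (lebesgue_on BU) (W i) \<le> (\<Sum>h\<in>F. measure (lebesgue_on BU) (T i h)) / \<theta> i"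
        unfolding W_def by (rule fm.measure_card_gt_le[OF finite_F T_sets th0])
      also have "(\<Sum>h\<in>F. measure (lebesgue_on BU) (T i h)) = (\<Sum>h\<in>F. measure lebesgue (T i h))"
        by (intro sum.cong refl measure_on_BU) (auto simp: T_def)
      also have "\<dots> / \<theta> i \<le> ((real n + 2) * (C * (V + 2 * Cd) * (1 / 2 ^ i) powr \<delta> * N)) / \<theta> i"
      proof (rule divide_right_mono)
        show "(\<Sum>h\<in>F. measure lebesgue (T i h)) \<le> (real n + 2) * (C * (V + 2 * Cd) * (1 / 2 ^ i) powr \<delta> * N)"
          unfolding T_def V_def N_def by (rule sublevel_sum[OF Cd f]) (use i in simp_all)
      qed (use th0[of i] in simp)
      also have "V + 2 * Cd = A * V" using V0 by (simp add: A_def)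
      also have "((real n + 2) * (C * (A * V) * (1 / 2 ^ i) powr \<delta> * N)) / \<theta> i = (real n + 2) * V / Y ^ 50"
      proof -
        have cancel: "(m * (C * (A * V) * x * N)) / (A * C * y * x * N) = m * V / y" if "x > 0" for m x y
          using that A0 C1 N0 by simp
        show ?thesis unfolding \<theta>_def by (rule cancel) simp
      qed
      finally show "measure (lebesgue_on BU) (W i) \<le> (real n + 2) * V / Y ^ 50" .
    qed
    also have "\<dots> = (real n * (real n + 2)) * (V / Y ^ 50)" by simp
    also have "\<dots> \<le> (Y * Y) * (V / Y ^ 50)"
      using V0 Y0 by (intro mult_right_mono mult_mono) (auto simp: Y_def)
    also have "\<dots> = V / Y ^ 48"
    proof -
      have Y50: "Y ^ 50 = (Y * Y) * Y ^ 48" by (simp flip: power2_eq_square power_add)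
      have cancel: "z * (V / (z * w)) = V / w" if "z > 0" for z w using that by simp
      show ?thesis unfolding Y50 by (rule cancel) (use Y0 in simp)
    qed
    finally show ?thesis by (subst measure_on_BU[symmetric]) (auto simp: bad_def)
  qed
  have "(\<Sum>f\<in>F. measure lebesgue (bad A f)) \<le> (\<Sum>f\<in>F. V / Y ^ 48)" by (rule sum_mono) (rule one)
  also have "\<dots> = V / Y ^ 48 * N" by (simp add: N_def)
  also have "\<dots> \<le> 1 / 10000 * V * N"
  proof (rule mult_right_mono)
    have "1000 ^ 48 \<le> Y ^ 48" using Y0 by (intro power_mono) auto
    then have "V / Y ^ 48 \<le> V / 10000" using V0 by (intro divide_left_mono) auto
    then show "V / Y ^ 48 \<le> 1 / 10000 * V" by simp
  qed (use N0 in simp)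
  finally show ?thesis unfolding A_def N_def .
qed

end

text \<open>Joins the two cases of the dimension. \<open>A\<close> is chosen before all other data
  and so depends only on the index type.\<close>

lemma bad_total:
  "\<exists>A>0. \<forall>(F :: 'm::finite rvec set) b1 C \<delta> n. frostman_points F b1 C \<delta> n \<longrightarrow>
    (\<Sum>f\<in>F. measure lebesgue (frostman_points.bad F b1 C \<delta> n A f))
      \<le> 1 / 10000 * measure lebesgue (BU :: (real^'m) set) * card F"
proof (cases "CARD('m) = 1")
  case True
  then show ?thesis using frostman_points.bad_total_line by (intro exI[of _ 1]) auto
next
  case False
  have "CARD('m) > 0" by simp
  then have "CARD('m) \<ge> 2" using False by linarith
  then obtain Cd where Cd: "Cd > 0" "\<And>(Z :: 'm rvec) r. 0 < r \<Longrightarrow> 0 < rnorm Z \<Longrightarrow>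
      measure lebesgue {s\<in>BU. \<bar>xi s Z\<bar> \<le> r} \<le> Cd * (r / rnorm Z)"
    using xi_sublevel_measure by blast
  define V where "V = measure lebesgue (BU :: (real^'m) set)"
  have "V > 0" unfolding V_def BU_def by simp
  then have "(V + 2 * Cd) / V > 0" using Cd by simp
  then show ?thesis using frostman_points.bad_total_higher[OF _ Cd] unfolding V_def by blast
qed

text \<open>Compares the exponential series at \<open>\<epsilon> * ln 2 * (m + 1001)\<close> with
  its term of degree 50. The shift 1001 fits \<open>m = n - 1\<close>, for which
  \<open>m + 1001\<close> is \<open>n + 1000\<close>.\<close>

lemma polynomial_le_powr:
  fixes \<epsilon> :: real
  assumes "\<epsilon> > 0"
  shows "\<exists>K\<ge>1. \<forall>m::nat. (real m + 1001) ^ 50 \<le> K * (2 ^ m) powr \<epsilon>"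
proof -
  define a where "a = \<epsilon> * ln 2"
  have a0: "a > 0" using assms by (simp add: a_def)
  define K where "K = max 1 (fact 50 / a ^ 50 * exp (1001 * a))"
  have "(real m + 1001) ^ 50 \<le> K * (2 ^ m) powr \<epsilon>" for m :: nat
  proof -
    define x where "x = a * (real m + 1001)"
    have x0: "x \<ge> 0" using a0 by (simp add: x_def)
    have "x ^ 50 / fact 50 \<le> exp x"
    proof -
      have "(\<Sum>k<51. x ^ k /\<^sub>R fact k) \<le> exp x"
        unfolding exp_def by (rule sum_le_suminf[OF summable_exp_generic]) (use x0 in auto)
      moreover have "x ^ 50 /\<^sub>R fact 50 \<le> (\<Sum>k<51. x ^ k /\<^sub>R fact k)"
        by (rule member_le_sum) (use x0 in auto)
      ultimately show ?thesis by (simp add: divide_inverse mult.commute)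
    qed
    then have "x ^ 50 \<le> fact 50 * exp x" by (simp add: field_simps)
    then have "a ^ 50 * (real m + 1001) ^ 50 \<le> fact 50 * exp x" by (simp add: x_def power_mult_distrib)
    then have "(real m + 1001) ^ 50 \<le> fact 50 * exp x / a ^ 50" using a0 by (simp add: field_simps)
    also have "\<dots> = fact 50 / a ^ 50 * exp (1001 * a) * exp (a * real m)"
      by (simp add: x_def algebra_simps exp_add)
    also have "\<dots> \<le> K * exp (a * real m)" unfolding K_def by (intro mult_right_mono) auto
    also have "exp (a * real m) = (2 ^ m) powr \<epsilon>"
      by (simp add: powr_def a_def ln_realpow mult_ac)
    finally show ?thesis .
  qed
  moreover have "K \<ge> 1" by (simp add: K_def)
  ultimately show ?thesis by blast
qed

text \<open>\<open>Fs\<close> removes from \<open>F\<close> the elements for which \<open>s\<close>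
  is bad, and \<open>B\<close> removes the parameters that are bad for more than one percent of
  \<open>F\<close>. The factor with \<epsilon> comes solely from the fiftieth power of
  \<open>n + 1000\<close>, with \<open>2 ^ (n - 1) \<le> b1 / b0\<close>.\<close>

theorem theorem1p3:
  fixes C \<epsilon> :: real
  assumes "C \<ge> 1" and "\<epsilon> > 0"
  shows "\<exists>C\<epsilon>::real. \<forall>(\<delta>::real) (b0::real) (b1::real) (F :: 'm::finite rvec set).
     0 < \<delta> \<longrightarrow> \<delta> < 1 \<longrightarrow> 0 < b0 \<longrightarrow> b0 < b1 \<longrightarrow> b1 < 1 \<longrightarrow> \<epsilon> < \<delta> / 100 \<longrightarrow>
     finite F \<longrightarrow> F \<subseteq> rball 0 b1 \<longrightarrow>
     (\<forall>Z b. b \<ge> b0 \<longrightarrow> real (card (rball Z b \<inter> F)) / real (card F) \<le> C * (b / b1) powr \<delta>) \<longrightarrow>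
     (\<exists>B. B \<in> sets lebesgue \<and> B \<subseteq> BU \<and>
        measure lebesgue (BU - B) \<le> 0.01 * measure lebesgue (BU :: (real^'m) set) \<and>
        (\<forall>s\<in>B. \<exists>Fs. Fs \<subseteq> F \<and> real (card (F - Fs)) \<le> 0.01 * real (card F) \<and>
           (\<forall>Z\<in>Fs. \<forall>b. b \<ge> b0 \<longrightarrow>
              real (card {Z'\<in>Fs. \<bar>xi s Z' - xi s Z\<bar> \<le> b})
                \<le> C\<epsilon> * (b0 / b1) powr (- \<epsilon>) * (b / b1) powr \<delta> * real (card F))))"
proof -
  obtain A where A: "A > 0" "\<And>(F :: 'm rvec set) b1 C \<delta> n. frostman_points F b1 C \<delta> n \<Longrightarrow>
    (\<Sum>f\<in>F. measure lebesgue (frostman_points.bad F b1 C \<delta> n A f))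
      \<le> 1 / 10000 * measure lebesgue (BU :: (real^'m) set) * card F"
    using bad_total by blast
  obtain K where K: "K \<ge> 1" "\<And>m::nat. (real m + 1001) ^ 50 \<le> K * (2 ^ m) powr \<epsilon>"
    using polynomial_le_powr[OF assms(2)] by blast
  \<comment> \<open>The 2 pays for replacing \<open>b / b1\<close> by the next larger power of 1/2;
    the summand 1 covers \<open>b \<ge> b1\<close>, where the trivial bound \<open>card F\<close> is
    used.\<close>
  define C\<epsilon> where "C\<epsilon> = 1 + 2 * A * C * K"
  have Ce1: "C\<epsilon> \<ge> 1" using A assms K by (simp add: C\<epsilon>_def)
  show ?thesis
  proof (intro exI[of _ C\<epsilon>] allI impI)
    fix \<delta> b0 b1 :: real and F :: "'m rvec set"
    assume d: "0 < \<delta>" "\<delta> < 1" and b: "0 < b0" "b0 < b1" "b1 < 1" and "\<epsilon> < \<delta> / 100" and fin: "finite F"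
      and ball: "F \<subseteq> rball 0 b1"
      and fr: "\<forall>Z b. b \<ge> b0 \<longrightarrow> real (card (rball Z b \<inter> F)) / real (card F) \<le> C * (b / b1) powr \<delta>"
    let ?concl = "\<exists>B. B \<in> sets lebesgue \<and> B \<subseteq> BU \<and>
        measure lebesgue (BU - B) \<le> 0.01 * measure lebesgue (BU :: (real^'m) set) \<and>
        (\<forall>s\<in>B. \<exists>Fs. Fs \<subseteq> F \<and> real (card (F - Fs)) \<le> 0.01 * real (card F) \<and>
           (\<forall>Z\<in>Fs. \<forall>b. b \<ge> b0 \<longrightarrow>
              real (card {Z'\<in>Fs. \<bar>xi s Z' - xi s Z\<bar> \<le> b})
                \<le> C\<epsilon> * (b0 / b1) powr (- \<epsilon>) * (b / b1) powr \<delta> * real (card F)))"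
    show ?concl
    proof (cases "F = {}")
      case True
      have "(BU :: (real^'m) set) \<in> sets lebesgue" unfolding BU_def by simp
      then show ?thesis using True by (intro exI[of _ BU]) auto
    next
      case False
      define \<beta> where "\<beta> = b0 / b1"
      have beta: "0 < \<beta>" "\<beta> < 1" using b by (auto simp: \<beta>_def)
      obtain k where "(1/2::real) ^ k < \<beta>" using real_arch_pow_inv[OF beta(1), of "1/2"] by auto
      then have "\<exists>k. 1 / 2 ^ k < \<beta>" by (auto simp: power_one_over)
      \<comment> \<open>Minimality gives \<open>\<beta> \<le> 2 / 2 ^ n\<close>, so the hypothesis
        on \<open>F\<close> applies from radius \<open>2 / 2 ^ n\<close> on, and also
        \<open>2 ^ (n - 1) \<le> 1 / \<beta>\<close>, which later turns a power of
        \<open>2 ^ (n - 1)\<close> into one of \<beta>.\<close>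
      then obtain n where n: "1 / 2 ^ n < \<beta>" "\<And>m. m < n \<Longrightarrow> \<not> 1 / 2 ^ m < \<beta>"
        using exists_least_iff[of "\<lambda>k. 1 / 2 ^ k < \<beta>"] by blast
      have n1: "n \<ge> 1" using n(1) beta by (cases n) auto
      have n_half: "\<beta> \<le> 1 / 2 ^ (n - 1)" using n(2)[of "n - 1"] n1 by simp
      have two: "2 / 2 ^ n = (1::real) / 2 ^ (n - 1)" using n1 by (cases n) auto
      interpret p: frostman_points F b1 C \<delta> n
      proof
        fix f \<rho> assume f: "f \<in> F" and \<rho>: "2 / 2 ^ n \<le> (\<rho>::real)"
        have "\<rho> * b1 \<ge> b0"
        proof -
          have "\<beta> \<le> \<rho>" using n_half \<rho> two by simp
          then have "\<beta> * b1 \<le> \<rho> * b1" using b by (intro mult_right_mono) auto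
          then show ?thesis using b by (simp add: \<beta>_def)
        qed
        then have "real (card (rball f (\<rho> * b1) \<inter> F)) / real (card F) \<le> C * (\<rho> * b1 / b1) powr \<delta>"
          using fr by blast
        moreover have "rball f (\<rho> * b1) \<inter> F = {g\<in>F. rnorm (g - f) \<le> \<rho> * b1}" by (auto simp: rball_def)
        moreover have "real (card F) > 0" using False fin by (simp add: card_gt_0_iff)
        ultimately show "real (card {g\<in>F. rnorm (g - f) \<le> \<rho> * b1}) \<le> C * \<rho> powr \<delta> * real (card F)"
          using b by (simp add: pos_divide_le_eq)
      next
        fix f g assume fg: "f \<in> F" "g \<in> F"
        obtain r1 c r2 where f: "f = (r1, c, r2)" by (cases f) auto
        obtain r1' c' r2' where g: "g = (r1', c', r2')" by (cases g) auto
        have "rnorm f \<le> b1" "rnorm g \<le> b1" using ball fg by (auto simp: rball_def)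
        then have *: "\<bar>r1\<bar> \<le> b1" "\<And>i. \<bar>c $ i\<bar> \<le> b1" "\<bar>r2\<bar> \<le> b1" "\<bar>r1'\<bar> \<le> b1" "\<And>i. \<bar>c' $ i\<bar> \<le> b1" "\<bar>r2'\<bar> \<le> b1"
          unfolding f g rnorm_le_iff by auto
        have "\<bar>x - y\<bar> \<le> 2 * b1" if "\<bar>x\<bar> \<le> b1" "\<bar>y\<bar> \<le> b1" for x y using that by linarith
        then show "rnorm (g - f) \<le> 2 * b1" unfolding f g using * by (simp add: rnorm_le_iff)
      qed (use fin False b assms d in auto)
      define N where "N = real (card F)"
      have N0: "N > 0" using False fin by (simp add: N_def card_gt_0_iff)
      let ?M = "lebesgue_on BU :: (real^'m) measure"
      interpret fm: finite_measure ?M by (rule p.finite_measure_BU)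
      \<comment> \<open>Markov's inequality turns the mean 1/10000 of \<open>bad_total\<close> into
        one percent of the parameters at the threshold of one percent of \<open>F\<close>.\<close>
      define W where "W = {s\<in>space ?M. real (card {f\<in>F. s \<in> p.bad A f}) > 0.01 * N}"
      define B where "B = BU - W"
      have W_sets: "W \<in> sets ?M"
      proof -
        have "(\<lambda>s. real (card {f\<in>F. s \<in> p.bad A f})) \<in> borel_measurable ?M"
          using p.bad_sets[measurable] by (intro borel_measurable_card_Collect fin) measurable
        then show ?thesis unfolding W_def by measurable
      qed
      have W_sub: "W \<subseteq> BU" by (auto simp: W_def)
      have "W \<in> sets lebesgue"
        using W_sets sets_restrict_space_iff[OF p.BU_sets] by blast
      then have B_sets: "B \<in> sets lebesgue" unfolding B_def using fmeasurableD[OF p.BU_lmeasurable] by blast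
      have "BU - B = W" using W_sub by (auto simp: B_def)
      moreover have "measure lebesgue W \<le> 0.01 * measure lebesgue (BU :: (real^'m) set)"
      proof -
        have "measure lebesgue W = measure ?M W" by (rule p.measure_on_BU[OF W_sub, symmetric])
        also have "\<dots> \<le> (\<Sum>f\<in>F. measure ?M (p.bad A f)) / (0.01 * N)"
          unfolding W_def by (rule fm.measure_card_gt_le[OF fin p.bad_sets]) (use N0 in simp)
        also have "(\<Sum>f\<in>F. measure ?M (p.bad A f)) = (\<Sum>f\<in>F. measure lebesgue (p.bad A f))"
          by (intro sum.cong refl p.measure_on_BU) (auto simp: p.bad_def)
        also have "\<dots> / (0.01 * N) \<le> (1 / 10000 * measure lebesgue (BU :: (real^'m) set) * N) / (0.01 * N)"
          using A(2)[OF p.frostman_points_axioms] N0 by (intro divide_right_mono) (auto simp: N_def)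
        also have "\<dots> = 0.01 * measure lebesgue (BU :: (real^'m) set)" using N0 by simp
        finally show ?thesis .
      qed
      moreover have "\<exists>Fs. Fs \<subseteq> F \<and> real (card (F - Fs)) \<le> 0.01 * real (card F) \<and>
           (\<forall>Z\<in>Fs. \<forall>b. b \<ge> b0 \<longrightarrow>
              real (card {Z'\<in>Fs. \<bar>xi s Z' - xi s Z\<bar> \<le> b})
                \<le> C\<epsilon> * (b0 / b1) powr (- \<epsilon>) * (b / b1) powr \<delta> * real (card F))"
        if s: "s \<in> B" for s
      proof (intro exI[of _ "{f\<in>F. s \<notin> p.bad A f}"] conjI ballI allI impI)
        have "F - {f\<in>F. s \<notin> p.bad A f} = {f\<in>F. s \<in> p.bad A f}" by auto
        then show "real (card (F - {f\<in>F. s \<notin> p.bad A f})) \<le> 0.01 * real (card F)"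
          using s by (simp add: B_def W_def N_def not_less)
      next
        fix Z b assume Z: "Z \<in> {f\<in>F. s \<notin> p.bad A f}" and bb: "b0 \<le> b"
        define x where "x = b / b1"
        have x_ge: "\<beta> \<le> x" using bb b by (simp add: x_def \<beta>_def divide_right_mono)
        have x0: "x > 0" using x_ge beta by linarith
        have beta_eps: "\<beta> powr (- \<epsilon>) \<ge> 1"
        proof -
          have "1 powr (- \<epsilon>) \<le> \<beta> powr (- \<epsilon>)" using beta assms by (intro powr_mono2') auto
          then show ?thesis by simp
        qed
        have sub: "card {Z'\<in>{f\<in>F. s \<notin> p.bad A f}. \<bar>xi s Z' - xi s Z\<bar> \<le> b} \<le> card {g\<in>F. \<bar>xi s g - xi s Z\<bar> \<le> b'}"
          if "b \<le> b'" for b' using fin that by (intro card_mono) auto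
        have "real (card {Z'\<in>{f\<in>F. s \<notin> p.bad A f}. \<bar>xi s Z' - xi s Z\<bar> \<le> b}) \<le> C\<epsilon> * \<beta> powr (- \<epsilon>) * x powr \<delta> * N"
        proof (cases "x \<ge> 1")
          case True
          have "real (card {Z'\<in>{f\<in>F. s \<notin> p.bad A f}. \<bar>xi s Z' - xi s Z\<bar> \<le> b}) \<le> 1 * 1 * 1 * N"
            unfolding N_def using fin by (auto intro!: card_mono)
          also have "\<dots> \<le> C\<epsilon> * \<beta> powr (- \<epsilon>) * x powr \<delta> * N"
            using Ce1 beta_eps ge_one_powr_ge_zero[OF True, of \<delta>] d N0
            by (intro mult_right_mono mult_mono) auto
          finally show ?thesis .
        next
          case x1: False
          define P where "P i \<longleftrightarrow> x \<le> 1 / 2 ^ i" for i :: nat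
          have "\<not> P n" using n(1) x_ge by (simp add: P_def)
          moreover have "P 0" using x1 by (simp add: P_def)
          ultimately obtain i where i: "i < n" "P i" "\<not> P (Suc i)"
            using ex_least_nat_less[of "\<lambda>i. \<not> P i" n] by (metis Suc_le_lessD less_Suc_eq_le not_less_eq order_refl)
          have "b \<le> b1 / 2 ^ i" using i(2) b by (simp add: P_def x_def field_simps)
          then have "real (card {Z'\<in>{f\<in>F. s \<notin> p.bad A f}. \<bar>xi s Z' - xi s Z\<bar> \<le> b})
              \<le> real (card {g\<in>F. \<bar>xi s g - xi s Z\<bar> \<le> b1 / 2 ^ i})" using sub by simp
          also have "\<dots> \<le> A * C * (real n + 1000) ^ 50 * (1 / 2 ^ i) powr \<delta> * N"
          proof -
            have "s \<in> BU" "s \<notin> p.bad A Z" using Z s by (auto simp: B_def)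
            then have "\<not> real (card {g\<in>F. \<bar>xi s g - xi s Z\<bar> \<le> b1 / 2 ^ i})
                > A * C * (real n + 1000) ^ 50 * (1 / 2 ^ i) powr \<delta> * real (card F)"
              using i(1) unfolding p.bad_def by blast
            then show ?thesis by (simp add: N_def not_less)
          qed
          also have "\<dots> \<le> A * C * (K * \<beta> powr (- \<epsilon>)) * (2 * x powr \<delta>) * N"
          proof -
            have "(real n + 1000) ^ 50 \<le> K * (2 ^ (n - 1)) powr \<epsilon>"
              using K(2)[of "n - 1"] n1 by (simp add: of_nat_diff add.commute)
            also have "\<dots> \<le> K * \<beta> powr (- \<epsilon>)"
            proof (rule mult_left_mono)
              have "2 ^ (n - 1) \<le> 1 / \<beta>" using n_half beta by (simp add: field_simps)
              then have "(2 ^ (n - 1)) powr \<epsilon> \<le> (1 / \<beta>) powr \<epsilon>" using assms by (intro powr_mono2) auto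
              also have "(1 / \<beta>) powr \<epsilon> = \<beta> powr (- \<epsilon>)" using beta by (simp add: powr_divide powr_minus_divide)
              finally show "(2 ^ (n - 1)) powr \<epsilon> \<le> \<beta> powr (- \<epsilon>)" .
            qed (use K in simp)
            finally have 1: "(real n + 1000) ^ 50 \<le> K * \<beta> powr (- \<epsilon>)" .
            have "(1 / 2 ^ i) \<le> 2 * x" using i(3) by (simp add: P_def field_simps)
            then have "(1 / 2 ^ i) powr \<delta> \<le> (2 * x) powr \<delta>" using d by (intro powr_mono2) auto
            also have "\<dots> \<le> 2 * x powr \<delta>" using powr_ratio_le[OF x0, of "2 * x" \<delta>] x0 d by simp
            finally have 2: "(1 / 2 ^ i) powr \<delta> \<le> 2 * x powr \<delta>" .
            show ?thesis using 1 2 A(1) assms N0 K by (intro mult_mono) auto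
          qed
          also have "\<dots> = (2 * A * C * K) * (\<beta> powr (- \<epsilon>) * x powr \<delta> * N)" by simp
          also have "\<dots> \<le> C\<epsilon> * (\<beta> powr (- \<epsilon>) * x powr \<delta> * N)"
            using N0 by (intro mult_right_mono) (auto simp: C\<epsilon>_def)
          finally show ?thesis by (simp add: mult_ac)
        qed
        then show "real (card {Z'\<in>{f\<in>F. s \<notin> p.bad A f}. \<bar>xi s Z' - xi s Z\<bar> \<le> b})
            \<le> C\<epsilon> * (b0 / b1) powr (- \<epsilon>) * (b / b1) powr \<delta> * real (card F)"
          unfolding \<beta>_def x_def N_def .
      qed auto
      ultimately show ?thesis using B_sets by (intro exI[of _ B]) (auto simp: B_def)
    qed
  qed
qed

end
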